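(* Let $k\ge1$, let $a,b,p,q$ be positive integers with $q\le p$, and let $\lambda\in\mathcal P_k$. Let $\mathcal H^\lambda=\mathrm{span}_{\mathbb C}\{v_T\ |\ T\in\mathcal T_\lambda\}$ be the vector space with basis indexed by $\mathcal T_\lambda$. Define an action of $\mathcal H_k^{\mathrm{ext}}$ on $\mathcal H^\lambda$ by $$w_i\cdot v_T=c_T(i)v_T\quad(0\le i\le k),$$ $$t_{s_i}\cdot v_T=[t_i]_{T,T}v_T+[t_i]_{T,s_iT}v_{s_iT}\quad(1\le i\le k-1),\qquad x_1\cdot v_T=[x_1]_{T,T}v_T+[x_1]_{T,s_0T}v_{s_0T},$$ where $$[t_i]_{T,T}=\frac1{c_T(i+1)-c_T(i)},\qquad [t_i]_{T,S}=\sqrt{1-[t_i]_{T,T}^2}\quad\text{for }S=s_iT\ne T,$$ $$[x_1]_{T,T}=\frac{(a-p)c_T(1)+c_T(1)^2+\left(\frac{(a+p)+(b+q)}2\right)\left(\frac{(a+p)-(b+q)}2\right)}{2c_T(1)},$$ and, for $S=s_0T\neq T$, $[x_1]_{T,S}$ equals $$\sqrt{-\tfrac1{(2c_T(1))^2}\left(c_T(1)+\tfrac{(a+p)+(b+q)}2\right)\left(c_T(1)-\tfrac{(a+p)-(b+q)}2\right)\left(c_T(1)-\tfrac{(a+p)+(b+q)}2\right)\left(c_T(1)+\tfrac{(a+p)-(b+q)}2\right)}.$$ With this action, $\mathcal H^\lambda$ is a simple $\mathcal H_k^{\mathrm{ext}}$-module.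
   Context: **Partitions and tableaux.** The box in column $c$ and row $r$ of a partition has content $c-r$, written $c(B)$. $\mathcal P_0=\mathcal P$ is the set of partitions $\lambda$ with at most $p+q$ rows such that $\lambda_{q+1}=\cdots=\lambda_p=a$, $\lambda_q\ge\max(a,b)$, and $\lambda_i+\lambda_{p+q-i+1}=a+b$ for $i=1,\dots,q$. For $i\ge1$, $\mathcal P_i$ is the set of partitions obtained by adding a box to an element of $\mathcal P_{i-1}$. For $\lambda\in\mathcal P_k$, $$\mathcal T_\lambda=\{T=(T^{(0)}\searrow\cdots\searrow T^{(k)}=\lambda)\ |\ T^{(i)}\in\mathcal P_i\},$$ where $T^{(i)}$ is obtained from $T^{(i-1)}$ by adding one box $T^{(i)}/T^{(i-1)}$. Shifted contents: with $\mathcal B_\mu$ the set of boxes of $\mu$ in rows $p+1$ and below and $\mu=T^{(0)}$, $$c_T(0)=abq-(|\mathcal B_\mu|+\tfrac12)(a-p+b-q)+2\sum_{B\in\mathcal B_\mu}c(B),\qquad c_T(i)=c(T^{(i)}/T^{(i-1)})-\tfrac12(a-p+b-q)\ (1\le i\le k).$$ For $1\le i\le k-1$, if $c_T(i)\ne c_T(i+1)\pm1$, $s_iT$ is the tableau obtained from $T$ by switching the order of adding the $i$-th and $(i+1)$-st boxes (only $T^{(i)}$ changes). If $c_T(1)\ne\frac12(\pm(a+p)\pm(b+q))$ for all signs, there are exactly two $\nu\in\mathcal P$ contained in $T^{(1)}$, and $s_0T$ is obtained from $T$ by replacing $T^{(0)}$ with the other one. When $s_iT$ (resp. $s_0T$)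 is not defined, the corresponding off-diagonal coefficient is $0$ and the term is absent. Square roots are the non-negative real ones. **The algebra $\mathcal G_k$.** $S_k$ is the symmetric group, $s_i=(i\ i{+}1)$. $\mathcal G_k$ is the unital associative $\mathbb C$-algebra generated by $t_w$ ($w\in S_k$), $x_1,\dots,x_k$, $y_1,\dots,y_k$, $z_0,\dots,z_k$, subject to the relations below. Here $m_1=0$ and, for $j>1$, $m_j=\sum_{1\le i<j}m_{i,j}$, where $m_{j-1,j}=x_j-t_{s_{j-1}}x_{j-1}t_{s_{j-1}}$ and $m_{i,j}=t_{(i\ j-1)}m_{j-1,j}t_{(i\ j-1)}$ for $1\le i<j-1$. - $z_i=x_i+y_i-m_i$ for $1\le i\le k$; - $t_wt_{w'}=t_{ww'}$ (with $t_e=1$); - $x_ix_j=x_jx_i$, $y_iy_j=y_jy_i$, $z_iz_j=z_jz_i$ for all admissible $i,j$; - $t_{s_i}x_j=x_jt_{s_i}$, $t_{s_i}y_j=y_jt_{s_i}$, $t_{s_i}z_j=z_jt_{s_i}$ for $j\ne i,i+1$; - $(z_0+\cdots+z_i)x_j=x_j(z_0+\cdots+z_i)$ and $(z_0+\cdots+z_i)y_j=y_j(z_0+\cdots+z_i)$ for $i\ge j$; - $t_{s_i}(x_i+x_{i+1})=(x_i+x_{i+1})t_{s_i}$ and $t_{s_i}(y_i+y_{i+1})=(y_i+y_{i+1})t_{s_i}$ for $1\le i\le k-1$; - $t_{s_i}t_{s_{i+1}}(x_{i+1}-t_{s_i}x_it_{s_i})t_{s_{i+1}}t_{s_i}=x_{i+2}-t_{s_{i+1}}x_{i+1}t_{s_{i+1}}$,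 and the same with $y$ in place of $x$, for $1\le i\le k-2$; - $x_{i+1}-t_{s_i}x_it_{s_i}=y_{i+1}-t_{s_i}y_it_{s_i}$ for $1\le i\le k-1$. **The algebra $\mathcal H_k^{\mathrm{ext}}$** is the quotient of $\mathcal G_k$ by $t_{s_i}x_i=x_{i+1}t_{s_i}-1$, $t_{s_i}y_i=y_{i+1}t_{s_i}-1$ ($1\le i\le k-1$), $(x_1-a)(x_1+p)=0$, $(y_1-b)(y_1+q)=0$. Put $w_i=z_i-\frac12(a-p+b-q)$ for $0\le i\le k$; the algebra $\mathcal H_k^{\mathrm{ext}}$ is generated by $w_0,\dots,w_k,x_1,t_{s_1},\dots,t_{s_{k-1}}$.
   Formalization: When c_T(1)=0 (this occurs exactly if a+p=b+q, q<p and the first added box is in row q+1, column a+1), the stated formula for [x_1]_{T,T} reads 0/0; in that case [x_1]_{T,T} is taken to be a. *)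

theory Defs
  imports
    Complex_Main
    "HOL-Library.Poly_Mapping"
    "HOL-Library.Function_Algebras"
    "HOL-Combinatorics.Permutations"
    "HOL-Algebra.QuotRing"
begin

section \<open>Partitions and tableaux\<close>

text \<open>A partition is the function sending the row number \<open>r \<ge> 1\<close> to the length of row \<open>r\<close>.
  There is no row \<open>0\<close>; the value there is fixed to be \<open>0\<close> so that equal partitions are equal
  functions.  The box in row \<open>r\<close> and column \<open>c\<close> is the pair \<open>(r, c)\<close>.\<close>

type_synonym partition = "nat \<Rightarrow> nat"

definition is_partition :: "partition \<Rightarrow> bool" where
  "is_partition lam \<longleftrightarrow>
     lam 0 = 0 \<and> (\<forall>r\<ge>1. lam (Suc r) \<le> lam r) \<and> finite {r. lam r \<noteq> 0}"

definition boxes :: "partition \<Rightarrow> (nat \<times> nat) set" where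
  "boxes lam = {(r, c). 1 \<le> r \<and> 1 \<le> c \<and> c \<le> lam r}"

definition content :: "nat \<times> nat \<Rightarrow> int" where
  "content B = int (snd B) - int (fst B)"

definition adds_box :: "partition \<Rightarrow> partition \<Rightarrow> bool" where
  "adds_box mu nu \<longleftrightarrow> is_partition mu \<and> is_partition nu \<and>
     (\<exists>B. B \<notin> boxes mu \<and> boxes nu = insert B (boxes mu))"

definition P0 :: "nat \<Rightarrow> nat \<Rightarrow> nat \<Rightarrow> nat \<Rightarrow> partition set" where
  "P0 a b p q = {lam. is_partition lam \<and> (\<forall>r>p + q. lam r = 0) \<and>
     (\<forall>r\<in>{q+1..p}. lam r = a) \<and> max a b \<le> lam q \<and>
     (\<forall>i\<in>{1..q}. lam i + lam (p + q - i + 1) = a + b)}"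

fun Pset :: "nat \<Rightarrow> nat \<Rightarrow> nat \<Rightarrow> nat \<Rightarrow> nat \<Rightarrow> partition set" where
  "Pset a b p q 0 = P0 a b p q"
| "Pset a b p q (Suc i) = {nu. \<exists>mu\<in>Pset a b p q i. adds_box mu nu}"

text \<open>A tableau is the list \<open>[T\<^sup>(\<^sup>0\<^sup>), \<dots>, T\<^sup>(\<^sup>k\<^sup>)]\<close>.\<close>

type_synonym tableau = "partition list"

definition tableaux ::
  "nat \<Rightarrow> nat \<Rightarrow> nat \<Rightarrow> nat \<Rightarrow> nat \<Rightarrow> partition \<Rightarrow> tableau set" where
  "tableaux a b p q k lam = {T. length T = k + 1 \<and> T ! k = lam \<and>
     (\<forall>i\<le>k. T ! i \<in> Pset a b p q i) \<and> (\<forall>i<k. adds_box (T ! i) (T ! (i + 1)))}"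

definition half_shift :: "nat \<Rightarrow> nat \<Rightarrow> nat \<Rightarrow> nat \<Rightarrow> real" where
  "half_shift a b p q = (real a - real p + real b - real q) / 2"

definition low_boxes :: "nat \<Rightarrow> partition \<Rightarrow> (nat \<times> nat) set" where
  "low_boxes p mu = {B \<in> boxes mu. p + 1 \<le> fst B}"

definition cont :: "nat \<Rightarrow> nat \<Rightarrow> nat \<Rightarrow> nat \<Rightarrow> tableau \<Rightarrow> nat \<Rightarrow> real" where
  "cont a b p q T i =
     (if i = 0
      then real a * real b * real q
             - (real (card (low_boxes p (T ! 0))) + 1/2) * (real a - real p + real b - real q)
             + 2 * (\<Sum>B\<in>low_boxes p (T ! 0). real_of_int (content B))
      else real_of_int (content (the_elem (boxes (T ! i) - boxes (T ! (i - 1)))))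
             - half_shift a b p q)"

text \<open>The partition replacing \<open>T\<^sup>(\<^sup>i\<^sup>)\<close> in \<open>s\<^sub>i T\<close> consists of \<open>T\<^sup>(\<^sup>i\<^sup>-\<^sup>1\<^sup>)\<close> and the box
  that \<open>T\<close> adds in step \<open>i + 1\<close>.\<close>

definition s_tab :: "nat \<Rightarrow> nat \<Rightarrow> nat \<Rightarrow> nat \<Rightarrow> nat \<Rightarrow> tableau \<Rightarrow> tableau option" where
  "s_tab a b p q i T =
     (if cont a b p q T i \<noteq> cont a b p q T (i + 1) + 1 \<and>
         cont a b p q T i \<noteq> cont a b p q T (i + 1) - 1
      then Some (T[i := (\<lambda>r. (T ! (i - 1)) r + ((T ! (i + 1)) r - (T ! i) r))])
      else None)"

definition half_sum :: "nat \<Rightarrow> nat \<Rightarrow> nat \<Rightarrow> nat \<Rightarrow> real" where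
  "half_sum a b p q = ((real a + real p) + (real b + real q)) / 2"

definition half_diff :: "nat \<Rightarrow> nat \<Rightarrow> nat \<Rightarrow> nat \<Rightarrow> real" where
  "half_diff a b p q = ((real a + real p) - (real b + real q)) / 2"

definition s0_tab :: "nat \<Rightarrow> nat \<Rightarrow> nat \<Rightarrow> nat \<Rightarrow> tableau \<Rightarrow> tableau option" where
  "s0_tab a b p q T =
     (if cont a b p q T 1 \<notin> {half_sum a b p q, - half_sum a b p q,
                              half_diff a b p q, - half_diff a b p q}
      then Some (T[0 := (THE nu. nu \<in> P0 a b p q \<and> nu \<noteq> T ! 0 \<and> boxes nu \<subseteq> boxes (T ! 1))])
      else None)"

definition t_diag :: "nat \<Rightarrow> nat \<Rightarrow> nat \<Rightarrow> nat \<Rightarrow> nat \<Rightarrow> tableau \<Rightarrow> real" where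
  "t_diag a b p q i T = 1 / (cont a b p q T (i + 1) - cont a b p q T i)"

definition t_off :: "nat \<Rightarrow> nat \<Rightarrow> nat \<Rightarrow> nat \<Rightarrow> nat \<Rightarrow> tableau \<Rightarrow> real" where
  "t_off a b p q i T = sqrt (1 - (t_diag a b p q i T)\<^sup>2)"

text \<open>Write \<open>c = c\<^sub>T(1)\<close>, \<open>A = half_sum\<close> and \<open>D = half_diff\<close>.  The diagonal entry of \<open>x\<^sub>1\<close> is
  \<open>((a - p) c + c\<^sup>2 + A D) / (2 c)\<close>.  This reads \<open>0 / 0\<close> exactly if \<open>c = 0\<close>, which does occur:
  it happens when \<open>a + p = b + q\<close>, \<open>q < p\<close>, and the first added box is the one in row \<open>q + 1\<close>
  and column \<open>a + 1\<close>.  For that box \<open>c = D\<close> whatever the parameters are, so that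
  \<open>(a - p) c + c\<^sup>2 + A D = c (a - p + D + A) = 2 a c\<close>, and cancelling \<open>2 c\<close> gives \<open>a\<close>.\<close>

definition x_diag :: "nat \<Rightarrow> nat \<Rightarrow> nat \<Rightarrow> nat \<Rightarrow> tableau \<Rightarrow> real" where
  "x_diag a b p q T =
     (let c = cont a b p q T 1 in
      if c = 0 then real a
      else ((real a - real p) * c + c\<^sup>2 + half_sum a b p q * half_diff a b p q) / (2 * c))"

definition x_off :: "nat \<Rightarrow> nat \<Rightarrow> nat \<Rightarrow> nat \<Rightarrow> tableau \<Rightarrow> real" where
  "x_off a b p q T =
     (let c = cont a b p q T 1 in
      sqrt (- (1 / (2 * c)\<^sup>2) * (c + half_sum a b p q) * (c - half_diff a b p q)
              * (c - half_sum a b p q) * (c + half_diff a b p q)))"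


section \<open>Algebras given by generators and relations\<close>

text \<open>The free complex algebra on a set of letters is the monoid algebra of the free monoid.
  The monoid is written additively because the convolution product of \<open>\<Rightarrow>\<^sub>0\<close> requires it.\<close>

datatype 'a word = Word (letters: "'a list")

instantiation word :: (type) monoid_add
begin

definition zero_word :: "'a word" where
  "0 = Word []"

definition plus_word :: "'a word \<Rightarrow> 'a word \<Rightarrow> 'a word" where
  "u + v = Word (letters u @ letters v)"

instance
  by standard (auto simp: zero_word_def plus_word_def)

end

definition free_algebra :: "'a set \<Rightarrow> ('a word \<Rightarrow>\<^sub>0 complex) ring" where
  "free_algebra S =
     \<lparr>carrier = {f. \<forall>u\<in>Poly_Mapping.keys f. set (letters u) \<subseteq> S},
      mult = (*), one = 1, zero = 0, add = (+)\<rparr>"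

datatype letter = LT "nat \<Rightarrow> nat" | LX nat | LY nat | LZ nat

type_synonym free = "letter word \<Rightarrow>\<^sub>0 complex"

definition gen :: "letter \<Rightarrow> free" where
  "gen l = Poly_Mapping.single (Word [l]) 1"

definition scal :: "complex \<Rightarrow> free" where
  "scal c = Poly_Mapping.single 0 c"

abbreviation tt :: "(nat \<Rightarrow> nat) \<Rightarrow> free" where "tt w \<equiv> gen (LT w)"
abbreviation xx :: "nat \<Rightarrow> free" where "xx i \<equiv> gen (LX i)"
abbreviation yy :: "nat \<Rightarrow> free" where "yy i \<equiv> gen (LY i)"
abbreviation zz :: "nat \<Rightarrow> free" where "zz i \<equiv> gen (LZ i)"

definition alphabet :: "nat \<Rightarrow> letter set" where
  "alphabet k = LT ` {w. w permutes {1..k}} \<union> LX ` {1..k} \<union> LY ` {1..k} \<union> LZ ` {0..k}"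

definition adj :: "nat \<Rightarrow> nat \<Rightarrow> nat" where
  "adj i = Transposition.transpose i (i + 1)"

definition m_pair :: "nat \<Rightarrow> nat \<Rightarrow> free" where
  "m_pair i j =
     (let d = xx j - tt (adj (j - 1)) * xx (j - 1) * tt (adj (j - 1));
          t = tt (Transposition.transpose i (j - 1))
      in if i = j - 1 then d else t * d * t)"

definition m_sum :: "nat \<Rightarrow> free" where
  "m_sum j = (\<Sum>i\<in>{1..<j}. m_pair i j)"

text \<open>\<open>G_rel k u v\<close> says that \<open>u = v\<close> is one of the defining relations.\<close>

inductive G_rel :: "nat \<Rightarrow> free \<Rightarrow> free \<Rightarrow> bool" for k where
  z_def: "i \<in> {1..k} \<Longrightarrow> G_rel k (zz i) (xx i + yy i - m_sum i)"
| t_mult: "w permutes {1..k} \<Longrightarrow> w' permutes {1..k} \<Longrightarrow> G_rel k (tt w * tt w') (tt (w \<circ> w'))"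
| t_id: "G_rel k (tt id) 1"
| x_comm: "i \<in> {1..k} \<Longrightarrow> j \<in> {1..k} \<Longrightarrow> G_rel k (xx i * xx j) (xx j * xx i)"
| y_comm: "i \<in> {1..k} \<Longrightarrow> j \<in> {1..k} \<Longrightarrow> G_rel k (yy i * yy j) (yy j * yy i)"
| z_comm: "i \<in> {0..k} \<Longrightarrow> j \<in> {0..k} \<Longrightarrow> G_rel k (zz i * zz j) (zz j * zz i)"
| t_x: "i \<in> {1..k-1} \<Longrightarrow> j \<in> {1..k} \<Longrightarrow> j \<noteq> i \<Longrightarrow> j \<noteq> i + 1 \<Longrightarrow>
    G_rel k (tt (adj i) * xx j) (xx j * tt (adj i))"
| t_y: "i \<in> {1..k-1} \<Longrightarrow> j \<in> {1..k} \<Longrightarrow> j \<noteq> i \<Longrightarrow> j \<noteq> i + 1 \<Longrightarrow>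
    G_rel k (tt (adj i) * yy j) (yy j * tt (adj i))"
| t_z: "i \<in> {1..k-1} \<Longrightarrow> j \<in> {0..k} \<Longrightarrow> j \<noteq> i \<Longrightarrow> j \<noteq> i + 1 \<Longrightarrow>
    G_rel k (tt (adj i) * zz j) (zz j * tt (adj i))"
| zsum_x: "j \<in> {1..k} \<Longrightarrow> i \<in> {j..k} \<Longrightarrow>
    G_rel k ((\<Sum>l\<in>{0..i}. zz l) * xx j) (xx j * (\<Sum>l\<in>{0..i}. zz l))"
| zsum_y: "j \<in> {1..k} \<Longrightarrow> i \<in> {j..k} \<Longrightarrow>
    G_rel k ((\<Sum>l\<in>{0..i}. zz l) * yy j) (yy j * (\<Sum>l\<in>{0..i}. zz l))"
| t_xsum: "i \<in> {1..k-1} \<Longrightarrow>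
    G_rel k (tt (adj i) * (xx i + xx (i+1))) ((xx i + xx (i+1)) * tt (adj i))"
| t_ysum: "i \<in> {1..k-1} \<Longrightarrow>
    G_rel k (tt (adj i) * (yy i + yy (i+1))) ((yy i + yy (i+1)) * tt (adj i))"
| x_braid: "i \<in> {1..k-2} \<Longrightarrow>
    G_rel k
      (tt (adj i) * tt (adj (i+1)) * (xx (i+1) - tt (adj i) * xx i * tt (adj i)) * tt (adj (i+1)) * tt (adj i))
      (xx (i+2) - tt (adj (i+1)) * xx (i+1) * tt (adj (i+1)))"
| y_braid: "i \<in> {1..k-2} \<Longrightarrow>
    G_rel k
      (tt (adj i) * tt (adj (i+1)) * (yy (i+1) - tt (adj i) * yy i * tt (adj i)) * tt (adj (i+1)) * tt (adj i))
      (yy (i+2) - tt (adj (i+1)) * yy (i+1) * tt (adj (i+1)))"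
| x_y: "i \<in> {1..k-1} \<Longrightarrow>
    G_rel k (xx (i+1) - tt (adj i) * xx i * tt (adj i)) (yy (i+1) - tt (adj i) * yy i * tt (adj i))"

definition G_ideal :: "nat \<Rightarrow> free set" where
  "G_ideal k = genideal (free_algebra (alphabet k)) {u - v | u v. G_rel k u v}"

definition G_alg :: "nat \<Rightarrow> free set ring" where
  "G_alg k = free_algebra (alphabet k) Quot G_ideal k"

definition G_class :: "nat \<Rightarrow> free \<Rightarrow> free set" where
  "G_class k u = G_ideal k +>\<^bsub>free_algebra (alphabet k)\<^esub> u"

inductive H_rel :: "nat \<Rightarrow> nat \<Rightarrow> nat \<Rightarrow> nat \<Rightarrow> nat \<Rightarrow> free \<Rightarrow> free \<Rightarrow> bool" for k a b p q where
  t_x: "i \<in> {1..k-1} \<Longrightarrow> H_rel k a b p q (tt (adj i) * xx i) (xx (i+1) * tt (adj i) - 1)"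
| t_y: "i \<in> {1..k-1} \<Longrightarrow> H_rel k a b p q (tt (adj i) * yy i) (yy (i+1) * tt (adj i) - 1)"
| x_quad: "H_rel k a b p q ((xx 1 - scal (of_nat a)) * (xx 1 + scal (of_nat p))) 0"
| y_quad: "H_rel k a b p q ((yy 1 - scal (of_nat b)) * (yy 1 + scal (of_nat q))) 0"

definition H_ideal :: "nat \<Rightarrow> nat \<Rightarrow> nat \<Rightarrow> nat \<Rightarrow> nat \<Rightarrow> free set set" where
  "H_ideal k a b p q = genideal (G_alg k) {G_class k (u - v) | u v. H_rel k a b p q u v}"

definition H_ext :: "nat \<Rightarrow> nat \<Rightarrow> nat \<Rightarrow> nat \<Rightarrow> nat \<Rightarrow> free set set ring" where
  "H_ext k a b p q = G_alg k Quot H_ideal k a b p q"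

definition H_class :: "nat \<Rightarrow> nat \<Rightarrow> nat \<Rightarrow> nat \<Rightarrow> nat \<Rightarrow> free \<Rightarrow> free set set" where
  "H_class k a b p q u = H_ideal k a b p q +>\<^bsub>G_alg k\<^esub> G_class k u"

definition ww :: "nat \<Rightarrow> nat \<Rightarrow> nat \<Rightarrow> nat \<Rightarrow> nat \<Rightarrow> free" where
  "ww a b p q i = zz i - scal (of_real (half_shift a b p q))"


section \<open>Modules over complex algebras\<close>

text \<open>A complex algebra is given by a ring \<open>R\<close> and the map \<open>\<iota>\<close> sending a scalar \<open>c\<close> to
  \<open>c \<cdot> 1\<close>.  A module over it is a subspace \<open>M\<close> of a complex vector space on which \<open>R\<close> acts
  from the left, with \<open>\<iota> c\<close> acting as the scalar \<open>c\<close>.\<close>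

locale algebra_module =
  ring R + VS: vector_space scl
  for R (structure)
    and \<iota> :: "complex \<Rightarrow> 'r"
    and scl :: "complex \<Rightarrow> 'v::ab_group_add \<Rightarrow> 'v"
    and M :: "'v set"
    and act :: "'r \<Rightarrow> 'v \<Rightarrow> 'v" +
  assumes subspace_M: "VS.subspace M"
    and act_closed: "g \<in> carrier R \<Longrightarrow> u \<in> M \<Longrightarrow> act g u \<in> M"
    and act_add_right: "g \<in> carrier R \<Longrightarrow> u \<in> M \<Longrightarrow> v \<in> M \<Longrightarrow> act g (u + v) = act g u + act g v"
    and act_add_left: "g \<in> carrier R \<Longrightarrow> h \<in> carrier R \<Longrightarrow> u \<in> M \<Longrightarrow>
      act (g \<oplus> h) u = act g u + act h u"
    and act_mult: "g \<in> carrier R \<Longrightarrow> h \<in> carrier R \<Longrightarrow> u \<in> M \<Longrightarrow>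
      act (g \<otimes> h) u = act g (act h u)"
    and act_one: "u \<in> M \<Longrightarrow> act \<one> u = u"
    and act_scalar: "u \<in> M \<Longrightarrow> act (\<iota> c) u = scl c u"

locale simple_algebra_module = algebra_module +
  assumes nonzero: "M \<noteq> {0}"
    and submodule_trivial: "VS.subspace N \<Longrightarrow> N \<subseteq> M \<Longrightarrow>
      (\<And>g u. g \<in> carrier R \<Longrightarrow> u \<in> N \<Longrightarrow> act g u \<in> N) \<Longrightarrow> N = {0} \<or> N = M"


section \<open>The seminormal module\<close>

definition cscale :: "complex \<Rightarrow> (tableau \<Rightarrow> complex) \<Rightarrow> (tableau \<Rightarrow> complex)" where
  "cscale c f = (\<lambda>T. c * f T)"

interpretation cscale: vector_space cscale
  by standard (auto simp: cscale_def fun_eq_iff algebra_simps)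

definition basis_vec :: "tableau \<Rightarrow> (tableau \<Rightarrow> complex)" where
  "basis_vec T = (\<lambda>S. if S = T then 1 else 0)"

definition H_lam ::
  "nat \<Rightarrow> nat \<Rightarrow> nat \<Rightarrow> nat \<Rightarrow> nat \<Rightarrow> partition \<Rightarrow> (tableau \<Rightarrow> complex) set" where
  "H_lam k a b p q lam = cscale.span (basis_vec ` tableaux a b p q k lam)"

text \<open>The vector \<open>d v\<^sub>T + e v\<^sub>S\<close> if the partner tableau \<open>S\<close> of \<open>T\<close> is defined, otherwise \<open>d v\<^sub>T\<close>.\<close>

definition two_term :: "real \<Rightarrow> real \<Rightarrow> tableau \<Rightarrow> tableau option \<Rightarrow> (tableau \<Rightarrow> complex)" where
  "two_term d e T S' =
     cscale (of_real d) (basis_vec T) +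
     (case S' of None \<Rightarrow> 0 | Some S \<Rightarrow> cscale (of_real e) (basis_vec S))"

definition seminormal_formulas ::
  "nat \<Rightarrow> nat \<Rightarrow> nat \<Rightarrow> nat \<Rightarrow> nat \<Rightarrow> partition \<Rightarrow>
   (free set set \<Rightarrow> (tableau \<Rightarrow> complex) \<Rightarrow> (tableau \<Rightarrow> complex)) \<Rightarrow> bool" where
  "seminormal_formulas k a b p q lam act \<longleftrightarrow>
     (\<forall>T\<in>tableaux a b p q k lam.
        (\<forall>i\<in>{0..k}. act (H_class k a b p q (ww a b p q i)) (basis_vec T) =
           cscale (of_real (cont a b p q T i)) (basis_vec T)) \<and>
        (\<forall>i\<in>{1..k-1}. act (H_class k a b p q (tt (adj i))) (basis_vec T) =
           two_term (t_diag a b p q i T) (t_off a b p q i T) T (s_tab a b p q i T)) \<and>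
        act (H_class k a b p q (xx 1)) (basis_vec T) =
           two_term (x_diag a b p q T) (x_off a b p q T) T (s0_tab a b p q T))"

end

theory Submission
  imports Defs
begin

text \<open>
  The tableau \<open>T\<close> is determined by \<open>\<lambda>\<close> and its sequence of shifted contents, its weight, because the
  last box is the removable box of \<open>\<lambda>\<close> of the given content.  In terms of weights, \<open>s\<^sub>i\<close> swaps two
  entries and \<open>s\<^sub>0\<close> sends \<open>(c\<^sub>0, c\<^sub>1)\<close> to \<open>(c\<^sub>0 + 2 c\<^sub>1, - c\<^sub>1)\<close>, so the generators act on functions of
  weights by a diagonal part plus a weighted reflection, the amplitude of the reflection vanishing
  whenever the reflected weight is not the weight of a tableau.  Every relation then becomes a rational
  identity in the entries of one weight.  The ones that are not formal are the braid relation, and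
  \<open>x\<^sub>1 x\<^sub>2 = x\<^sub>2 x\<^sub>1\<close>, a braid relation of type \<open>B\<^sub>2\<close>.  The latter follows from
  \<open>c k(c) = A D / 2\<close> and \<open>k(c)\<^sup>2 + w(c)\<^sup>2 + c\<^sup>2 / 4 = (A\<^sup>2 + D\<^sup>2) / 4\<close>, where
  \<open>(a - p) / 2 + c / 2 + k(c)\<close> and \<open>w(c)\<close> are the diagonal and off-diagonal coefficients of \<open>x\<^sub>1\<close>.
  All other relations of \<open>\<H>\<^sub>k\<close> are consequences in an arbitrary ring, once the transpositions are
  extended to the symmetric group by means of its Coxeter presentation.

  For simplicity, a nonzero submodule contains a basis vector, since the joint spectrum of the \<open>w\<^sub>i\<close> is
  simple, and then all of them, since any two tableaux are joined by moves \<open>s\<^sub>i\<close> and \<open>s\<^sub>0\<close> with nonzero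
  amplitudes: moves \<open>s\<^sub>i\<close> with \<open>i \<ge> 1\<close> join tableaux with the same \<open>T\<^sup>(\<^sup>0\<^sup>)\<close>, and \<open>s\<^sub>0\<close> moves \<open>T\<^sup>(\<^sup>0\<^sup>)\<close>
  one box closer to that of the other tableau.
\<close>

section \<open>The Coxeter presentation of the symmetric group\<close>

text \<open>The coefficients of x_1 are forced. On the plane of two weights with first entries c and
  -c, the matrices x = x_1 - (a-p)/2 and y = y_1 - (b-q)/2 add up to C = diag(c, -c) and have the
  squares ((A+D)/2)^2 and ((A-D)/2)^2. Expanding y^2 = (C - x)^2 gives C x + x C = c^2 + A D, hence
  the diagonal entry c/2 + A D/(2c) of x; then x^2 gives the off-diagonal entry up to sign. So the
  quadratic relations hold by design, and the real question is how these planes fit together with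
  t_{s_1}: the commutation of x_1 and x_2.

  The obstacle is that the coefficients and identities are rational in the weight, with possible
  poles at c_1 = 0, c_2 = 0 and c_1 + c_2 = 0, and tableaux do meet such weights. The identities
  therefore carry the amplitudes as factors, and the shape of the partitions in P_0 shows that at
  such a weight either these factors vanish or D = 0 removes the pole.\<close>

locale coxeter_type_A = Groups.monoid f e
  for f :: "'a \<Rightarrow> 'a \<Rightarrow> 'a" (infixl "\<cdot>" 70) and e :: 'a +
  fixes g :: "nat \<Rightarrow> 'a" and N :: nat
  assumes g_sq: "i \<in> {1..N} \<Longrightarrow> g i \<cdot> g i = e"
    and g_far: "i \<in> {1..N} \<Longrightarrow> j \<in> {1..N} \<Longrightarrow> i + 2 \<le> j \<Longrightarrow> g i \<cdot> g j = g j \<cdot> g i"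
    and g_braid: "i \<in> {1..<N} \<Longrightarrow> g i \<cdot> g (i + 1) \<cdot> g i = g (i + 1) \<cdot> g i \<cdot> g (i + 1)"
begin

inductive_set words :: "nat \<Rightarrow> 'a set" for n where
  words_e: "e \<in> words n"
| words_g: "x \<in> words n \<Longrightarrow> i \<in> {1..n} \<Longrightarrow> x \<cdot> g i \<in> words n"

text \<open>\<open>descent m l\<close> is g_m g_(m-1) ... g_(m-l+1). For l = 0, ..., m these
  represent the right cosets of S_m in S_(m+1), where \<open>words n\<close> plays the part of
  S_(n+1).\<close>

primrec descent :: "nat \<Rightarrow> nat \<Rightarrow> 'a" where
  "descent m 0 = e"
| "descent m (Suc l) = descent m l \<cdot> g (m - l)"

lemma words_mult: "y \<in> words n \<Longrightarrow> x \<in> words n \<Longrightarrow> x \<cdot> y \<in> words n"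
  by (induction rule: words.induct) (auto simp: assoc[symmetric] intro: words.intros)

lemma words_mono: "x \<in> words n \<Longrightarrow> n \<le> n' \<Longrightarrow> x \<in> words n'"
  by (induction rule: words.induct) (auto intro: words.intros)

lemma words_gen: "i \<in> {1..n} \<Longrightarrow> g i \<in> words n"
  using words_g[OF words_e] by simp

lemma descent_words: "l \<le> m \<Longrightarrow> descent m l \<in> words m"
  by (induction l) (auto intro!: words.intros)

lemma descent_mult_low:
  assumes "m \<le> N" "1 \<le> i" "i < m - l"
  shows "descent m l \<cdot> g i = g i \<cdot> descent m l"
  using assms(3)
proof (induction l)
  case (Suc l)
  have "descent m (Suc l) \<cdot> g i = descent m l \<cdot> (g (m - l) \<cdot> g i)"
    by (simp add: assoc)
  also have "g (m - l) \<cdot> g i = g i \<cdot> g (m - l)"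
    using g_far[of i "m - l"] assms Suc.prems by auto
  also have "descent m l \<cdot> (g i \<cdot> g (m - l)) = descent m l \<cdot> g i \<cdot> g (m - l)"
    by (simp add: assoc)
  also have "\<dots> = g i \<cdot> descent m (Suc l)"
    using Suc by (simp add: assoc)
  finally show ?case .
qed simp

text \<open>A single braid move g_i g_(i-1) g_i = g_(i-1) g_i g_(i-1): the factors to the right of
  g_(i-1) commute with g_i, and those to the left of g_i commute with the new g_(i-1).\<close>

lemma descent_mult_high:
  assumes "m \<le> N" "i \<le> m" "l \<le> m" "m - l + 1 < i"
  shows "descent m l \<cdot> g i = g (i - 1) \<cdot> descent m l"
  using assms(3,4)
proof (induction l)
  case (Suc l)
  show ?case
  proof (cases "i = m - l + 1")
    case True
    then obtain l' where l: "l = Suc l'"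
      using \<open>i \<le> m\<close> Suc.prems by (cases l) auto
    let ?j = "m - l"
    have j: "m - l' = ?j + 1" "?j \<ge> 1" "?j < N"
      using l Suc.prems assms by auto
    have "descent m (Suc l) \<cdot> g i = descent m l' \<cdot> (g (?j + 1) \<cdot> g ?j \<cdot> g (?j + 1))"
      using True j l by (simp add: assoc)
    also have "g (?j + 1) \<cdot> g ?j \<cdot> g (?j + 1) = g ?j \<cdot> g (?j + 1) \<cdot> g ?j"
      using g_braid[of ?j] j by simp
    also have "descent m l' \<cdot> (g ?j \<cdot> g (?j + 1) \<cdot> g ?j)
        = (descent m l' \<cdot> g ?j) \<cdot> g (?j + 1) \<cdot> g ?j"
      by (simp add: assoc)
    also have "descent m l' \<cdot> g ?j = g ?j \<cdot> descent m l'"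
      by (rule descent_mult_low) (use j assms in auto)
    finally show ?thesis
      using True j l by (simp add: assoc)
  next
    case False
    have "descent m (Suc l) \<cdot> g i = descent m l \<cdot> (g (m - l) \<cdot> g i)"
      by (simp add: assoc)
    also have "g (m - l) \<cdot> g i = g i \<cdot> g (m - l)"
      using g_far[of "m - l" i] assms Suc.prems False by auto
    also have "descent m l \<cdot> (g i \<cdot> g (m - l)) = descent m l \<cdot> g i \<cdot> g (m - l)"
      by (simp add: assoc)
    also have "descent m l \<cdot> g i = g (i - 1) \<cdot> descent m l"
      using Suc False by auto
    finally show ?thesis
      by (simp add: assoc)
  qed
qed (use assms in auto)

text \<open>Right multiplication by g_i lengthens the descent, cancels its last factor, or passes
  through it as g_i or g_(i-1), which is absorbed by \<open>words n\<close>.\<close>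

lemma words_normal_form:
  assumes "x \<in> words (Suc n)" "Suc n \<le> N"
  shows "\<exists>y\<in>words n. \<exists>l\<le>Suc n. x = y \<cdot> descent (Suc n) l"
  using assms(1)
proof (induction rule: words.induct)
  case words_e
  show ?case
    by (rule bexI[of _ e], rule exI[of _ 0]) (auto intro: words.words_e)
next
  case (words_g x i)
  then obtain y l where y: "y \<in> words n" and l: "l \<le> Suc n" and x: "x = y \<cdot> descent (Suc n) l"
    by auto
  let ?D = "descent (Suc n)"
  consider "i = Suc n - l" | "i = Suc n - l + 1" | "i < Suc n - l" | "Suc n - l + 1 < i"
    by linarith
  then show ?case
  proof cases
    case 1
    then show ?thesis
      using words_g.hyps y l x
      by (intro bexI[OF _ y] exI[of _ "Suc l"]) (auto simp: assoc)
  next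
    case 2
    then obtain l' where l': "l = Suc l'"
      using words_g.hyps by (cases l) auto
    have "g (Suc n - l') \<cdot> g i = e"
      using g_sq[of i] 2 l' l words_g.hyps assms(2) by (auto simp: Suc_diff_le)
    then have "x \<cdot> g i = y \<cdot> ?D l'"
      by (simp add: x l' assoc)
    then show ?thesis
      using y l l' by (intro bexI[OF _ y] exI[of _ l']) auto
  next
    case 3
    then have "x \<cdot> g i = (y \<cdot> g i) \<cdot> ?D l"
      using descent_mult_low[of "Suc n" i l] words_g.hyps assms(2) by (simp add: x assoc)
    moreover have "y \<cdot> g i \<in> words n"
      using y words_g.hyps 3 by (intro words.words_g) auto
    ultimately show ?thesis
      using l by auto
  next
    case 4
    then have "x \<cdot> g i = (y \<cdot> g (i - 1)) \<cdot> ?D l"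
      using descent_mult_high[of "Suc n" i l] words_g.hyps assms(2) l by (simp add: x assoc)
    moreover have "y \<cdot> g (i - 1) \<in> words n"
      using y words_g.hyps 4 by (intro words.words_g) auto
    ultimately show ?thesis
      using l by auto
  qed
qed

end

section \<open>Adjacent transpositions, and words compared with permutations\<close>

lemma adj_permutes: "i \<in> S \<Longrightarrow> Suc i \<in> S \<Longrightarrow> adj i permutes S"
  unfolding adj_def by (rule permutes_swap_id) auto

lemma adj_involution [simp]: "adj i \<circ> adj i = id" "adj i (adj i x) = x"
  by (auto simp: adj_def)

lemma adj_apply: "adj i i = Suc i" "adj i (Suc i) = i" "j \<noteq> i \<Longrightarrow> j \<noteq> Suc i \<Longrightarrow> adj i j = j"
  by (auto simp: adj_def)

lemma adj_commute: "i + 2 \<le> j \<Longrightarrow> adj i \<circ> adj j = adj j \<circ> adj i"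
  by (auto simp: adj_def fun_eq_iff Transposition.transpose_def)

lemma adj_braid: "adj i \<circ> adj (Suc i) \<circ> adj i = adj (Suc i) \<circ> adj i \<circ> adj (Suc i)"
  by (auto simp: adj_def fun_eq_iff Transposition.transpose_def)

text \<open>Words are evaluated in the product of the monoid of functions with \<open>'r\<close>, so
  that each carries its permutation together with its image; the normal form shows that this
  relation is the graph of a map. The last conclusion is an induction over products of the
  \<open>t i\<close>, by which closure properties pass to every \<open>\<rho> w\<close>.\<close>

theorem symmetric_group_presentation:
  fixes t :: "nat \<Rightarrow> 'r::monoid_mult" and k :: nat
  assumes sq: "\<And>i. i \<in> {1..k-1} \<Longrightarrow> t i * t i = 1"
    and far: "\<And>i j. i \<in> {1..k-1} \<Longrightarrow> j \<in> {1..k-1} \<Longrightarrow> i + 2 \<le> j \<Longrightarrow> t i * t j = t j * t i"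
    and braid: "\<And>i. i \<in> {1..<k-1} \<Longrightarrow> t i * t (i + 1) * t i = t (i + 1) * t i * t (i + 1)"
  obtains \<rho> where "\<rho> id = 1"
    and "\<And>w w'. w permutes {1..k} \<Longrightarrow> w' permutes {1..k} \<Longrightarrow> \<rho> (w \<circ> w') = \<rho> w * \<rho> w'"
    and "\<And>i. i \<in> {1..k-1} \<Longrightarrow> \<rho> (adj i) = t i"
    and "\<And>P w. w permutes {1..k} \<Longrightarrow> P 1 \<Longrightarrow> (\<And>r i. P r \<Longrightarrow> i \<in> {1..k-1} \<Longrightarrow> P (r * t i)) \<Longrightarrow> P (\<rho> w)"
proof -
  define pm :: "(nat \<Rightarrow> nat) \<times> 'r \<Rightarrow> (nat \<Rightarrow> nat) \<times> 'r \<Rightarrow> (nat \<Rightarrow> nat) \<times> 'r" where "pm u v = (fst u \<circ> fst v, snd u * snd v)" for u v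
  have pm_simps: "fst (pm u v) = fst u \<circ> fst v" "snd (pm u v) = snd u * snd v" for u v
    by (simp_all add: pm_def)
  define g where "g i = (adj i, t i)" for i
  have g_simps: "fst (g i) = adj i" "snd (g i) = t i" for i
    by (simp_all add: g_def)
  define e where "e = (id :: nat \<Rightarrow> nat, 1 :: 'r)"
  have e_simps: "fst e = id" "snd e = 1"
    by (simp_all add: e_def)
  interpret C: coxeter_type_A pm e g "k - 1"
  proof
    show "pm (pm a b) c = pm a (pm b c)" for a b c
      by (simp add: pm_def o_assoc mult.assoc)
    show "pm e a = a" "pm a e = a" for a
      by (simp_all add: pm_def e_def)
    show "pm (g i) (g i) = e" if "i \<in> {1..k - 1}" for i
      using sq[OF that] by (simp add: pm_def g_def e_def)
    show "pm (g i) (g j) = pm (g j) (g i)"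
      if "i \<in> {1..k - 1}" "j \<in> {1..k - 1}" "i + 2 \<le> j" for i j
      using far[OF that] adj_commute[OF that(3)] by (simp add: pm_def g_def)
    show "pm (pm (g i) (g (i + 1))) (g i) = pm (pm (g (i + 1)) (g i)) (g (i + 1))"
      if "i \<in> {1..<k - 1}" for i
      using braid[OF that] adj_braid by (simp add: pm_def g_def)
  qed
  have perm: "fst x permutes {1..Suc n}" if "x \<in> C.words n" for x n
    using that
  proof (induction rule: C.words.induct)
    case (words_g x i)
    have "adj i permutes {1..Suc n}"
      by (rule adj_permutes) (use words_g.hyps in auto)
    from permutes_compose[OF this words_g.IH] show ?case
      by (simp add: pm_def g_def comp_def)
  qed (simp add: permutes_def e_simps)
  have D_bij: "bij (fst (C.descent m l))" for m l
  proof (induction l)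
    case (Suc l)
    show ?case
      unfolding C.descent.simps pm_simps g_simps adj_def by (rule bij_comp[OF bij_transpose Suc.IH])
  next
    case 0
    show ?case
      by (simp add: e_simps bij_id[unfolded id_def])
  qed
  have D_top: "fst (C.descent m l) (Suc m - l) = Suc m" if "l \<le> m" for m l
    using that by (induction l) (auto simp: pm_simps g_simps adj_apply Suc_diff_le e_simps)
  have unique: "r = r'" if "(w, r) \<in> C.words n" "(w, r') \<in> C.words n" "n \<le> k - 1" for w r r' n
    using that
  proof (induction n arbitrary: w r r')
    case 0
    have "x = e" if "x \<in> C.words 0" for x
      using that by cases auto
    from this[OF 0(1)] this[OF 0(2)] show ?case by (simp add: e_def)
  next
    case (Suc n)
    obtain y l where y: "y \<in> C.words n" "l \<le> Suc n" "(w, r) = pm y (C.descent (Suc n) l)"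
      using C.words_normal_form[OF Suc.prems(1,3)] by auto
    obtain y' l' where y': "y' \<in> C.words n" "l' \<le> Suc n" "(w, r') = pm y' (C.descent (Suc n) l')"
      using C.words_normal_form[OF Suc.prems(2,3)] by auto
    \<comment> \<open>\<open>fst y\<close> fixes the top point, so the coset representative alone
      decides where \<open>w\<close> attains it. This recovers \<open>l\<close> from
      \<open>w\<close>.\<close>
    have top: "w (Suc (Suc n) - l) = Suc (Suc n)"
      if "y \<in> C.words n" "l \<le> Suc n" "(w, r) = pm y (C.descent (Suc n) l)" for y l r
    proof -
      have "w (Suc (Suc n) - l) = fst y (Suc (Suc n))"
        using that(3) D_top[OF that(2)] by (simp add: pm_def)
      then show ?thesis
        using perm[OF that(1)] by (simp add: permutes_not_in)
    qed
    have "inj w"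
      using perm[OF Suc.prems(1)] permutes_inj by auto
    with top[OF y] top[OF y'] have "Suc (Suc n) - l = Suc (Suc n) - l'"
      by (metis injD)
    then have l': "l' = l"
      using y(2) y'(2) by linarith
    have "fst y \<circ> fst (C.descent (Suc n) l) = fst y' \<circ> fst (C.descent (Suc n) l)"
      using y(3) y'(3) l' by (simp add: pm_def)
    moreover have "surj (fst (C.descent (Suc n) l))"
      using D_bij bij_is_surj by blast
    ultimately have "fst y = fst y'"
      by (metis surj_fun_eq)
    then have "snd y = snd y'"
      using Suc.IH y(1) y'(1) Suc.prems(3) by (metis Suc_leD prod.collapse)
    then show ?case
      using y(3) y'(3) l' by (simp add: pm_def)
  qed
  have total: "\<exists>r. (w, r) \<in> C.words n" if "w permutes {1..Suc n}" for w n
    using that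
  proof (induction n arbitrary: w)
    case 0
    then have w: "w = id"
      by simp
    have "(id, 1) \<in> C.words 0"
      using C.words_e unfolding e_def .
    then show ?case
      unfolding w by blast
  next
    case (Suc n)
    \<comment> \<open>The preimage of the top point dictates the coset: the descent chosen below
      sends \<open>j\<close> to the top, so that \<open>v\<close> fixes the top.\<close>
    define j where "j = inv_into UNIV w (Suc (Suc n))"
    have wj: "w j = Suc (Suc n)"
      using permutes_inverses(1)[OF Suc.prems] by (simp add: j_def)
    have j: "j \<in> {1..Suc (Suc n)}"
      using permutes_in_image[OF Suc.prems, of j] wj by auto
    define l where "l = Suc (Suc n) - j"
    have l: "l \<le> Suc n" "Suc (Suc n) - l = j"
      using j by (auto simp: l_def)
    let ?D = "fst (C.descent (Suc n) l)"
    have Dw: "C.descent (Suc n) l \<in> C.words (Suc n)"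
      by (rule C.descent_words) (use l in auto)
    have Dp: "?D permutes {1..Suc (Suc n)}"
      using perm[OF Dw] .
    define v where "v = w \<circ> inv_into UNIV ?D"
    have vp: "v permutes {1..Suc (Suc n)}"
      unfolding v_def by (intro permutes_compose permutes_inv Dp Suc.prems)
    have "inv_into UNIV ?D (Suc (Suc n)) = j"
      using D_top[OF l(1)] l(2) permutes_inverses(2)[OF Dp] by metis
    then have vtop: "v (Suc (Suc n)) = Suc (Suc n)"
      by (simp add: v_def wj)
    have "v permutes {1..Suc n}"
      by (rule permutes_superset[OF vp]) (use vtop in \<open>auto simp: not_le le_Suc_eq\<close>)
    from Suc.IH[OF this] obtain r where "(v, r) \<in> C.words n" ..
    then have "pm (v, r) (C.descent (Suc n) l) \<in> C.words (Suc n)"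
      using Dw C.words_mono[of _ n "Suc n"] by (intro C.words_mult) auto
    moreover have "w = v \<circ> ?D"
      using permutes_inv_o(2)[OF Dp] by (simp add: v_def comp_assoc)
    then have "pm (v, r) (C.descent (Suc n) l) = (w, r * snd (C.descent (Suc n) l))"
      by (simp add: pm_def)
    ultimately show ?case
      by metis
  qed
  define \<rho> where "\<rho> w = (THE r. (w, r) \<in> C.words (k - 1))" for w
  have \<rho>I: "\<rho> w = r" if "(w, r) \<in> C.words (k - 1)" for w r
    unfolding \<rho>_def using that unique by blast
  have \<rho>_words: "(w, \<rho> w) \<in> C.words (k - 1)" if "w permutes {1..k}" for w
  proof -
    have "w permutes {1..Suc (k - 1)}"
      using that by (rule permutes_subset) auto
    from total[OF this] \<rho>I show ?thesis by blast
  qed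
  show ?thesis
  proof
    show "\<rho> id = 1"
      using C.words_e by (intro \<rho>I) (simp add: e_def)
    show "\<rho> (w \<circ> w') = \<rho> w * \<rho> w'" if "w permutes {1..k}" "w' permutes {1..k}" for w w'
      using C.words_mult[OF \<rho>_words[OF that(2)] \<rho>_words[OF that(1)]]
      by (intro \<rho>I) (simp add: pm_def)
    show "\<rho> (adj i) = t i" if "i \<in> {1..k-1}" for i
      using C.words_gen[OF that] by (intro \<rho>I) (simp add: g_def)
    show "P (\<rho> w)"
      if "w permutes {1..k}" "P 1" "\<And>r i. P r \<Longrightarrow> i \<in> {1..k-1} \<Longrightarrow> P (r * t i)" for P w
    proof -
      note P = that
      have "P (snd x)" if "x \<in> C.words (k - 1)" for x
        using that
        by (induction rule: C.words.induct) (auto simp: e_simps pm_simps g_simps intro: P(2,3))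
      from this[OF \<rho>_words[OF P(1)]] show ?thesis by simp
    qed
  qed
qed

section \<open>Linear operators and the free algebra\<close>

text \<open>A type of its own makes the linear operators an instance of \<open>ring_1\<close>, so
  that the consequences of the relations, derived for an arbitrary ring, apply to them
  directly.\<close>

typedef 'i op = "{F :: ('i \<Rightarrow> complex) \<Rightarrow> ('i \<Rightarrow> complex).
    (\<forall>\<phi> \<psi>. F (\<lambda>i. \<phi> i + \<psi> i) = (\<lambda>i. F \<phi> i + F \<psi> i)) \<and> (\<forall>c \<phi>. F (\<lambda>i. c * \<phi> i) = (\<lambda>i. c * F \<phi> i))}"
  morphisms app Op
  by (rule exI[of _ "\<lambda>\<phi>. \<phi>"]) simp

setup_lifting type_definition_op

lemma op_eqI: "(\<And>\<phi> i. app F \<phi> i = app G \<phi> i) \<Longrightarrow> F = G"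
  by (metis app_inject ext)

lemma app_add_fun: "app F (\<lambda>i. \<phi> i + \<psi> i) = (\<lambda>i. app F \<phi> i + app F \<psi> i)"
  and app_cmult_fun: "app F (\<lambda>i. c * \<phi> i) = (\<lambda>i. c * app F \<phi> i)"
  using app[of F] by blast+

instantiation op :: (type) ring_1
begin

lift_definition zero_op :: "'a op" is "\<lambda>\<phi> i. 0" by simp
lift_definition one_op :: "'a op" is "\<lambda>\<phi>. \<phi>" by simp
lift_definition plus_op :: "'a op \<Rightarrow> 'a op \<Rightarrow> 'a op" is "\<lambda>F G \<phi> i. F \<phi> i + G \<phi> i"
  by (auto simp: fun_eq_iff algebra_simps)
lift_definition minus_op :: "'a op \<Rightarrow> 'a op \<Rightarrow> 'a op" is "\<lambda>F G \<phi> i. F \<phi> i - G \<phi> i"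
  by (auto simp: fun_eq_iff algebra_simps)
lift_definition uminus_op :: "'a op \<Rightarrow> 'a op" is "\<lambda>F \<phi> i. - F \<phi> i"
  by (auto simp: fun_eq_iff algebra_simps)
lift_definition times_op :: "'a op \<Rightarrow> 'a op \<Rightarrow> 'a op" is "\<lambda>F G \<phi>. F (G \<phi>)"
  by auto

instance
proof
  have "(\<lambda>\<phi>::'a \<Rightarrow> complex. \<lambda>i. 0) \<noteq> (\<lambda>\<phi>. \<phi>)"
    by (metis one_neq_zero)
  then show "(0::'a op) \<noteq> 1"
    by transfer
qed (transfer; simp add: fun_eq_iff algebra_simps)+

end

lemma app_simps [simp]:
  "app 0 \<phi> i = 0" "app 1 \<phi> = \<phi>" "app (F + G) \<phi> i = app F \<phi> i + app G \<phi> i"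
  "app (F - G) \<phi> i = app F \<phi> i - app G \<phi> i" "app (- F) \<phi> i = - app F \<phi> i"
  "app (F * G) \<phi> = app F (app G \<phi>)"
  by (transfer; simp)+

lift_definition scalar_op :: "complex \<Rightarrow> 'i op" is "\<lambda>c \<phi> i. c * \<phi> i"
  by (auto simp: algebra_simps)

lemma app_scalar_op [simp]: "app (scalar_op c) \<phi> i = c * \<phi> i"
  by transfer simp

section \<open>Evaluation of noncommutative polynomials\<close>

lemma letters_simps [simp]: "letters 0 = []" "letters (u + v) = letters u @ letters v"
  by (simp_all add: zero_word_def plus_word_def)

lemma poly_mapping_as_sum:
  "f = (\<Sum>u\<in>Poly_Mapping.keys f. Poly_Mapping.single u (Poly_Mapping.lookup f u))"
proof (rule poly_mapping_eqI)
  fix v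
  show "Poly_Mapping.lookup f v
      = Poly_Mapping.lookup (\<Sum>u\<in>Poly_Mapping.keys f. Poly_Mapping.single u (Poly_Mapping.lookup f u)) v"
    by (auto simp: lookup_sum lookup_single when_def in_keys_iff)
qed

text \<open>A unital ring map from the complex numbers into the centre makes \<open>'r\<close> a
  complex algebra; \<open>eval\<close> is then the homomorphism given by the universal property of
  the free algebra.\<close>

locale central_scalars =
  fixes \<kappa> :: "complex \<Rightarrow> 'r::ring_1"
  assumes \<kappa>_add: "\<kappa> (c + d) = \<kappa> c + \<kappa> d"
    and \<kappa>_mult: "\<kappa> (c * d) = \<kappa> c * \<kappa> d"
    and \<kappa>_one: "\<kappa> 1 = 1"
    and \<kappa>_central: "\<kappa> c * r = r * \<kappa> c"
begin

lemma \<kappa>_zero: "\<kappa> 0 = 0"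
  by (metis \<kappa>_add add_cancel_right_right)

definition eval :: "('l \<Rightarrow> 'r) \<Rightarrow> ('l word \<Rightarrow>\<^sub>0 complex) \<Rightarrow> 'r" where
  "eval L f = (\<Sum>u\<in>Poly_Mapping.keys f. \<kappa> (Poly_Mapping.lookup f u) * prod_list (map L (letters u)))"

lemma eval_superset:
  assumes "finite A" "Poly_Mapping.keys f \<subseteq> A"
  shows "eval L f = (\<Sum>u\<in>A. \<kappa> (Poly_Mapping.lookup f u) * prod_list (map L (letters u)))"
  unfolding eval_def using assms
  by (intro sum.mono_neutral_left) (auto simp: in_keys_iff \<kappa>_zero)

lemma eval_add: "eval L (f + g) = eval L f + eval L g"
proof -
  let ?A = "Poly_Mapping.keys f \<union> Poly_Mapping.keys g"
  have "Poly_Mapping.keys (f + g) \<subseteq> ?A"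
    by (rule Poly_Mapping.keys_add)
  then show ?thesis
    by (simp add: eval_superset[of ?A] lookup_add \<kappa>_add distrib_right sum.distrib)
qed

lemma eval_zero [simp]: "eval L 0 = 0"
  by (simp add: eval_def)

lemma eval_uminus: "eval L (- f) = - eval L f"
  using eval_add[of L f "- f"] by (simp add: eq_neg_iff_add_eq_0 add.commute)

lemma eval_diff: "eval L (f - g) = eval L f - eval L g"
  using eval_add[of L f "- g"] by (simp add: eval_uminus)

lemma eval_sum: "eval L (sum h A) = (\<Sum>x\<in>A. eval L (h x))"
  by (induction A rule: infinite_finite_induct) (auto simp: eval_add)

lemma eval_single: "eval L (Poly_Mapping.single u c) = \<kappa> c * prod_list (map L (letters u))"
  by (cases "c = 0") (auto simp: eval_def \<kappa>_zero)

lemma eval_mult: "eval L (f * g) = eval L f * eval L g"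
proof -
  have single: "eval L (Poly_Mapping.single u c * Poly_Mapping.single v d)
      = eval L (Poly_Mapping.single u c) * eval L (Poly_Mapping.single v d)" for u v c d
  proof -
    let ?u = "prod_list (map L (letters u))" and ?v = "prod_list (map L (letters v))"
    have "\<kappa> (c * d) * (?u * ?v) = \<kappa> c * (\<kappa> d * ?u) * ?v"
      by (simp add: \<kappa>_mult mult.assoc)
    also have "\<dots> = \<kappa> c * ?u * (\<kappa> d * ?v)"
      by (simp add: \<kappa>_central[of d ?u] mult.assoc)
    finally show ?thesis
      by (simp add: mult_single eval_single)
  qed
  have "eval L (f * g) = eval L
      ((\<Sum>u\<in>Poly_Mapping.keys f. Poly_Mapping.single u (Poly_Mapping.lookup f u)) *
       (\<Sum>v\<in>Poly_Mapping.keys g. Poly_Mapping.single v (Poly_Mapping.lookup g v)))"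
    by (simp only: poly_mapping_as_sum[symmetric])
  also have "\<dots> = eval L (\<Sum>u\<in>Poly_Mapping.keys f. Poly_Mapping.single u (Poly_Mapping.lookup f u)) *
      eval L (\<Sum>v\<in>Poly_Mapping.keys g. Poly_Mapping.single v (Poly_Mapping.lookup g v))"
    by (simp only: sum_product eval_sum single)
  finally show ?thesis
    by (simp only: poly_mapping_as_sum[symmetric])
qed

lemma eval_one [simp]: "eval L 1 = 1"
  using eval_single[of L 0 1] by (simp add: \<kappa>_one)

lemma eval_gen [simp]: "eval L (gen l) = L l"
  by (simp add: gen_def eval_single \<kappa>_one)

lemma eval_scal [simp]: "eval L (scal c) = \<kappa> c"
  by (simp add: scal_def eval_single)

end

section \<open>Free algebras as rings with a carrier, and maps out of quotients\<close>

lemma keys_subset_letters: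
  "f \<in> carrier (free_algebra S) \<longleftrightarrow> (\<forall>u\<in>Poly_Mapping.keys f. set (letters u) \<subseteq> S)"
  by (simp add: free_algebra_def)

lemma free_algebra_simps [simp]:
  "one (free_algebra S) = 1" "zero (free_algebra S) = 0"
  "add (free_algebra S) = (+)" "mult (free_algebra S) = (*)"
  by (simp_all add: free_algebra_def)

context
  fixes S :: "'l set"
begin

lemma free_algebra_closed:
  shows free_zero: "0 \<in> carrier (free_algebra S)"
    and free_one: "1 \<in> carrier (free_algebra S)"
    and free_add: "f \<in> carrier (free_algebra S) \<Longrightarrow> g \<in> carrier (free_algebra S) \<Longrightarrow>
        f + g \<in> carrier (free_algebra S)"
    and free_uminus: "f \<in> carrier (free_algebra S) \<Longrightarrow> - f \<in> carrier (free_algebra S)"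
    and free_mult: "f \<in> carrier (free_algebra S) \<Longrightarrow> g \<in> carrier (free_algebra S) \<Longrightarrow>
        f * g \<in> carrier (free_algebra S)"
proof -
  show "0 \<in> carrier (free_algebra S)" "1 \<in> carrier (free_algebra S)"
    by (auto simp: keys_subset_letters)
  show "f + g \<in> carrier (free_algebra S)"
    if "f \<in> carrier (free_algebra S)" "g \<in> carrier (free_algebra S)"
    using that Poly_Mapping.keys_add[of f g] by (auto simp: keys_subset_letters)
  show "- f \<in> carrier (free_algebra S)" if "f \<in> carrier (free_algebra S)"
    using that by (simp add: keys_subset_letters)
  show "f * g \<in> carrier (free_algebra S)"
    if "f \<in> carrier (free_algebra S)" "g \<in> carrier (free_algebra S)"
    using that keys_mult[of f g] by (fastforce simp: keys_subset_letters)
qed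

lemma free_diff:
  "f \<in> carrier (free_algebra S) \<Longrightarrow> g \<in> carrier (free_algebra S) \<Longrightarrow> f - g \<in> carrier (free_algebra S)"
  using free_add[of f "- g"] free_uminus[of g] by simp

lemma free_sum: "(\<And>x. x \<in> A \<Longrightarrow> h x \<in> carrier (free_algebra S)) \<Longrightarrow> sum h A \<in> carrier (free_algebra S)"
  by (induction A rule: infinite_finite_induct) (auto intro: free_zero free_add)

lemma ring_free_algebra: "ring (free_algebra S)"
proof (rule ringI)
  show "abelian_group (free_algebra S)"
  proof (rule abelian_groupI)
    show "\<exists>y\<in>carrier (free_algebra S). y \<oplus>\<^bsub>free_algebra S\<^esub> x = \<zero>\<^bsub>free_algebra S\<^esub>"
      if "x \<in> carrier (free_algebra S)" for x
      using free_uminus[OF that] by (intro bexI[of _ "- x"]) auto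
  qed (auto simp: algebra_simps intro: free_zero free_add)
  show "Group.monoid (free_algebra S)"
    by (rule monoidI) (auto simp: mult.assoc intro: free_one free_mult)
qed (auto simp: algebra_simps)

end

lemma free_gen: "l \<in> S \<Longrightarrow> gen l \<in> carrier (free_algebra S)"
  by (simp add: gen_def keys_subset_letters)

lemma free_scal: "scal c \<in> carrier (free_algebra S)"
  by (simp add: scal_def keys_subset_letters)

text \<open>This record form of a type-class ring serves as the target of homomorphisms out of the
  quotient rings.\<close>

definition ring_of :: "'r::ring_1 itself \<Rightarrow> 'r ring" where
  "ring_of _ = \<lparr>carrier = UNIV, mult = (*), one = 1, zero = 0, add = (+)\<rparr>"

lemma ring_of_simps [simp]:
  "carrier (ring_of R) = UNIV" "one (ring_of R) = 1" "zero (ring_of R) = 0"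
  "add (ring_of R) = (+)" "mult (ring_of R) = (*)"
  by (simp_all add: ring_of_def)

lemma ring_ring_of: "ring (ring_of TYPE('r::ring_1))"
proof (rule ringI)
  show "abelian_group (ring_of TYPE('r))"
  proof (rule abelian_groupI)
    show "\<exists>y\<in>carrier (ring_of TYPE('r)). y \<oplus>\<^bsub>ring_of TYPE('r)\<^esub> x = \<zero>\<^bsub>ring_of TYPE('r)\<^esub>" for x
      by (intro bexI[of _ "- x"]) auto
  qed (auto simp: algebra_simps)
  show "Group.monoid (ring_of TYPE('r))"
    by (rule monoidI) (auto simp: mult.assoc)
qed (auto simp: algebra_simps)

lemma FactRing_carrier: "X \<in> carrier (R Quot I) \<Longrightarrow> \<exists>u\<in>carrier R. X = I +>\<^bsub>R\<^esub> u"
  by (auto simp: FactRing_simps)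

lemma ring_hom_factor:
  assumes "ring R" "ring S" "h \<in> ring_hom R S" "ideal I R"
    and vanish: "\<And>u. u \<in> I \<Longrightarrow> h u = \<zero>\<^bsub>S\<^esub>"
  obtains h' where "h' \<in> ring_hom (R Quot I) S" "\<And>u. u \<in> carrier R \<Longrightarrow> h' (I +>\<^bsub>R\<^esub> u) = h u"
proof -
  interpret R: ring R by fact
  interpret S: ring S by fact
  interpret I: ideal I R by fact
  have hc: "h x \<in> carrier S" if "x \<in> carrier R" for x
    using that assms(3) by (auto simp: ring_hom_def)
  define h' where "h' X = (THE y. \<exists>u\<in>carrier R. X = I +>\<^bsub>R\<^esub> u \<and> y = h u)" for X
  have h': "h' (I +>\<^bsub>R\<^esub> u) = h u" if u: "u \<in> carrier R" for u
    unfolding h'_def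
  proof (rule the_equality)
    fix y assume "\<exists>v\<in>carrier R. I +>\<^bsub>R\<^esub> u = I +>\<^bsub>R\<^esub> v \<and> y = h v"
    then obtain v where v: "v \<in> carrier R" "I +>\<^bsub>R\<^esub> u = I +>\<^bsub>R\<^esub> v" "y = h v" by auto
    have "u \<in> I +>\<^bsub>R\<^esub> v"
      using I.a_rcos_self[OF u] v(2) by simp
    then obtain i where i: "i \<in> I" "u = i \<oplus>\<^bsub>R\<^esub> v"
      by (auto simp: a_r_coset_def r_coset_def)
    have "h u = h i \<oplus>\<^bsub>S\<^esub> h v"
      using i v(1) I.a_Hcarr[OF i(1)] assms(3) by (simp add: ring_hom_add)
    then show "y = h u"
      using vanish[OF i(1)] hc[OF v(1)] v(3) by simp
  qed (use u in blast)
  show ?thesis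
  proof
    note carr = FactRing_carrier[of _ R I]
    note hom = I.rcos_ring_hom
    show "h' \<in> ring_hom (R Quot I) S"
    proof (rule ring_hom_memI)
      fix X assume "X \<in> carrier (R Quot I)"
      then show "h' X \<in> carrier S"
        using carr h' hc by fastforce
    next
      fix X Y assume "X \<in> carrier (R Quot I)" "Y \<in> carrier (R Quot I)"
      then obtain u v where u: "u \<in> carrier R" "X = I +>\<^bsub>R\<^esub> u" and v: "v \<in> carrier R" "Y = I +>\<^bsub>R\<^esub> v"
        using carr by meson
      have "X \<otimes>\<^bsub>R Quot I\<^esub> Y = I +>\<^bsub>R\<^esub> (u \<otimes>\<^bsub>R\<^esub> v)" "X \<oplus>\<^bsub>R Quot I\<^esub> Y = I +>\<^bsub>R\<^esub> (u \<oplus>\<^bsub>R\<^esub> v)"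
        using ring_hom_mult[OF hom u(1) v(1)] ring_hom_add[OF hom u(1) v(1)] u v by auto
      then show "h' (X \<otimes>\<^bsub>R Quot I\<^esub> Y) = h' X \<otimes>\<^bsub>S\<^esub> h' Y" "h' (X \<oplus>\<^bsub>R Quot I\<^esub> Y) = h' X \<oplus>\<^bsub>S\<^esub> h' Y"
        using u v h' assms(3) by (simp_all add: ring_hom_mult ring_hom_add)
    next
      show "h' \<one>\<^bsub>R Quot I\<^esub> = \<one>\<^bsub>S\<^esub>"
        using ring_hom_one[OF hom] h'[OF R.one_closed] ring_hom_one[OF assms(3)] by simp
    qed
  qed (rule h')
qed

lemma ring_hom_vanish_genideal:
  assumes "ring R" "ring S" "h \<in> ring_hom R S" "A \<subseteq> carrier R"
    and "\<And>u. u \<in> A \<Longrightarrow> h u = \<zero>\<^bsub>S\<^esub>" and "u \<in> genideal R A"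
  shows "h u = \<zero>\<^bsub>S\<^esub>"
proof -
  interpret ring_hom_ring R S h
    using assms(1-3) by (rule ring_hom_ringI2)
  have "A \<subseteq> a_kernel R S h"
    unfolding a_kernel_def' using assms(4,5) by blast
  then have "genideal R A \<subseteq> a_kernel R S h"
    by (rule R.genideal_minimal[OF kernel_is_ideal])
  then have "u \<in> a_kernel R S h"
    using assms(6) by (rule subsetD)
  then show ?thesis
    unfolding a_kernel_def' by blast
qed

section \<open>Consequences of the defining relations\<close>

text \<open>Relations among the t_w, x_1 and the z_i alone. The other x_i and all y_i are built from
  these, and the remaining relations of \<open>G_rel\<close> and \<open>H_rel\<close> are derived,
  apart from the two quadratic ones, which are added in \<open>two_boundary_algebra\<close>.\<close>

locale two_boundary_relations =
  fixes k :: nat and \<rho> :: "(nat \<Rightarrow> nat) \<Rightarrow> 'r::ring_1" and X :: 'r and Z :: "nat \<Rightarrow> 'r"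
  assumes rho_id: "\<rho> id = 1"
    and rho_mult: "w permutes {1..k} \<Longrightarrow> w' permutes {1..k} \<Longrightarrow> \<rho> (w \<circ> w') = \<rho> w * \<rho> w'"
    and t_Z: "i \<in> {1..k-1} \<Longrightarrow> \<rho> (adj i) * Z i = Z (Suc i) * \<rho> (adj i) - 1"
    and t_Z_far: "i \<in> {1..k-1} \<Longrightarrow> j \<in> {0..k} \<Longrightarrow> j \<noteq> i \<Longrightarrow> j \<noteq> i + 1 \<Longrightarrow> \<rho> (adj i) * Z j = Z j * \<rho> (adj i)"
    and Z_Z: "i \<in> {0..k} \<Longrightarrow> j \<in> {0..k} \<Longrightarrow> Z i * Z j = Z j * Z i"
    and X_t: "i \<in> {2..k-1} \<Longrightarrow> \<rho> (adj i) * X = X * \<rho> (adj i)"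
    and X_Z: "i \<in> {2..k} \<Longrightarrow> Z i * X = X * Z i"
    and X_Z01: "(Z 0 + Z 1) * X = X * (Z 0 + Z 1)"
    and X_X2: "2 \<le> k \<Longrightarrow> X * (\<rho> (adj 1) * X * \<rho> (adj 1) + \<rho> (adj 1)) =
        (\<rho> (adj 1) * X * \<rho> (adj 1) + \<rho> (adj 1)) * X"
    and k_pos: "1 \<le> k"
begin

definition t :: "nat \<Rightarrow> 'r" where "t i = \<rho> (adj i)"

text \<open>The recursion solves t_i x_i = x_(i+1) t_i - 1 for x_(i+1), using t_i^2 = 1.\<close>

fun tower :: "'r \<Rightarrow> nat \<Rightarrow> 'r" where
  "tower x 0 = x"
| "tower x (Suc 0) = x"
| "tower x (Suc (Suc i)) = t (Suc i) * tower x (Suc i) * t (Suc i) + t (Suc i)"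

lemma tower_step: "1 \<le> i \<Longrightarrow> tower x (Suc i) = t i * tower x i * t i + t i"
  by (cases i) auto

lemma adj_perm: "i \<in> {1..k-1} \<Longrightarrow> adj i permutes {1..k}"
  by (rule adj_permutes) auto

lemma t_sq: "i \<in> {1..k-1} \<Longrightarrow> t i * t i = 1"
  using rho_mult[OF adj_perm adj_perm, of i i] rho_id by (simp add: t_def)

lemma t_sq_left: "i \<in> {1..k-1} \<Longrightarrow> t i * (t i * x) = x"
  using t_sq by (simp add: mult.assoc[symmetric])

lemma t_far: "i \<in> {1..k-1} \<Longrightarrow> j \<in> {1..k-1} \<Longrightarrow> i + 2 \<le> j \<Longrightarrow> t i * t j = t j * t i"
  using rho_mult[OF adj_perm adj_perm, of i j] rho_mult[OF adj_perm adj_perm, of j i]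
    adj_commute[of i j] by (simp add: t_def)

lemma t_braid:
  assumes "i \<in> {1..k-2}"
  shows "t i * t (Suc i) * t i = t (Suc i) * t i * t (Suc i)"
proof -
  have p: "adj i permutes {1..k}" "adj (Suc i) permutes {1..k}"
    using assms by (auto intro!: adj_permutes)
  show ?thesis
    using arg_cong[OF adj_braid[of i], of \<rho>] p permutes_compose[OF p] permutes_compose[OF p(2) p(1)]
    by (simp add: t_def rho_mult)
qed

lemma t_tower:
  assumes "i \<in> {1..k-1}"
  shows "t i * tower x i = tower x (Suc i) * t i - 1"
  using assms t_sq[OF assms] by (simp add: tower_step algebra_simps)

text \<open>With \<open>s = t i\<close> and \<open>y\<close> the entry \<open>i\<close> of a tower,
  \<open>s * y * s + s\<close> is the next entry. This is the inductive step of the commutations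
  with towers below.\<close>

lemma commute_step:
  fixes y z s :: 'r
  assumes "s * z = z * s" "y * z = z * y"
  shows "(s * y * s + s) * z = z * (s * y * s + s)"
proof -
  have "s * y * s * z = s * (y * z) * s"
    using assms(1) by (simp add: mult.assoc)
  also have "\<dots> = s * z * y * s"
    using assms(2) by (simp add: mult.assoc)
  also have "\<dots> = z * (s * y * s)"
    using assms(1) by (simp add: mult.assoc)
  finally show ?thesis
    using assms(1) by (simp add: distrib_left distrib_right)
qed

text \<open>Both boundary generators \<open>X\<close> and \<open>Z 1 - X\<close> satisfy the hypotheses of this context.\<close>

context
  fixes x :: 'r
  assumes x_t: "i \<in> {2..k-1} \<Longrightarrow> t i * x = x * t i"
    and x_x2: "2 \<le> k \<Longrightarrow> x * (t 1 * x * t 1 + t 1) = (t 1 * x * t 1 + t 1) * x"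
begin

lemma t_tower_low: "1 \<le> j \<Longrightarrow> j < i \<Longrightarrow> i \<le> k - 1 \<Longrightarrow> t i * tower x j = tower x j * t i"
proof (induction j rule: dec_induct)
  case base
  then show ?case using x_t by simp
next
  case (step j)
  then show ?case
    using commute_step[of "t j" "t i" "tower x j"] t_far[of j i] tower_step[of j x] by auto
qed

text \<open>The case j = i + 2 is where the braid relation enters: moved past t_(i+1) t_i, the
  factor t_i becomes t_(i+1), which commutes with \<open>tower x i\<close> and turns back into t_i
  on the other side.\<close>

lemma t_tower_high: "i + 2 \<le> j \<Longrightarrow> 1 \<le> i \<Longrightarrow> j \<le> k \<Longrightarrow> t i * tower x j = tower x j * t i"
proof (induction j rule: dec_induct)
  case base
  let ?t = "t i" and ?s = "t (Suc i)" and ?T = "tower x i"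
  have i: "i \<in> {1..k-2}" "i \<in> {1..k-1}" "i + 1 \<in> {1..k-1}"
    using base by auto
  have braid: "?t * (?s * (?t * y)) = ?s * (?t * (?s * y))" for y
    using t_braid[OF i(1)] by (metis mult.assoc)
  have braid': "?t * (?s * ?t) = ?s * (?t * ?s)"
    using t_braid[OF i(1)] by (metis mult.assoc)
  have sT: "?s * (?T * y) = ?T * (?s * y)" for y
    using t_tower_low[of i "Suc i"] i by (simp add: mult.assoc[symmetric])
  have T: "tower x (Suc (Suc i)) = ?s * (?t * (?T * (?t * ?s))) + ?s * (?t * ?s) + ?s"
    using tower_step[of i x] tower_step[of "Suc i" x] i
    by (simp add: distrib_left distrib_right mult.assoc)
  have 1: "?t * (?s * (?t * (?T * (?t * ?s)))) = ?s * (?t * (?T * (?t * ?s))) * ?t"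
  proof -
    have "?t * (?s * (?t * (?T * (?t * ?s)))) = ?s * (?t * (?T * (?s * (?t * ?s))))"
      by (simp add: braid sT)
    also have "?s * (?t * ?s) = ?t * (?s * ?t)"
      by (rule braid'[symmetric])
    finally show ?thesis
      by (simp add: mult.assoc)
  qed
  \<comment> \<open>The lower-order terms are exchanged: \<open>?t\<close> times the cubic term
    equals the linear term \<open>?s\<close> times \<open>?t\<close>, and conversely.\<close>
  have 2: "?t * (?s * (?t * ?s)) = ?s * ?t"
    using braid'[symmetric] t_sq_left[OF i(2)] by simp
  have 3: "?s * (?t * ?s) * ?t = ?t * ?s"
    using braid'[symmetric] t_sq[OF i(2)] by (simp add: mult.assoc)
  show ?case
    unfolding add_2_eq_Suc' T by (simp only: distrib_left distrib_right 1 2 3) (simp add: mult.assoc)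
next
  case (step j)
  then show ?case
    using commute_step[of "t j" "t i" "tower x j"] t_far[of i j] tower_step[of j x] by auto
qed

text \<open>The entry 2 commutes with \<open>x\<close> by hypothesis; the later ones arise from it
  by conjugation with \<open>t j\<close> for j at least 2, and these commute with
  \<open>x\<close>.\<close>

lemma x_tower: "2 \<le> j \<Longrightarrow> j \<le> k \<Longrightarrow> tower x j * x = x * tower x j"
proof (induction j rule: nat_induct_at_least)
  case base
  then show ?case
    using x_x2 tower_step[of 1 x] by (simp add: numeral_2_eq_2)
next
  case (Suc j)
  then show ?case
    using commute_step[of "t j" x "tower x j"] x_t[of j] tower_step[of j x] by auto
qed

lemma tower_commute_less: "1 \<le> i \<Longrightarrow> i < j \<Longrightarrow> j \<le> k \<Longrightarrow> tower x i * tower x j = tower x j * tower x i"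
proof (induction i rule: dec_induct)
  case base
  then show ?case using x_tower[of j] by simp
next
  case (step i)
  then show ?case
    using commute_step[of "t i" "tower x j" "tower x i"] t_tower_high[of i j] tower_step[of i x] by auto
qed

lemma tower_commute:
  assumes "i \<in> {1..k}" "j \<in> {1..k}"
  shows "tower x i * tower x j = tower x j * tower x i"
  using assms tower_commute_less[of i j] tower_commute_less[of j i] by (cases i j rule: linorder_cases) auto

lemma t_tower_far:
  assumes "i \<in> {1..k-1}" "j \<in> {1..k}" "j \<noteq> i" "j \<noteq> i + 1"
  shows "t i * tower x j = tower x j * t i"
  using assms t_tower_low[of j i] t_tower_high[of i j] by (cases i j rule: linorder_cases) auto

end

lemma t_tower': "i \<in> {1..k-1} \<Longrightarrow> t i * tower x (Suc i) = tower x i * t i + 1"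
  using t_sq t_sq_left by (simp add: tower_step distrib_left mult.assoc)

lemma t_tower_sum:
  assumes "i \<in> {1..k-1}"
  shows "t i * (tower x i + tower x (Suc i)) = (tower x i + tower x (Suc i)) * t i"
  using t_tower[OF assms, of x] t_tower'[OF assms, of x] by (simp add: distrib_left distrib_right)

lemma tower_diff:
  assumes "i \<in> {1..k-1}"
  shows "tower x (Suc i) - t i * tower x i * t i = t i"
  using assms by (simp add: tower_step)

section \<open>The second boundary generator and the elements z_i\<close>

abbreviation Y :: 'r where "Y \<equiv> Z 1 - X"

lemma Z_step: "i \<in> {1..k-1} \<Longrightarrow> Z (Suc i) = t i * Z i * t i + t i"
proof -
  assume i: "i \<in> {1..k-1}"
  have "Z (Suc i) * t i = t i * Z i + 1"
    using t_Z[OF i] by (simp add: t_def)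
  then have "Z (Suc i) * (t i * t i) = (t i * Z i + 1) * t i"
    by (simp add: mult.assoc[symmetric])
  then show ?thesis
    using t_sq[OF i] by (simp add: distrib_right)
qed

lemma t_Z': "i \<in> {1..k-1} \<Longrightarrow> t i * Z (Suc i) = Z i * t i + 1"
  using Z_step[of i] t_sq[of i] t_sq_left[of i] by (simp add: distrib_left mult.assoc)

lemma Y_t: "i \<in> {2..k-1} \<Longrightarrow> t i * Y = Y * t i"
  using X_t[of i] t_Z_far[of i 1] k_pos by (simp add: t_def algebra_simps)

text \<open>Since y_2 = z_2 - x_2 + t_1, the commutator [y_1, y_2] expands into commutators of z_1,
  z_2, x_1, x_2 and t_1. The essential one is [z_1, x_2] = [z_1, t_1] - [x_1, t_1], which cancels
  the two that do not vanish by hypothesis.\<close>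

lemma Y_Y2:
  assumes "2 \<le> k"
  shows "Y * (t 1 * Y * t 1 + t 1) = (t 1 * Y * t 1 + t 1) * Y"
proof -
  let ?t = "t 1" and ?X2 = "t 1 * X * t 1 + t 1"
  have k: "1 \<in> {1..k-1}"
    using assms by auto
  have ZX2: "Z 1 * ?X2 - ?X2 * Z 1 = Z 1 * ?t - ?t * Z 1 - (X * ?t - ?t * X)"
  proof -
    \<comment> \<open>Moved past t_1, z_1 becomes z_2 up to a scalar, and z_2 commutes with
      x_1.\<close>
    have a: "Z 1 * ?t = ?t * Z 2 - 1" and b: "?t * Z 1 = Z 2 * ?t - 1"
      using t_Z'[OF k] t_Z[OF k] by (simp_all add: t_def numeral_2_eq_2)
    have "Z 1 * (?t * X * ?t) = (Z 1 * ?t) * X * ?t"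
      by (simp add: mult.assoc)
    also have "\<dots> = ?t * (Z 2 * X) * ?t - X * ?t"
      unfolding a by (simp add: left_diff_distrib mult.assoc)
    also have "Z 2 * X = X * Z 2"
      using X_Z[of 2] assms by simp
    also have "?t * (X * Z 2) * ?t = ?t * X * (Z 2 * ?t)"
      by (simp add: mult.assoc)
    also have "Z 2 * ?t = ?t * Z 1 + 1"
      using b by simp
    finally have "Z 1 * (?t * X * ?t) = ?t * X * ?t * Z 1 + ?t * X - X * ?t"
      by (simp add: distrib_left mult.assoc)
    then show ?thesis
      by (simp add: distrib_left distrib_right)
  qed
  have Y2: "t 1 * Y * t 1 + t 1 = Z 2 - ?X2 + ?t"
    using Z_step[OF k] by (simp add: algebra_simps numeral_2_eq_2)
  have "Y * (Z 2 - ?X2 + ?t) - (Z 2 - ?X2 + ?t) * Y =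
      (Z 1 * Z 2 - Z 2 * Z 1) - (Z 1 * ?X2 - ?X2 * Z 1) + (Z 1 * ?t - ?t * Z 1)
      - (X * Z 2 - Z 2 * X) + (X * ?X2 - ?X2 * X) - (X * ?t - ?t * X)"
    by (simp add: algebra_simps)
  also have "\<dots> = 0"
    using Z_Z[of 1 2] X_Z[of 2] X_X2 assms unfolding ZX2 by (simp add: t_def)
  finally show ?thesis
    unfolding Y2 by simp
qed

text \<open>The Jucys-Murphy elements. They are the values of \<open>m_sum j\<close>, because the
  difference x_j - t_{s_(j-1)} x_(j-1) t_{s_(j-1)} of consecutive tower entries is
  t_{s_(j-1)}.\<close>

definition M :: "nat \<Rightarrow> 'r" where
  "M j = (\<Sum>i\<in>{1..<j}. \<rho> (Transposition.transpose i j))"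

lemma rho_conj:
  assumes "v permutes {1..k}" "w permutes {1..k}"
  shows "\<rho> v * \<rho> w * \<rho> v = \<rho> (v \<circ> w \<circ> v)"
  using assms permutes_compose[OF assms(2,1)] by (simp add: rho_mult)

lemma transpose_conj:
  "i < j \<Longrightarrow> j < l \<Longrightarrow> Transposition.transpose i (j::nat) \<circ> Transposition.transpose j l \<circ> Transposition.transpose i j
    = Transposition.transpose i l"
  unfolding fun_eq_iff by (simp add: Transposition.transpose_def)

lemma rho_transpose_step:
  assumes "1 \<le> i" "i < j - 1" "j \<le> k"
  shows "\<rho> (Transposition.transpose i (j - 1)) * t (j - 1) * \<rho> (Transposition.transpose i (j - 1))
    = \<rho> (Transposition.transpose i j)"
proof -
  have "\<rho> (Transposition.transpose i (j - 1)) * t (j - 1) * \<rho> (Transposition.transpose i (j - 1))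
      = \<rho> (Transposition.transpose i (j - 1) \<circ> adj (j - 1) \<circ> Transposition.transpose i (j - 1))"
    unfolding t_def by (rule rho_conj) (use assms in \<open>auto intro!: permutes_swap_id adj_permutes\<close>)
  also have "Transposition.transpose i (j - 1) \<circ> adj (j - 1) \<circ> Transposition.transpose i (j - 1)
      = Transposition.transpose i j"
    using transpose_conj[of i "j - 1" j] assms by (simp add: adj_def)
  finally show ?thesis .
qed

lemma M_step:
  assumes "i \<in> {1..k-1}"
  shows "M (Suc i) = t i * M i * t i + t i"
proof -
  have "t i * \<rho> (Transposition.transpose l i) * t i = \<rho> (Transposition.transpose l (Suc i))"
    if "l \<in> {1..<i}" for l
  proof -
    have "adj i \<circ> Transposition.transpose l i \<circ> adj i = Transposition.transpose l (Suc i)"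
      using that by (auto simp: fun_eq_iff Transposition.transpose_def adj_def)
    then show ?thesis
      unfolding t_def using that assms by (subst rho_conj) (auto intro!: permutes_swap_id adj_permutes)
  qed
  then have "t i * M i * t i = (\<Sum>l\<in>{1..<i}. \<rho> (Transposition.transpose l (Suc i)))"
    by (simp add: M_def sum_distrib_left sum_distrib_right)
  moreover have "{1..<i + 1} = insert i {1..<i}"
    using assms by auto
  ultimately show ?thesis
    by (simp add: M_def t_def adj_def)
qed

text \<open>\<open>Z\<close>, both towers and \<open>M\<close> obey the same affine recursion r
  \<mapsto> t_i r t_i + t_i, and a combination with coefficients 1, 1, -1 obeys it too, since these
  add up to 1.\<close>

lemma Z_eq: "1 \<le> i \<Longrightarrow> i \<le> k \<Longrightarrow> Z i = tower X i + tower Y i - M i"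
proof (induction i rule: nat_induct_at_least)
  case base
  then show ?case by (simp add: M_def)
next
  case (Suc i)
  then have i: "i \<in> {1..k-1}" and IH: "Z i = tower X i + tower Y i - M i"
    by auto
  have "Z (Suc i) = t i * (tower X i + tower Y i - M i) * t i + t i"
    using Z_step[OF i] IH by simp
  also have "\<dots> = tower X (Suc i) + tower Y (Suc i) - M (Suc i)"
    using i by (simp add: M_step tower_step distrib_left distrib_right left_diff_distrib right_diff_distrib)
  finally show ?case by simp
qed

text \<open>t_j commutes with z_j + z_(j+1) and with every other z_l, and j < i guarantees that both
  of the two special terms occur in the sum.\<close>

lemma zsum_t:
  assumes "1 \<le> j" "j < i" "i \<le> k"
  shows "t j * (\<Sum>l\<in>{0..i}. Z l) = (\<Sum>l\<in>{0..i}. Z l) * t j"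
proof -
  let ?R = "\<Sum>l\<in>{0..i} - {j, j + 1}. Z l"
  have j: "j \<in> {1..k-1}"
    using assms by auto
  have "(\<Sum>l\<in>{0..i}. Z l) = ?R + (\<Sum>l\<in>{j, j + 1}. Z l)"
    by (rule sum.subset_diff) (use assms in auto)
  then have split: "(\<Sum>l\<in>{0..i}. Z l) = ?R + (Z j + Z (Suc j))"
    by simp
  have 1: "t j * ?R = ?R * t j"
    unfolding sum_distrib_left sum_distrib_right
    by (rule sum.cong) (use j assms t_Z_far[of j] in \<open>auto simp: t_def\<close>)
  have 2: "t j * (Z j + Z (Suc j)) = (Z j + Z (Suc j)) * t j"
    using t_Z[OF j] t_Z'[OF j] by (simp add: t_def distrib_left distrib_right)
  show ?thesis
    unfolding split using 1 2 by (simp add: distrib_left distrib_right)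
qed

lemma zsum_X:
  assumes "1 \<le> i" "i \<le> k"
  shows "(\<Sum>l\<in>{0..i}. Z l) * X = X * (\<Sum>l\<in>{0..i}. Z l)"
proof -
  have "(\<Sum>l\<in>{0..i}. Z l) = (\<Sum>l\<in>{2..i}. Z l) + (\<Sum>l\<in>{0, 1}. Z l)"
  proof -
    have "{0..i} - {0, 1} = {2..i}"
      by auto
    then show ?thesis
      using sum.subset_diff[of "{0, 1}" "{0..i}" Z] assms by auto
  qed
  moreover have "(\<Sum>l\<in>{2..i}. Z l) * X = X * (\<Sum>l\<in>{2..i}. Z l)"
    unfolding sum_distrib_left sum_distrib_right
    by (rule sum.cong) (use assms X_Z in auto)
  ultimately show ?thesis
    using X_Z01 by (simp add: distrib_left distrib_right)
qed

lemma zsum_Z: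
  assumes "j \<le> k" "i \<le> k"
  shows "(\<Sum>l\<in>{0..i}. Z l) * Z j = Z j * (\<Sum>l\<in>{0..i}. Z l)"
  unfolding sum_distrib_left sum_distrib_right
  by (rule sum.cong) (use assms Z_Z[of _ j] in auto)

lemma zsum_tower:
  assumes x: "\<And>i. 1 \<le> i \<Longrightarrow> i \<le> k \<Longrightarrow> (\<Sum>l\<in>{0..i}. Z l) * x = x * (\<Sum>l\<in>{0..i}. Z l)"
  shows "1 \<le> j \<Longrightarrow> j \<le> i \<Longrightarrow> i \<le> k \<Longrightarrow> (\<Sum>l\<in>{0..i}. Z l) * tower x j = tower x j * (\<Sum>l\<in>{0..i}. Z l)"
proof (induction j rule: nat_induct_at_least)
  case base
  then show ?case using x[of i] by simp
next
  case (Suc j)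
  then show ?case
    using commute_step[of "t j" "\<Sum>l\<in>{0..i}. Z l" "tower x j"] zsum_t[of j i] tower_step[of j x] by auto
qed

lemma zsum_Y: "1 \<le> i \<Longrightarrow> i \<le> k \<Longrightarrow> (\<Sum>l\<in>{0..i}. Z l) * Y = Y * (\<Sum>l\<in>{0..i}. Z l)"
  using zsum_X[of i] zsum_Z[of 1 i] k_pos by (simp add: left_diff_distrib right_diff_distrib)

end

section \<open>Coefficient identities\<close>

definition t_coeff :: "real \<Rightarrow> real \<Rightarrow> real" where
  "t_coeff x y = 1 / (y - x)"

definition t_amp :: "real \<Rightarrow> real \<Rightarrow> real" where
  "t_amp x y = sqrt (1 - (t_coeff x y)\<^sup>2)"

definition x_coeff :: "nat \<Rightarrow> nat \<Rightarrow> nat \<Rightarrow> nat \<Rightarrow> real \<Rightarrow> real" where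
  "x_coeff a b p q c = (if c = 0 then real a
     else ((real a - real p) * c + c\<^sup>2 + half_sum a b p q * half_diff a b p q) / (2 * c))"

definition x_amp :: "nat \<Rightarrow> nat \<Rightarrow> nat \<Rightarrow> nat \<Rightarrow> real \<Rightarrow> real" where
  "x_amp a b p q c = sqrt (- (1 / (2 * c)\<^sup>2) * (c + half_sum a b p q) * (c - half_diff a b p q)
     * (c - half_sum a b p q) * (c + half_diff a b p q))"

definition negate :: "(nat \<Rightarrow> real) \<Rightarrow> nat \<Rightarrow> real" where
  "negate c = c(0 := c 0 + 2 * c 1, 1 := - c 1)"

lemma t_coeff_swap: "t_coeff y x = - t_coeff x y"
  by (simp add: t_coeff_def divide_simps)

lemma t_amp_swap: "t_amp y x = t_amp x y"
  by (simp add: t_amp_def t_coeff_swap[of y])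

lemma t_amp_sq: "1 \<le> \<bar>y - x\<bar> \<Longrightarrow> (t_amp x y)\<^sup>2 = 1 - (t_coeff x y)\<^sup>2"
proof -
  assume "1 \<le> \<bar>y - x\<bar>"
  then have "1 \<le> (y - x)\<^sup>2"
    by (metis abs_le_square_iff abs_one one_power2)
  then show ?thesis
    by (simp add: t_amp_def t_coeff_def power_divide divide_le_eq_1)
qed

lemma t_amp_zero: "\<bar>y - x\<bar> = 1 \<Longrightarrow> t_amp x y = 0"
  by (auto simp: t_amp_def t_coeff_def power_divide abs_square_eq_1)

text \<open>The convention 1 / 0 = 0 yields the right value: if 0 is admissible, then D = 0, so 0 is
  one of the exceptional contents without a partner tableau.\<close>

lemma x_amp_zero [simp]: "x_amp a b p q 0 = 0"
  by (simp add: x_amp_def)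

lemma x_amp_minus: "x_amp a b p q (- c) = x_amp a b p q c"
proof -
  have "(- c + A) * (- c - D) * (- c - A) * (- c + D) = (c + A) * (c - D) * (c - A) * (c + D)"
    for A D :: real
    by (simp add: algebra_simps)
  then show ?thesis
    by (simp add: x_amp_def mult.assoc)
qed

lemma negate_apply [simp]:
  "negate c 0 = c 0 + 2 * c (Suc 0)" "negate c (Suc 0) = - c (Suc 0)" "i \<ge> 2 \<Longrightarrow> negate c i = c i"
  by (auto simp: negate_def)

lemma negate_negate [simp]: "negate (negate c) = c"
  by (auto simp: negate_def)

lemma swap_swap [simp]: "(c \<circ> adj i) \<circ> adj i = c"
  by (simp add: comp_assoc)

section \<open>The coefficients of the boundary generators\<close>

locale boundary_parameters =
  fixes a b p q :: nat
begin

abbreviation "A \<equiv> half_sum a b p q"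
abbreviation "D \<equiv> half_diff a b p q"
abbreviation "h \<equiv> half_shift a b p q"
abbreviation "u \<equiv> x_coeff a b p q"
abbreviation "w \<equiv> x_amp a b p q"

text \<open>This is \<open>A D / (2 c)\<close> for \<open>c \<noteq> 0\<close>.  At \<open>c = 0\<close>, which only matters when \<open>D = 0\<close>, it is \<open>A / 2\<close>.\<close>

definition odd_part :: "real \<Rightarrow> real" where
  "odd_part c = u c - (real a - real p) / 2 - c / 2"

text \<open>The radicand of \<open>w c\<close> is (A^2 - c^2)(c^2 - D^2)/(4 c^2); these bounds make
  it nonnegative, so that squaring \<open>w c\<close> returns it when c is nonzero.\<close>

definition admissible :: "real \<Rightarrow> bool" where
  "admissible c \<longleftrightarrow> \<bar>D\<bar> \<le> \<bar>c\<bar> \<and> \<bar>c\<bar> \<le> A"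

lemma odd_part_mult: "c = 0 \<longrightarrow> D = 0 \<Longrightarrow> c * odd_part c = A * D / 2"
  by (auto simp: odd_part_def x_coeff_def field_simps power2_eq_square)

lemma sum_diff: "A + D = real a + real p" "A - D = real b + real q" "2 * h = (real a - real p) + (real b - real q)"
  by (simp_all add: half_sum_def half_diff_def half_shift_def field_simps)

lemma w_sq:
  assumes "admissible c"
  shows "(odd_part c)\<^sup>2 + (w c)\<^sup>2 + c\<^sup>2 / 4 = (A\<^sup>2 + D\<^sup>2) / 4"
proof (cases "c = 0")
  case True
  then have "D = 0"
    using assms by (simp add: admissible_def)
  \<comment> \<open>Here the value a chosen for \<open>u 0\<close> enters: a - (a - p)/2 = (a + p)/2
    = (A + D)/2.\<close>
  then have "odd_part c = A / 2"
    using True sum_diff(1) by (simp add: odd_part_def x_coeff_def field_simps)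
  then have "(odd_part c)\<^sup>2 = A\<^sup>2 / 4"
    by (simp only: power_divide) simp
  then show ?thesis
    using True \<open>D = 0\<close> by simp
next
  case False
  have le: "c\<^sup>2 \<le> A\<^sup>2" "D\<^sup>2 \<le> c\<^sup>2"
    using assms power_mono[of "\<bar>c\<bar>" A 2] by (auto simp: admissible_def abs_le_square_iff)
  have rad: "- (1 / (2 * c)\<^sup>2) * (c + A) * (c - D) * (c - A) * (c + D) = (A\<^sup>2 - c\<^sup>2) * (c\<^sup>2 - D\<^sup>2) / (4 * c\<^sup>2)"
    using False by (simp add: field_simps power2_eq_square)
  have w2: "(w c)\<^sup>2 = (A\<^sup>2 - c\<^sup>2) * (c\<^sup>2 - D\<^sup>2) / (4 * c\<^sup>2)"
    unfolding x_amp_def rad using le by (intro real_sqrt_pow2 divide_nonneg_nonneg mult_nonneg_nonneg) auto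
  have op: "odd_part c = A * D / (2 * c)"
    using odd_part_mult[of c] False by (simp add: field_simps)
  show ?thesis
    unfolding w2 op using False by (simp add: field_simps power2_eq_square)
qed

lemma u_eq: "u c = (real a - real p) / 2 + c / 2 + odd_part c"
  by (simp add: odd_part_def)

text \<open>The hypothesis excludes c = 0, where the function need not be odd.\<close>

lemma odd_part_minus: "w c \<noteq> 0 \<Longrightarrow> odd_part (- c) = - odd_part c"
  by (cases "c = 0") (auto simp: odd_part_def x_coeff_def field_simps power2_eq_square)

text \<open>Diagonal and off-diagonal entries of x_1^2 = (a - p) x_1 + a p for the symmetric matrix
  of x_1 on two weights exchanged by \<open>negate\<close>.\<close>

lemma x_quadratic:
  assumes "admissible c"
  shows "(u c)\<^sup>2 + (w c)\<^sup>2 = (real a - real p) * u c + real a * real p"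
    and "w c * (u c + u (- c)) = w c * (real a - real p)"
proof -
  have c: "c * odd_part c = A * D / 2"
    using assms by (intro odd_part_mult) (auto simp: admissible_def)
  have "(u c)\<^sup>2 + (w c)\<^sup>2 - (real a - real p) * u c - real a * real p
      = ((odd_part c)\<^sup>2 + (w c)\<^sup>2 + c\<^sup>2 / 4) + c * odd_part c - ((real a + real p) / 2)\<^sup>2"
    by (simp add: u_eq field_simps power2_eq_square)
  also have "\<dots> = 0"
    unfolding w_sq[OF assms] c sum_diff(1)[symmetric] by (simp add: field_simps power2_eq_square)
  finally show "(u c)\<^sup>2 + (w c)\<^sup>2 = (real a - real p) * u c + real a * real p"
    by simp
  show "w c * (u c + u (- c)) = w c * (real a - real p)"
    using odd_part_minus[of c] by (cases "w c = 0") (auto simp: u_eq)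
qed

text \<open>Passing from x_1 to y_1 = z_1 - x_1 exchanges (a, p) with (b, q). This fixes A and
  negates D, whence the opposite sign of \<open>c * odd_part c\<close> in the computation.\<close>

lemma y_quadratic:
  assumes "admissible c"
  shows "(c + h - u c)\<^sup>2 + (w c)\<^sup>2 = (real b - real q) * (c + h - u c) + real b * real q"
proof -
  have c: "c * odd_part c = A * D / 2"
    using assms by (intro odd_part_mult) (auto simp: admissible_def)
  have h: "h = ((real a - real p) + (real b - real q)) / 2"
    using sum_diff(3) by simp
  have "(c + h - u c)\<^sup>2 + (w c)\<^sup>2 - (real b - real q) * (c + h - u c) - real b * real q
      = ((odd_part c)\<^sup>2 + (w c)\<^sup>2 + c\<^sup>2 / 4) - c * odd_part c - ((real b + real q) / 2)\<^sup>2"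
    unfolding u_eq h by (simp add: field_simps power2_eq_square)
  also have "\<dots> = 0"
    unfolding w_sq[OF assms] c sum_diff(2)[symmetric] by (simp add: field_simps power2_eq_square)
  finally show ?thesis
    by simp
qed

text \<open>Write s for the swap of the first two contents and n for \<open>negate\<close>. In x_1
  x_2 - x_2 x_1 these are the coefficients at the weights s (n c), n (s c), n c and s c, the first
  up to the factor \<open>o2\<close>; the other coefficients cancel formally. By \<open>reg\<close>,
  the poles at x + y = 0 and at y = 0 are met only when both amplitudes vanish.\<close>

lemma boundary_braid_coeffs:
  assumes x: "admissible x" and xy: "1 \<le> \<bar>y - x\<bar>"
    and y: "t_amp x y \<noteq> 0 \<Longrightarrow> admissible y"
    and e: "w x \<noteq> 0 \<Longrightarrow> 1 \<le> \<bar>y + x\<bar>"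
    and reg: "w x = 0 \<and> t_amp x y = 0 \<or> x + y \<noteq> 0 \<and> (y = 0 \<longrightarrow> D = 0)"
  defines "d \<equiv> t_coeff x y" and "e \<equiv> t_coeff (- x) y" and "o1 \<equiv> t_amp x y" and "o2 \<equiv> t_amp (- x) y"
  shows "w x * (d * (u x - u y) + e * (u (- x) - u y) + 1) = 0" (is ?A)
    and "o1 * w y * (e * (u x - u (- y)) - d * (u x - u y) - 1) = 0" (is ?B)
    and "w x * (u x * d * e + e\<^sup>2 * u (- x) + o2\<^sup>2 * u y + e)
       = w x * (d\<^sup>2 * u x + d * e * u (- x) + o1\<^sup>2 * u y + d)" (is ?C)
    and "o1 * (d * (u x - u y)\<^sup>2 + (u x - u y) + e * ((w x)\<^sup>2 - (w y)\<^sup>2)) = 0" (is ?E)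
proof -
  have "?A \<and> ?B \<and> ?C \<and> ?E"
  proof (cases "w x = 0 \<and> t_amp x y = 0")
    case True
    then show ?thesis by (simp add: o1_def)
  next
    case nz: False
    then have ne: "x + y \<noteq> 0" "y = 0 \<longrightarrow> D = 0" "y - x \<noteq> 0"
      using reg xy by auto
    define \<alpha> where "\<alpha> = (real a - real p) / 2"
    \<comment> \<open>Since \<open>x * odd_part x = y * odd_part y\<close>, both odd parts are
      multiples of the one number A D/(2 x y). Written as a difference quotient it makes sense also
      if x or y is 0.\<close>
    define g where "g = (odd_part x - odd_part y) / (y - x)"
    have kx: "x * odd_part x = A * D / 2"
      using x by (intro odd_part_mult) (auto simp: admissible_def)
    have ky: "y * odd_part y = A * D / 2"
      using ne by (intro odd_part_mult) auto
    have g1: "odd_part x = y * g" and g2: "odd_part y = x * g"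
      using ne kx ky unfolding g_def by (simp_all add: field_simps)
    have d: "d = 1 / (y - x)" and e_eq: "e = 1 / (y + x)"
      by (simp_all add: d_def e_def t_coeff_def)
    have ux: "u x = \<alpha> + x / 2 + y * g" and uy: "u y = \<alpha> + y / 2 + x * g"
      by (simp_all add: u_eq g1 g2 \<alpha>_def)
    have P: "d * (u x - u y) = g - 1 / 2"
      using ne unfolding d ux uy by (simp add: field_simps)
    have umx: "u (- x) = \<alpha> - x / 2 - y * g" if "w x \<noteq> 0"
      using odd_part_minus[OF that] by (simp add: u_eq g1 \<alpha>_def)
    have umy: "u (- y) = \<alpha> - y / 2 - x * g" if "w y \<noteq> 0"
      using odd_part_minus[OF that] by (simp add: u_eq g2 \<alpha>_def)
    have Q: "e * (u (- x) - u y) = - g - 1 / 2" if "w x \<noteq> 0"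
      using ne unfolding e_eq umx[OF that] uy by (simp add: field_simps)
    have hA: ?A
      using P Q by (cases "w x = 0") auto
    have Q': "e * (u x - u (- y)) = g + 1 / 2" if "w y \<noteq> 0"
      using ne unfolding e_eq umy[OF that] ux by (simp add: field_simps)
    have hB: ?B
      using P Q' by (cases "w y = 0") auto
    have hC: ?C
    proof (cases "w x = 0")
      case False
      have o1: "o1\<^sup>2 = 1 - d\<^sup>2"
        unfolding o1_def d_def using xy by (rule t_amp_sq)
      have o2: "o2\<^sup>2 = 1 - e\<^sup>2"
        unfolding o2_def e_def using e[OF False] by (intro t_amp_sq) simp
      have "(u x * d * e + e\<^sup>2 * u (- x) + o2\<^sup>2 * u y + e) - (d\<^sup>2 * u x + d * e * u (- x) + o1\<^sup>2 * u y + d)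
         = d * e * (u x - u (- x)) + e * (e * (u (- x) - u y)) - d * (d * (u x - u y)) + e - d"
        unfolding o1 o2 by (simp add: algebra_simps power2_eq_square)
      also have "\<dots> = d * e * (u x - u (- x)) - e * (g + 1 / 2) - d * (g - 1 / 2) + e - d"
        unfolding P Q[OF False] by (simp add: algebra_simps)
      also have "\<dots> = d * e * (x + 2 * y * g) - e * (g + 1 / 2) - d * (g - 1 / 2) + e - d"
        unfolding ux umx[OF False] by (simp add: algebra_simps)
      also have "\<dots> = d * e * x + 2 * g * (d * e * y) - e * (g + 1 / 2) - d * (g - 1 / 2) + e - d"
        by (simp add: algebra_simps)
      also have "d * e * x = (d - e) / 2"
        using ne unfolding d e_eq by (simp add: divide_simps)
      also have "d * e * y = (d + e) / 2"
        using ne unfolding d e_eq by (simp add: divide_simps)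
      also have "(d - e) / 2 + 2 * g * ((d + e) / 2) - e * (g + 1 / 2) - d * (g - 1 / 2) + e - d = 0"
        by (simp add: field_simps)
      finally show ?thesis
        by simp
    qed simp
    have hE: ?E
    proof (cases "o1 = 0")
      case False
      then have "admissible y"
        using y by (simp add: o1_def)
      from w_sq[OF this] w_sq[OF x] have ww: "(w x)\<^sup>2 - (w y)\<^sup>2 = (x * g)\<^sup>2 - (y * g)\<^sup>2 + (y\<^sup>2 - x\<^sup>2) / 4"
        unfolding g1 g2 by argo
      have "d * (u x - u y)\<^sup>2 + (u x - u y) = (u x - u y) * (d * (u x - u y) + 1)"
        by (simp add: power2_eq_square algebra_simps)
      also have "\<dots> = (u x - u y) * (g + 1 / 2)"
        unfolding P by simp
      finally have f1: "d * (u x - u y)\<^sup>2 + (u x - u y) = (u x - u y) * (g + 1 / 2)" .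
      have du: "u x - u y = (y - x) * (g - 1 / 2)"
        unfolding ux uy by (simp add: field_simps)
      have f2: "e * ((w x)\<^sup>2 - (w y)\<^sup>2) = (x - y) * (g\<^sup>2 - 1 / 4)"
      proof -
        have "(w x)\<^sup>2 - (w y)\<^sup>2 = (y + x) * ((x - y) * (g\<^sup>2 - 1 / 4))"
          unfolding ww by (simp add: field_simps power2_eq_square)
        moreover have "y + x \<noteq> 0"
          using ne by linarith
        ultimately show ?thesis
          unfolding e_eq by simp
      qed
      have "d * (u x - u y)\<^sup>2 + (u x - u y) + e * ((w x)\<^sup>2 - (w y)\<^sup>2) =
          (u x - u y) * (g + 1 / 2) + (x - y) * (g\<^sup>2 - 1 / 4)"
        unfolding f1 f2 ..
      also have "\<dots> = 0"
        unfolding du by (simp add: field_simps power2_eq_square)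
      finally show ?thesis
        by simp
    qed simp
    from hA hB hC hE show ?thesis
      by blast
  qed
  then show ?A and ?B and ?C and ?E
    by blast+
qed

end


section \<open>Reflections acting on functions of weights\<close>

definition gap :: "nat \<Rightarrow> nat \<Rightarrow> (nat \<Rightarrow> real) \<Rightarrow> bool" where
  "gap i j c \<longleftrightarrow> 1 \<le> \<bar>c j - c i\<bar>"

definition swap_op :: "nat \<Rightarrow> ((nat \<Rightarrow> real) \<Rightarrow> complex) \<Rightarrow> (nat \<Rightarrow> real) \<Rightarrow> complex" where
  "swap_op i \<phi> c = of_real (t_coeff (c i) (c (Suc i))) * \<phi> c +
     of_real (t_amp (c i) (c (Suc i))) * \<phi> (c \<circ> adj i)"

lemma swap_op_sq:
  assumes "gap i (Suc i) c"
  shows "swap_op i (swap_op i \<phi>) c = \<phi> c"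
proof -
  have "complex_of_real ((t_amp (c i) (c (Suc i)))\<^sup>2) = of_real (1 - (t_coeff (c i) (c (Suc i)))\<^sup>2)"
    using t_amp_sq assms by (simp add: gap_def)
  then have o: "of_real (t_amp (c i) (c (Suc i))) * of_real (t_amp (c i) (c (Suc i)))
      = 1 - complex_of_real (t_coeff (c i) (c (Suc i))) * of_real (t_coeff (c i) (c (Suc i)))"
    by (simp add: power2_eq_square)
  have "swap_op i (swap_op i \<phi>) c =
      (of_real (t_amp (c i) (c (Suc i))) * of_real (t_amp (c i) (c (Suc i))) +
       of_real (t_coeff (c i) (c (Suc i))) * of_real (t_coeff (c i) (c (Suc i)))) * \<phi> c"
    by (simp add: swap_op_def adj_apply t_coeff_swap[of "c (Suc i)"] t_amp_swap[of "c (Suc i)"]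
        algebra_simps)
  then show ?thesis
    unfolding o by simp
qed

lemma swap_op_far:
  assumes "i + 2 \<le> j"
  shows "swap_op i (swap_op j \<phi>) c = swap_op j (swap_op i \<phi>) c"
proof -
  have "(c \<circ> adj i) \<circ> adj j = (c \<circ> adj j) \<circ> adj i"
    using adj_commute[OF assms] by (simp add: comp_assoc)
  then show ?thesis
    using assms by (simp add: swap_op_def adj_apply algebra_simps)
qed

lemma swap_op_braid:
  assumes g: "gap i (Suc i) c" "gap (Suc i) (Suc (Suc i)) c" "gap i (Suc (Suc i)) c"
  shows "swap_op i (swap_op (Suc i) (swap_op i \<phi>)) c = swap_op (Suc i) (swap_op i (swap_op (Suc i) \<phi>)) c"
proof -
  define x y z where "x = c i" and "y = c (Suc i)" and "z = c (Suc (Suc i))"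
  define d1 d2 d3 where "d1 = t_coeff x y" and "d2 = t_coeff y z" and "d3 = t_coeff x z"
  \<comment> \<open>Partial fractions for 1/((y - x)(z - y)). The identity fails for z = x, which
    the gap between entries two apart excludes.\<close>
  have d: "d1 * d2 = d3 * (d1 + d2)"
    using g unfolding d1_def d2_def d3_def t_coeff_def gap_def x_def y_def z_def
    by (simp add: divide_simps) (auto simp: algebra_simps)
  have o: "(t_amp x y)\<^sup>2 = 1 - d1\<^sup>2" "(t_amp y z)\<^sup>2 = 1 - d2\<^sup>2"
    using g unfolding d1_def d2_def gap_def x_def y_def z_def by (auto intro!: t_amp_sq)
  define D1 D2 D3 where "D1 = complex_of_real d1" and "D2 = complex_of_real d2" and "D3 = complex_of_real d3"
  define O1 O2 O3 where "O1 = complex_of_real (t_amp x y)" and "O2 = complex_of_real (t_amp y z)"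
    and "O3 = complex_of_real (t_amp x z)"
  have D: "D1 * D2 = D3 * (D1 + D2)"
    unfolding D1_def D2_def D3_def of_real_mult[symmetric] of_real_add[symmetric] d ..
  have O: "O1 * O1 = 1 - D1 * D1" "O2 * O2 = 1 - D2 * D2"
    unfolding O1_def O2_def D1_def D2_def of_real_mult[symmetric]
    using o by (simp_all add: power2_eq_square)
  have br: "c \<circ> adj i \<circ> adj (Suc i) \<circ> adj i = c \<circ> adj (Suc i) \<circ> adj i \<circ> adj (Suc i)"
    using adj_braid[of i] by (metis comp_assoc)
  define f1 f2 f12 f21 f121 where "f1 = \<phi> (c \<circ> adj i)" and "f2 = \<phi> (c \<circ> adj (Suc i))"
    and "f12 = \<phi> (c \<circ> adj i \<circ> adj (Suc i))" and "f21 = \<phi> (c \<circ> adj (Suc i) \<circ> adj i)"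
    and "f121 = \<phi> (c \<circ> adj (Suc i) \<circ> adj i \<circ> adj (Suc i))"
  note folds = x_def[symmetric] y_def[symmetric] z_def[symmetric]
  note dfolds = d1_def[symmetric] d2_def[symmetric] d3_def[symmetric] D1_def[symmetric] D2_def[symmetric]
    D3_def[symmetric] O1_def[symmetric] O2_def[symmetric] O3_def[symmetric]
  have sw: "t_coeff y x = - d1" "t_coeff z y = - d2" "t_coeff z x = - d3"
    "t_amp y x = t_amp x y" "t_amp z y = t_amp y z" "t_amp z x = t_amp x z"
    by (simp_all add: d1_def d2_def d3_def t_coeff_swap[of y x] t_coeff_swap[of z y] t_coeff_swap[of z x]
        t_amp_swap[of y x] t_amp_swap[of z y] t_amp_swap[of z x])
  have L: "swap_op i (swap_op (Suc i) (swap_op i \<phi>)) c =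
      D1 * (D2 * (D1 * \<phi> c + O1 * f1) + O2 * (D3 * f2 + O3 * f21)) +
      O1 * (D3 * (- D1 * f1 + O1 * \<phi> c) + O3 * (D2 * f12 + O2 * f121))"
    by (simp add: swap_op_def adj_apply br folds sw dfolds f1_def f2_def f12_def f21_def f121_def)
  have R: "swap_op (Suc i) (swap_op i (swap_op (Suc i) \<phi>)) c =
      D2 * (D1 * (D2 * \<phi> c + O2 * f2) + O1 * (D3 * f1 + O3 * f12)) +
      O2 * (D3 * (- D2 * f2 + O2 * \<phi> c) + O3 * (D1 * f21 + O1 * f121))"
    by (simp add: swap_op_def adj_apply br folds sw dfolds f1_def f2_def f12_def f21_def f121_def)
  let ?E = "D1 * D2 - D3 * (D1 + D2)"
  have "swap_op i (swap_op (Suc i) (swap_op i \<phi>)) c - swap_op (Suc i) (swap_op i (swap_op (Suc i) \<phi>)) c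
    = \<phi> c * ((D1 - D2) * ?E + D3 * (O1 * O1 - (1 - D1 * D1)) - D3 * (O2 * O2 - (1 - D2 * D2)))
      + O1 * f1 * ?E - O2 * f2 * ?E"
    unfolding L R by (simp add: algebra_simps)
  also have "\<dots> = 0"
    unfolding D O by simp
  finally show ?thesis
    by simp
qed

context boundary_parameters
begin

definition neg_op :: "((nat \<Rightarrow> real) \<Rightarrow> complex) \<Rightarrow> (nat \<Rightarrow> real) \<Rightarrow> complex" where
  "neg_op \<phi> c = of_real (u (c 1)) * \<phi> c + of_real (w (c 1)) * \<phi> (negate c)"

lemma neg_op_quadratic:
  assumes "admissible (c 1)"
  shows "neg_op (neg_op \<phi>) c = of_real (real a - real p) * neg_op \<phi> c + of_nat a * of_nat p * \<phi> c"
proof -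
  have 1: "complex_of_real ((u (c 1))\<^sup>2 + (w (c 1))\<^sup>2) = of_real ((real a - real p) * u (c 1) + real a * real p)"
    using x_quadratic(1)[OF assms] by (rule arg_cong)
  have 2: "complex_of_real (w (c 1) * (u (c 1) + u (- c 1))) = of_real (w (c 1) * (real a - real p))"
    using x_quadratic(2)[OF assms] by (rule arg_cong)
  have "neg_op (neg_op \<phi>) c = complex_of_real ((u (c 1))\<^sup>2 + (w (c 1))\<^sup>2) * \<phi> c
      + complex_of_real (w (c 1) * (u (c 1) + u (- c 1))) * \<phi> (negate c)"
    by (simp add: neg_op_def x_amp_minus algebra_simps power2_eq_square)
  also have "\<dots> = of_real (real a - real p) * neg_op \<phi> c + of_nat a * of_nat p * \<phi> c"
    unfolding 1 2 by (simp add: neg_op_def algebra_simps)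
  finally show ?thesis .
qed

text \<open>The operator of y_1 = z_1 - x_1, as z_1 acts by c_1 + h.\<close>

definition co_op :: "((nat \<Rightarrow> real) \<Rightarrow> complex) \<Rightarrow> (nat \<Rightarrow> real) \<Rightarrow> complex" where
  "co_op \<phi> c = of_real (c 1 + h) * \<phi> c - neg_op \<phi> c"

lemma co_op_quadratic:
  assumes "admissible (c 1)"
  shows "co_op (co_op \<phi>) c = of_real (real b - real q) * co_op \<phi> c + of_nat b * of_nat q * \<phi> c"
proof -
  let ?v = "\<lambda>x. x + h - u x"
  have 1: "complex_of_real ((?v (c 1))\<^sup>2 + (w (c 1))\<^sup>2) = of_real ((real b - real q) * ?v (c 1) + real b * real q)"
    using y_quadratic[OF assms] by (rule arg_cong)
  have "w (c 1) * (?v (c 1) + ?v (- c 1)) = w (c 1) * (2 * h) - w (c 1) * (u (c 1) + u (- c 1))"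
    by (simp add: algebra_simps)
  also have "\<dots> = w (c 1) * (real b - real q)"
    unfolding x_quadratic(2)[OF assms] sum_diff(3) by (simp add: algebra_simps)
  finally have 2: "complex_of_real (w (c 1) * (?v (c 1) + ?v (- c 1))) = of_real (w (c 1) * (real b - real q))"
    by (rule arg_cong)
  have "co_op (co_op \<phi>) c = complex_of_real ((?v (c 1))\<^sup>2 + (w (c 1))\<^sup>2) * \<phi> c
      - complex_of_real (w (c 1) * (?v (c 1) + ?v (- c 1))) * \<phi> (negate c)"
    by (simp add: co_op_def neg_op_def x_amp_minus algebra_simps power2_eq_square)
  also have "\<dots> = of_real (real b - real q) * co_op \<phi> c + of_nat b * of_nat q * \<phi> c"
    unfolding 1 2 by (simp add: co_op_def neg_op_def algebra_simps)
  finally show ?thesis .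
qed

text \<open>The relation x_1 x_2 = x_2 x_1 at one weight, with x_2 = t_1 x_1 t_1 + t_1 written
  out.\<close>

lemma boundary_braid:
  fixes c :: "nat \<Rightarrow> real"
  defines "x \<equiv> c 1" and "y \<equiv> c 2"
  assumes "admissible x" "1 \<le> \<bar>y - x\<bar>" "t_amp x y \<noteq> 0 \<Longrightarrow> admissible y"
    and "w x \<noteq> 0 \<Longrightarrow> 1 \<le> \<bar>y + x\<bar>"
    and "w x = 0 \<and> t_amp x y = 0 \<or> x + y \<noteq> 0 \<and> (y = 0 \<longrightarrow> D = 0)"
  shows "neg_op (swap_op 1 (neg_op (swap_op 1 \<phi>))) c + neg_op (swap_op 1 \<phi>) c
       = swap_op 1 (neg_op (swap_op 1 (neg_op \<phi>))) c + swap_op 1 (neg_op \<phi>) c"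
proof -
  note H = boundary_braid_coeffs[OF assms(3-7)]
  define U1 U1' U2 U2' w1 w2 where "U1 = complex_of_real (u x)" and "U1' = complex_of_real (u (- x))"
    and "U2 = complex_of_real (u y)" and "U2' = complex_of_real (u (- y))"
    and "w1 = complex_of_real (w x)" and "w2 = complex_of_real (w y)"
  define d e o1 o2 where "d = complex_of_real (t_coeff x y)" and "e = complex_of_real (t_coeff (- x) y)"
    and "o1 = complex_of_real (t_amp x y)" and "o2 = complex_of_real (t_amp (- x) y)"
  note folds = U1_def[symmetric] U1'_def[symmetric] U2_def[symmetric] U2'_def[symmetric]
    w1_def[symmetric] w2_def[symmetric] d_def[symmetric] e_def[symmetric] o1_def[symmetric] o2_def[symmetric]
  have h: "w1 * (d * (U1 - U2) + e * (U1' - U2) + 1) = 0"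
    "o1 * w2 * (e * (U1 - U2') - d * (U1 - U2) - 1) = 0"
    "w1 * (U1 * d * e + e\<^sup>2 * U1' + o2\<^sup>2 * U2 + e) = w1 * (d\<^sup>2 * U1 + d * e * U1' + o1\<^sup>2 * U2 + d)"
    "o1 * (d * (U1 - U2)\<^sup>2 + (U1 - U2) + e * (w1\<^sup>2 - w2\<^sup>2)) = 0"
    using H[THEN arg_cong[where f = complex_of_real]]
    unfolding of_real_mult of_real_add of_real_diff of_real_power of_real_1 of_real_0 folds
    by simp_all
  \<comment> \<open>The first two entries of a reflected weight are x and y up to order and signs,
    so all coefficients reduce to those of the pairs (x, y) and (-x, y).\<close>
  have coeffs: "t_coeff y x = - t_coeff x y" "t_coeff y (- x) = - t_coeff (- x) y"
    "t_coeff (- y) x = t_coeff (- x) y" "t_coeff (- y) (- x) = t_coeff x y"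
    "t_coeff x (- y) = - t_coeff (- x) y"
    and amps: "t_amp y x = t_amp x y" "t_amp y (- x) = t_amp (- x) y"
    "t_amp (- y) x = t_amp (- x) y" "t_amp (- y) (- x) = t_amp x y" "t_amp x (- y) = t_amp (- x) y"
    by (auto simp: t_coeff_def t_amp_def divide_simps add.commute power2_commute)
  have pt: "c (Suc 0) = x" "c 2 = y" "c (Suc (Suc 0)) = y"
    by (simp_all add: x_def y_def numeral_2_eq_2)
  define s :: "(nat \<Rightarrow> real) \<Rightarrow> nat \<Rightarrow> real" where "s = (\<lambda>c. c \<circ> adj (Suc 0))"
  have s1: "s f (Suc 0) = f (Suc (Suc 0))" "s f (Suc (Suc 0)) = f (Suc 0)" for f
    by (simp_all add: s_def adj_apply)
  have ss: "s (s f) = f" for f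
    by (simp add: s_def)
  have n2: "negate f (Suc (Suc 0)) = f (Suc (Suc 0))" for f
    by simp
  \<comment> \<open>The reflections of weights satisfy the braid relation of type B_2, also at the
    entry 0, to which both sides add 2 (c_1 + c_2).\<close>
  have all: "negate (s (negate (s c))) = s (negate (s (negate c)))"
    by (auto simp: negate_def s_def adj_def fun_eq_iff Transposition.transpose_def)
  have so: "swap_op (Suc 0) \<psi> f = of_real (t_coeff (f (Suc 0)) (f (Suc (Suc 0)))) * \<psi> f +
     of_real (t_amp (f (Suc 0)) (f (Suc (Suc 0)))) * \<psi> (s f)" for \<psi> f
    by (simp add: swap_op_def s_def)
  have no: "neg_op \<psi> f = of_real (u (f (Suc 0))) * \<psi> f + of_real (w (f (Suc 0))) * \<psi> (negate f)" for \<psi> f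
    by (simp add: neg_op_def)
  define fs fn fns fsn fsns fnsn fall where "fs = \<phi> (s c)" and "fn = \<phi> (negate c)"
    and "fns = \<phi> (s (negate c))" and "fsn = \<phi> (negate (s c))" and "fsns = \<phi> (s (negate (s c)))"
    and "fnsn = \<phi> (negate (s (negate c)))" and "fall = \<phi> (s (negate (s (negate c))))"
  note ffolds = fs_def[symmetric] fn_def[symmetric] fns_def[symmetric] fsn_def[symmetric]
    fsns_def[symmetric] fnsn_def[symmetric] fall_def[symmetric]
  have L: "neg_op (swap_op 1 (neg_op (swap_op 1 \<phi>))) c + neg_op (swap_op 1 \<phi>) c =
    U1 * (d * (U1 * (d * \<phi> c + o1 * fs) + w1 * (e * fn + o2 * fns))
        + o1 * (U2 * (- d * fs + o1 * \<phi> c) + w2 * (e * fsn + o2 * fsns)))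
    + w1 * (e * (U1' * (e * fn + o2 * fns) + w1 * (d * \<phi> c + o1 * fs))
        + o2 * (U2 * (- e * fns + o2 * fn) + w2 * (d * fnsn + o1 * fall)))
    + (U1 * (d * \<phi> c + o1 * fs) + w1 * (e * fn + o2 * fns))"
    by (simp add: so no s1 ss n2 pt coeffs amps x_amp_minus folds ffolds)
  have R: "swap_op 1 (neg_op (swap_op 1 (neg_op \<phi>))) c + swap_op 1 (neg_op \<phi>) c =
    d * (U1 * (d * (U1 * \<phi> c + w1 * fn) + o1 * (U2 * fs + w2 * fsn))
        + w1 * (e * (U1' * fn + w1 * \<phi> c) + o2 * (U2 * fns + w2 * fnsn)))
    + o1 * (U2 * (- d * (U2 * fs + w2 * fsn) + o1 * (U1 * \<phi> c + w1 * fn))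
        + w2 * (e * (U2' * fsn + w2 * fs) + o2 * (U1 * fsns + w1 * fall)))
    + (d * (U1 * \<phi> c + w1 * fn) + o1 * (U2 * fs + w2 * fsn))"
    by (simp add: so no s1 ss n2 pt coeffs amps x_amp_minus all folds ffolds)
  have "(neg_op (swap_op 1 (neg_op (swap_op 1 \<phi>))) c + neg_op (swap_op 1 \<phi>) c)
     - (swap_op 1 (neg_op (swap_op 1 (neg_op \<phi>))) c + swap_op 1 (neg_op \<phi>) c)
    = fns * (o2 * (w1 * (d * (U1 - U2) + e * (U1' - U2) + 1)))
    + fsn * (o1 * w2 * (e * (U1 - U2') - d * (U1 - U2) - 1))
    + fn * (w1 * (U1 * d * e + e\<^sup>2 * U1' + o2\<^sup>2 * U2 + e) - w1 * (d\<^sup>2 * U1 + d * e * U1' + o1\<^sup>2 * U2 + d))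
    + fs * (o1 * (d * (U1 - U2)\<^sup>2 + (U1 - U2) + e * (w1\<^sup>2 - w2\<^sup>2)))"
    unfolding L R by (simp add: algebra_simps power2_eq_square)
  also have "\<dots> = 0"
    unfolding h by simp
  finally show ?thesis
    by simp
qed

end

section \<open>The operators on functions of weights\<close>

lift_definition t_op :: "(nat \<Rightarrow> real) set \<Rightarrow> nat \<Rightarrow> (nat \<Rightarrow> real) op" is
  "\<lambda>W i \<phi> c. if c \<in> W then swap_op i \<phi> c else \<phi> c"
  by (auto simp: swap_op_def fun_eq_iff algebra_simps)

lift_definition x_op :: "nat \<Rightarrow> nat \<Rightarrow> nat \<Rightarrow> nat \<Rightarrow> (nat \<Rightarrow> real) set \<Rightarrow> (nat \<Rightarrow> real) op" is
  "\<lambda>a b p q W \<phi> c. if c \<in> W then boundary_parameters.neg_op a b p q \<phi> c else of_nat a * \<phi> c"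
  by (auto simp: boundary_parameters.neg_op_def fun_eq_iff algebra_simps)

lift_definition z_op :: "nat \<Rightarrow> nat \<Rightarrow> nat \<Rightarrow> nat \<Rightarrow> (nat \<Rightarrow> real) set \<Rightarrow> nat \<Rightarrow> (nat \<Rightarrow> real) op" is
  "\<lambda>a b p q W i \<phi> c. (if c \<in> W then of_real (c i + half_shift a b p q)
      else if i = 0 then 0 else of_nat (a + b + i - 1)) * \<phi> c"
  by (auto simp: fun_eq_iff algebra_simps)

text \<open>Outside \<open>W\<close> the operators act through the one-dimensional representation
  \<open>t \<mapsto> 1\<close>, \<open>x\<^sub>1 \<mapsto> a\<close>, \<open>z\<^sub>0 \<mapsto> 0\<close>, \<open>z\<^sub>i \<mapsto> a + b + i - 1\<close>, so that all relations hold
  exactly and not only on the functions supported on \<open>W\<close>.\<close>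

locale weight_set = boundary_parameters a b p q for a b p q :: nat +
  fixes k :: nat and W :: "(nat \<Rightarrow> real) set"
  assumes k_pos: "1 \<le> k"
    and swap_mem: "c \<in> W \<Longrightarrow> i \<in> {1..k-1} \<Longrightarrow> t_amp (c i) (c (Suc i)) \<noteq> 0 \<Longrightarrow> c \<circ> adj i \<in> W"
    and gap1: "c \<in> W \<Longrightarrow> i \<in> {1..k-1} \<Longrightarrow> gap i (Suc i) c"
    and gap2: "c \<in> W \<Longrightarrow> 1 \<le> i \<Longrightarrow> Suc i \<le> k - 1 \<Longrightarrow> gap i (Suc (Suc i)) c"
    and negate_mem: "c \<in> W \<Longrightarrow> w (c 1) \<noteq> 0 \<Longrightarrow> negate c \<in> W"
    and admissible_W: "c \<in> W \<Longrightarrow> admissible (c 1)"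
    and regular_W: "c \<in> W \<Longrightarrow> 2 \<le> k \<Longrightarrow>
      w (c 1) = 0 \<and> t_amp (c 1) (c 2) = 0 \<or> c 1 + c 2 \<noteq> 0 \<and> (c 2 = 0 \<longrightarrow> D = 0)"
begin

abbreviation "t i \<equiv> t_op W i"
abbreviation "X \<equiv> x_op a b p q W"
abbreviation "Z i \<equiv> z_op a b p q W i"

lemma app_off:
  assumes "c \<notin> W"
  shows "app (t i) \<phi> c = \<phi> c" "app X \<phi> c = of_nat a * \<phi> c"
    "app (Z i) \<phi> c = (if i = 0 then 0 else of_nat (a + b + i - 1)) * \<phi> c"
  using assms by (transfer, simp)+

lemma app_on:
  assumes "c \<in> W"
  shows "app (t i) \<phi> c = swap_op i \<phi> c" "app X \<phi> c = neg_op \<phi> c"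
    "app (Z i) \<phi> c = of_real (c i + h) * \<phi> c"
  using assms by (transfer, simp)+

text \<open>Only the values on \<open>W\<close> matter: the reflected weight lies in
  \<open>W\<close>, or its value is multiplied by 0. Hence products of operators can be unfolded
  factor by factor on \<open>W\<close>.\<close>

lemma swap_op_cong:
  assumes "c \<in> W" "i \<in> {1..k-1}" "\<And>c. c \<in> W \<Longrightarrow> \<phi> c = \<psi> c"
  shows "swap_op i \<phi> c = swap_op i \<psi> c"
  using assms swap_mem[OF assms(1,2)]
  by (cases "t_amp (c i) (c (Suc i)) = 0") (auto simp: swap_op_def)

lemma neg_op_cong:
  assumes "c \<in> W" "\<And>c. c \<in> W \<Longrightarrow> \<phi> c = \<psi> c"
  shows "neg_op \<phi> c = neg_op \<psi> c"
  using assms negate_mem[OF assms(1)]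
  by (cases "w (c 1) = 0") (auto simp: neg_op_def)

lemma t_on: "c \<in> W \<Longrightarrow> i \<in> {1..k-1} \<Longrightarrow> (\<And>c. c \<in> W \<Longrightarrow> \<phi> c = \<psi> c) \<Longrightarrow> app (t i) \<phi> c = swap_op i \<psi> c"
  by (simp only: app_on(1)) (rule swap_op_cong)

lemma X_on: "c \<in> W \<Longrightarrow> (\<And>c. c \<in> W \<Longrightarrow> \<phi> c = \<psi> c) \<Longrightarrow> app X \<phi> c = neg_op \<psi> c"
  by (simp only: app_on(2)) (rule neg_op_cong)

lemma op_eq_W:
  assumes "\<And>c \<phi>. c \<in> W \<Longrightarrow> app F \<phi> c = app G \<phi> c" "\<And>c \<phi>. c \<notin> W \<Longrightarrow> app F \<phi> c = app G \<phi> c"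
  shows "F = G"
  using assms by (intro op_eqI) blast

lemma t_op_sq: "i \<in> {1..k-1} \<Longrightarrow> t i * t i = 1"
  by (rule op_eq_W) (simp_all add: app_off t_on[OF _ _ app_on(1)] swap_op_sq gap1)

lemma t_op_far:
  assumes "i \<in> {1..k-1}" "j \<in> {1..k-1}" "i + 2 \<le> j"
  shows "t i * t j = t j * t i"
  using assms swap_op_far[OF assms(3)]
  by (intro op_eq_W) (simp_all add: app_off t_on[OF _ _ app_on(1)])

lemma t_op_braid:
  assumes "i \<in> {1..<k-1}"
  shows "t i * t (i + 1) * t i = t (i + 1) * t i * t (i + 1)"
proof (rule op_eq_W)
  have i: "i \<in> {1..k-1}" "Suc i \<in> {1..k-1}"
    using assms by auto
  fix c \<phi> assume c: "c \<in> W"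
  have "app (t i * t (Suc i) * t i) \<phi> c = swap_op i (swap_op (Suc i) (swap_op i \<phi>)) c"
    by (simp add: t_on[OF c i(1) t_on[OF _ i(2) app_on(1)]])
  moreover have "app (t (Suc i) * t i * t (Suc i)) \<phi> c = swap_op (Suc i) (swap_op i (swap_op (Suc i) \<phi>)) c"
    by (simp add: t_on[OF c i(2) t_on[OF _ i(1) app_on(1)]])
  ultimately show "app (t i * t (i + 1) * t i) \<phi> c = app (t (i + 1) * t i * t (i + 1)) \<phi> c"
    using swap_op_braid[OF gap1[OF c i(1)] gap1[OF c i(2)] gap2[OF c]] i by simp
qed (simp add: app_off)

lemma Z_comm: "Z i * Z j = Z j * Z i"
  by (rule op_eq_W) (simp_all add: app_off app_on)

lemma t_Z_comm:
  assumes "i \<in> {1..k-1}" "j \<noteq> i" "j \<noteq> i + 1"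
  shows "t i * Z j = Z j * t i"
proof (rule op_eq_W)
  fix c \<phi> assume c: "c \<in> W"
  show "app (t i * Z j) \<phi> c = app (Z j * t i) \<phi> c"
    using assms c by (simp add: t_on[OF _ _ app_on(3)] app_on swap_op_def adj_apply algebra_simps)
qed (use assms in \<open>simp add: app_off\<close>)

lemma t_Z_hecke:
  assumes "i \<in> {1..k-1}"
  shows "t i * Z i = Z (i + 1) * t i - 1"
proof (rule op_eq_W)
  fix c \<phi> assume c: "c \<in> W"
  have "t_coeff (c i) (c (Suc i)) * (c (Suc i) - c i) = 1"
    using gap1[OF c assms] by (simp add: gap_def t_coeff_def)
  then have "complex_of_real (t_coeff (c i) (c (Suc i)) * (c (Suc i) - c i)) = 1"
    by simp
  then have d: "of_real (t_coeff (c i) (c (Suc i))) * complex_of_real (c (Suc i)) * \<phi> c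
      = of_real (t_coeff (c i) (c (Suc i))) * complex_of_real (c i) * \<phi> c + \<phi> c"
    by (simp add: algebra_simps)
  show "app (t i * Z i) \<phi> c = app (Z (i + 1) * t i - 1) \<phi> c"
    using assms c d by (simp add: t_on[OF _ _ app_on(3)] app_on swap_op_def adj_apply algebra_simps)
next
  fix c \<phi> assume "c \<notin> W"
  then show "app (t i * Z i) \<phi> c = app (Z (i + 1) * t i - 1) \<phi> c"
    using assms by (simp add: app_off of_nat_diff algebra_simps)
qed

lemma t_X_comm:
  assumes "i \<in> {2..k-1}"
  shows "t i * X = X * t i"
proof (rule op_eq_W)
  fix c \<phi> assume c: "c \<in> W"
  have i: "i \<in> {1..k-1}"
    using assms by auto
  have n: "negate c \<circ> adj i = negate (c \<circ> adj i)"
    using assms by (auto simp: negate_def adj_def fun_eq_iff Transposition.transpose_def)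
  have "app (t i * X) \<phi> c = swap_op i (neg_op \<phi>) c" "app (X * t i) \<phi> c = neg_op (swap_op i \<phi>) c"
    using c i by (simp_all add: t_on[OF _ _ app_on(2)] X_on[OF _ app_on(1)])
  moreover have "swap_op i (neg_op \<phi>) c = neg_op (swap_op i \<phi>) c"
    using assms by (simp add: swap_op_def neg_op_def n adj_apply algebra_simps)
  ultimately show "app (t i * X) \<phi> c = app (X * t i) \<phi> c"
    by simp
qed (use assms in \<open>simp add: app_off\<close>)

lemma Z_X_comm:
  assumes "i \<in> {2..k}"
  shows "Z i * X = X * Z i"
proof (rule op_eq_W)
  fix c \<phi> assume c: "c \<in> W"
  show "app (Z i * X) \<phi> c = app (X * Z i) \<phi> c"
    using c assms by (simp add: X_on[OF _ app_on(3)] app_on neg_op_def algebra_simps)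
qed (simp add: app_off)

lemma Z01_X_comm: "(Z 0 + Z 1) * X = X * (Z 0 + Z 1)"
proof (rule op_eq_W)
  fix c \<phi> assume c: "c \<in> W"
  \<comment> \<open>The sum c_0 + c_1 is invariant under \<open>negate\<close>, so multiplication by
    c_0 + c_1 + 2 h commutes with the reflection.\<close>
  have "app (X * (Z 0 + Z 1)) \<phi> c = neg_op (\<lambda>c. of_real (c 0 + c 1 + 2 * h) * \<phi> c) c"
    using c by (simp, intro X_on) (auto simp: app_on algebra_simps)
  then show "app ((Z 0 + Z 1) * X) \<phi> c = app (X * (Z 0 + Z 1)) \<phi> c"
    using c by (simp add: app_on neg_op_def algebra_simps)
qed (simp add: app_off algebra_simps)

lemma X_X2_comm:
  assumes "2 \<le> k"
  shows "X * (t 1 * X * t 1 + t 1) = (t 1 * X * t 1 + t 1) * X"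
proof (rule op_eq_W)
  have k: "1 \<in> {1..k-1}"
    using assms by auto
  fix c \<phi> assume c: "c \<in> W"
  have tX: "app (t 1) \<psi> c = swap_op 1 \<psi>' c" if "c \<in> W" "\<And>c. c \<in> W \<Longrightarrow> \<psi> c = \<psi>' c" for c \<psi> \<psi>'
    using that k by (intro t_on)
  have L: "app (X * (t 1 * X * t 1)) \<phi> c = neg_op (swap_op 1 (neg_op (swap_op 1 \<phi>))) c"
    by (simp only: app_simps) (intro X_on tX c app_on(1))
  have L': "app (X * t 1) \<phi> c = neg_op (swap_op 1 \<phi>) c"
    by (simp only: app_simps) (intro X_on tX c app_on(1))
  have R: "app (t 1 * X * t 1 * X) \<phi> c = swap_op 1 (neg_op (swap_op 1 (neg_op \<phi>))) c"
    by (simp only: app_simps) (intro X_on tX c app_on(2))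
  have R': "app (t 1 * X) \<phi> c = swap_op 1 (neg_op \<phi>) c"
    by (simp only: app_simps) (intro X_on tX c app_on(2))
  have "neg_op (swap_op 1 (neg_op (swap_op 1 \<phi>))) c + neg_op (swap_op 1 \<phi>) c
       = swap_op 1 (neg_op (swap_op 1 (neg_op \<phi>))) c + swap_op 1 (neg_op \<phi>) c"
  proof (rule boundary_braid)
    show "admissible (c 1)"
      using admissible_W[OF c] .
    show "1 \<le> \<bar>c 2 - c 1\<bar>"
      using gap1[OF c k] by (simp add: gap_def numeral_2_eq_2)
    show "admissible (c 2)" if "t_amp (c 1) (c 2) \<noteq> 0"
      using admissible_W[OF swap_mem[OF c k]] that by (simp add: adj_apply numeral_2_eq_2)
    \<comment> \<open>This is the gap of the negated weight, whose first entry is - c_1.\<close>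
    show "1 \<le> \<bar>c 2 + c 1\<bar>" if "w (c 1) \<noteq> 0"
      using gap1[OF negate_mem[OF c that] k] by (simp add: gap_def numeral_2_eq_2)
    show "w (c 1) = 0 \<and> t_amp (c 1) (c 2) = 0 \<or> c 1 + c 2 \<noteq> 0 \<and> (c 2 = 0 \<longrightarrow> D = 0)"
      by (rule regular_W[OF c assms])
  qed
  then show "app (X * (t 1 * X * t 1 + t 1)) \<phi> c = app ((t 1 * X * t 1 + t 1) * X) \<phi> c"
    unfolding distrib_left distrib_right app_simps(3) L L' R R' .
qed (simp add: app_off algebra_simps)

lemma op_quadratic:
  "app ((G - scalar_op \<alpha>) * (G + scalar_op \<beta>)) \<phi> c =
     app G (app G \<phi>) c + (\<beta> - \<alpha>) * app G \<phi> c - \<alpha> * \<beta> * \<phi> c"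
proof -
  have "app (G + scalar_op \<beta>) \<phi> = (\<lambda>c. app G \<phi> c + \<beta> * \<phi> c)"
    by auto
  then have "app G (app (G + scalar_op \<beta>) \<phi>) = (\<lambda>c. app G (app G \<phi>) c + \<beta> * app G \<phi> c)"
    by (simp only: app_add_fun app_cmult_fun)
  then show ?thesis
    by (simp only: app_simps app_scalar_op) (simp add: algebra_simps)
qed

lemma X_quadratic: "(X - scalar_op (of_nat a)) * (X + scalar_op (of_nat p)) = 0"
proof (rule op_eq_W)
  fix c \<phi> assume c: "c \<in> W"
  have XX: "app X (app X \<phi>) c = neg_op (neg_op \<phi>) c"
    by (intro X_on c app_on(2))
  show "app ((X - scalar_op (of_nat a)) * (X + scalar_op (of_nat p))) \<phi> c = app 0 \<phi> c"
    unfolding op_quadratic XX unfolding app_on(2)[OF c] neg_op_quadratic[of c, OF admissible_W[OF c], of \<phi>]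
    by (simp add: algebra_simps)
qed (simp add: app_off)

lemma Y_quadratic: "(Z 1 - X - scalar_op (of_nat b)) * (Z 1 - X + scalar_op (of_nat q)) = 0"
proof (rule op_eq_W)
  let ?Y = "Z 1 - X"
  have Y: "app ?Y \<phi> c = co_op \<phi> c" if "c \<in> W" for \<phi> c
    using that by (simp add: co_op_def app_on)
  fix c \<phi> assume c: "c \<in> W"
  have "neg_op (app ?Y \<phi>) c = neg_op (co_op \<phi>) c"
    by (rule neg_op_cong[OF c Y])
  then have YY: "app ?Y (app ?Y \<phi>) c = co_op (co_op \<phi>) c"
    unfolding Y[OF c] unfolding co_op_def[of "app ?Y \<phi>"] co_op_def[of "co_op \<phi>"] Y[OF c] by (rule arg_cong)
  show "app ((?Y - scalar_op (of_nat b)) * (?Y + scalar_op (of_nat q))) \<phi> c = app 0 \<phi> c"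
    unfolding op_quadratic YY unfolding Y[OF c] co_op_quadratic[of c, OF admissible_W[OF c], of \<phi>]
    by (simp add: algebra_simps)
qed (simp add: app_off algebra_simps)

lemma representation:
  obtains \<rho> where "two_boundary_relations k \<rho> X Z" "\<And>i. i \<in> {1..k-1} \<Longrightarrow> \<rho> (adj i) = t i"
    and "\<And>P w. w permutes {1..k} \<Longrightarrow> P 1 \<Longrightarrow> (\<And>r i. P r \<Longrightarrow> i \<in> {1..k-1} \<Longrightarrow> P (r * t i)) \<Longrightarrow> P (\<rho> w)"
proof -
  obtain \<rho> where \<rho>: "\<rho> id = 1"
    "\<And>w w'. w permutes {1..k} \<Longrightarrow> w' permutes {1..k} \<Longrightarrow> \<rho> (w \<circ> w') = \<rho> w * \<rho> w'"
    "\<And>i. i \<in> {1..k-1} \<Longrightarrow> \<rho> (adj i) = t i"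
    "\<And>P w. w permutes {1..k} \<Longrightarrow> P 1 \<Longrightarrow> (\<And>r i. P r \<Longrightarrow> i \<in> {1..k-1} \<Longrightarrow> P (r * t i)) \<Longrightarrow> P (\<rho> w)"
    by (rule symmetric_group_presentation[of k t, OF t_op_sq t_op_far t_op_braid]) (blast+)?
  have "two_boundary_relations k \<rho> X Z"
  proof
    show "X * (\<rho> (adj 1) * X * \<rho> (adj 1) + \<rho> (adj 1)) = (\<rho> (adj 1) * X * \<rho> (adj 1) + \<rho> (adj 1)) * X"
      if "2 \<le> k"
      using X_X2_comm[OF that] \<rho>(3)[of 1] that by simp
  qed (use \<rho> t_Z_hecke t_Z_comm Z_comm t_X_comm Z_X_comm Z01_X_comm k_pos in auto)
  with \<rho>(3,4) show ?thesis
    using that by blast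
qed

end

section \<open>Partitions and boxes\<close>

lemma partition_antimono:
  assumes "is_partition mu" "1 \<le> r" "r \<le> s"
  shows "mu s \<le> mu r"
  using assms(3)
proof (induction s rule: dec_induct)
  case (step n)
  then have "mu (Suc n) \<le> mu n"
    using assms by (simp add: is_partition_def)
  then show ?case
    using step.IH by simp
qed simp

lemma partition_zero: "is_partition mu \<Longrightarrow> mu 0 = 0"
  by (simp add: is_partition_def)

lemma is_partitionI:
  assumes "is_partition mu" "nu 0 = 0" "\<And>r. 1 \<le> r \<Longrightarrow> nu (Suc r) \<le> nu r" "finite {r. nu r \<noteq> mu r}"
  shows "is_partition nu"
proof -
  have "{r. nu r \<noteq> 0} \<subseteq> {r. nu r \<noteq> mu r} \<union> {r. mu r \<noteq> 0}"
    by auto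
  then show ?thesis
    using assms by (auto simp: is_partition_def intro: finite_subset)
qed

lemma is_partition_upd:
  assumes "is_partition mu" "1 \<le> r" "r = 1 \<or> mu r < mu (r - 1)"
  shows "is_partition (mu(r := Suc (mu r)))"
proof (rule is_partitionI[OF assms(1)])
  show "(mu(r := Suc (mu r))) (Suc s) \<le> (mu(r := Suc (mu r))) s" if "1 \<le> s" for s
    using assms that by (auto simp: is_partition_def intro: le_SucI)
  show "finite {s. (mu(r := Suc (mu r))) s \<noteq> mu s}"
    by (rule finite_subset[of _ "{r}"]) auto
qed (use assms in \<open>auto simp: is_partition_def\<close>)

definition adds :: "partition \<Rightarrow> nat \<Rightarrow> partition \<Rightarrow> bool" where
  "adds mu r nu \<longleftrightarrow> is_partition mu \<and> is_partition nu \<and> 1 \<le> r \<and> nu = mu(r := Suc (mu r))"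

lemma addsD:
  assumes "adds mu r nu"
  shows "is_partition mu" "is_partition nu" "1 \<le> r" "nu r = Suc (mu r)" "s \<noteq> r \<Longrightarrow> nu s = mu s"
    and "nu = mu(r := Suc (mu r))"
  using assms by (auto simp: adds_def)

lemma adds_prev:
  assumes "adds mu r nu" "2 \<le> r"
  shows "mu r < mu (r - 1)"
proof -
  have "nu r \<le> nu (r - 1)"
    using partition_antimono[OF addsD(2)[OF assms(1)], of "r - 1" r] assms(2) by auto
  then show ?thesis
    using addsD(4)[OF assms(1)] addsD(5)[OF assms(1), of "r - 1"] assms(2) by simp
qed

lemma boxes_upd: "1 \<le> r \<Longrightarrow> boxes (mu(r := Suc (mu r))) = insert (r, Suc (mu r)) (boxes mu)"
  by (auto simp: boxes_def split: if_splits)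

lemma adds_boxes:
  assumes "adds mu r nu"
  shows "boxes nu = insert (r, Suc (mu r)) (boxes mu)" "(r, Suc (mu r)) \<notin> boxes mu"
  using assms boxes_upd[of r mu] by (auto simp: adds_def boxes_def)

lemma the_elem_adds: "adds mu r nu \<Longrightarrow> the_elem (boxes nu - boxes mu) = (r, Suc (mu r))"
  using adds_boxes[of mu r nu] by (simp add: insert_Diff_if)

lemma boxes_subset_iff:
  assumes "is_partition mu"
  shows "boxes mu \<subseteq> boxes nu \<longleftrightarrow> (\<forall>r. mu r \<le> nu r)"
proof
  assume sub: "boxes mu \<subseteq> boxes nu"
  show "\<forall>r. mu r \<le> nu r"
  proof
    fix r
    show "mu r \<le> nu r"
    proof (cases "mu r = 0")
      case False
      then have "r \<noteq> 0"
        using partition_zero[OF assms] by (metis)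
      with False have "(r, mu r) \<in> boxes mu"
        by (simp add: boxes_def)
      with sub show ?thesis
        by (auto simp: boxes_def)
    qed simp
  qed
next
  assume "\<forall>r. mu r \<le> nu r"
  then show "boxes mu \<subseteq> boxes nu"
    by (auto simp: boxes_def intro: le_trans)
qed

lemma adds_box_iff: "adds_box mu nu \<longleftrightarrow> (\<exists>r. adds mu r nu)"
proof
  assume "adds_box mu nu"
  then obtain r c where P: "is_partition mu" "is_partition nu" and B: "(r, c) \<notin> boxes mu"
    and eq: "boxes nu = insert (r, c) (boxes mu)"
    by (auto simp: adds_box_def)
  have "(r, c) \<in> boxes nu"
    using eq by simp
  then have r: "1 \<le> r" "1 \<le> c" "c \<le> nu r"
    by (auto simp: boxes_def)
  have le: "mu s \<le> nu s" for s
    using boxes_subset_iff[OF P(1), of nu] eq by blast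
  have row: "d \<le> mu s \<or> (s, d) = (r, c)" if "1 \<le> s" "1 \<le> d" "d \<le> nu s" for s d
  proof -
    have "(s, d) \<in> boxes nu"
      using that by (simp add: boxes_def)
    then show ?thesis
      using eq by (auto simp: boxes_def)
  qed
  have other: "nu s = mu s" if "s \<noteq> r" for s
  proof (cases "nu s = 0 \<or> s = 0")
    case True
    then show ?thesis
      using le[of s] partition_zero[OF P(1)] partition_zero[OF P(2)] by auto
  next
    case False
    then show ?thesis
      using row[of s "nu s"] le[of s] that by auto
  qed
  have "mu r < c"
    using B r by (auto simp: boxes_def)
  then have "Suc (mu r) = c"
    using row[of r "Suc (mu r)"] r by auto
  moreover have "nu r = c"
    using row[of r "nu r"] r \<open>mu r < c\<close> by auto
  ultimately have "nu = mu(r := Suc (mu r))"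
    using other by (auto simp: fun_eq_iff)
  then show "\<exists>r. adds mu r nu"
    using P r by (auto simp: adds_def)
next
  assume "\<exists>r. adds mu r nu"
  then obtain r where "adds mu r nu" ..
  then show "adds_box mu nu"
    using adds_boxes[of mu r nu] by (auto simp: adds_box_def adds_def)
qed

text \<open>The numbers \<open>int (nu r) - int r\<close> strictly decrease along the rows, so the
  content of the last box of a row identifies the row.\<close>

lemma adds_row_unique:
  assumes "adds mu r nu" "adds mu' s nu" "int (nu r) - int r = int (nu s) - int s"
  shows "r = s" "mu = mu'"
proof -
  have "\<not> r < s" "\<not> s < r"
    using partition_antimono[OF addsD(2)[OF assms(1)], of r s] partition_antimono[OF addsD(2)[OF assms(1)], of s r]
      addsD(3)[OF assms(1)] addsD(3)[OF assms(2)] assms(3) by linarith+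
  then show rs: "r = s"
    by simp
  show "mu = mu'"
  proof
    fix x
    show "mu x = mu' x"
      using addsD(4)[OF assms(1)] addsD(5)[OF assms(1), of x] addsD(4)[OF assms(2)] addsD(5)[OF assms(2), of x] rs by (cases "x = r") auto
  qed
qed

definition box_content :: "partition \<Rightarrow> nat \<Rightarrow> int" where
  "box_content mu r = int (Suc (mu r)) - int r"

lemma consecutive_contents:
  assumes "adds mu r nu" "adds nu s ka"
  shows "box_content nu s \<noteq> box_content mu r"
proof -
  note * = addsD[OF assms(1)] addsD[OF assms(2)]
  show ?thesis
    using *(4) *(5)[of s] partition_antimono[OF *(1), of r s] partition_antimono[OF *(1), of s r] *(3) *(9)
    by (cases r s rule: linorder_cases) (auto simp: box_content_def)
qed

lemma swap_boxes:
  assumes "adds mu r nu" "adds nu s ka" "\<bar>box_content nu s - box_content mu r\<bar> \<noteq> 1"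
  defines "mu' \<equiv> mu(s := Suc (mu s))"
  shows "r \<noteq> s" "adds mu s mu'" "adds mu' r ka"
    and "box_content mu s = box_content nu s" "box_content mu' r = box_content mu r"
    and "mu' = (\<lambda>t. mu t + (ka t - nu t))"
proof -
  note 1 = addsD[OF assms(1)] and 2 = addsD[OF assms(2)]
  show rs: "r \<noteq> s"
    using assms(3) 1(4) by (auto simp: box_content_def)
  then have nus: "nu s = mu s"
    using 1(5) by simp
  then show "box_content mu s = box_content nu s"
    by (simp add: box_content_def)
  have "mu s < mu (s - 1)" if "2 \<le> s"
  proof (cases "r = s - 1")
    case True
    have "nu s < nu (s - 1)"
      using adds_prev[OF assms(2) that] .
    then have "mu s \<le> mu (s - 1)"
      using 1(4) nus True by simp
    \<comment> \<open>Equality would put the two boxes into one column and adjacent rows, with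
      contents differing by 1.\<close>
    moreover have "mu s \<noteq> mu (s - 1)"
      using assms(3) True that nus by (auto simp: box_content_def of_nat_diff)
    ultimately show ?thesis by simp
  next
    case False
    then show ?thesis
      using adds_prev[OF assms(2) that] nus 1(5)[of "s - 1"] by simp
  qed
  then have "s = 1 \<or> mu s < mu (s - 1)"
    using 2(3) by force
  then have mu': "is_partition mu'"
    unfolding mu'_def using is_partition_upd[OF 1(1) 2(3)] by simp
  then show "adds mu s mu'"
    using 1(1) 2(3) by (simp add: adds_def mu'_def)
  show "adds mu' r ka"
    using mu' 2(2,6) 1(3,6) rs nus by (auto simp: adds_def mu'_def fun_upd_twist)
  show "box_content mu' r = box_content mu r"
    using rs by (simp add: mu'_def box_content_def)
  show "mu' = (\<lambda>t. mu t + (ka t - nu t))"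
    using 2(4,5) nus by (auto simp: mu'_def fun_eq_iff)
qed

text \<open>The next box on a diagonal requires both the box to the right of and the box below the
  previous one, but only one box is added in between.\<close>

lemma alternate_contents:
  assumes "adds mu r nu" "adds nu s ka" "adds ka t la"
  shows "box_content ka t \<noteq> box_content mu r"
proof
  assume eq: "box_content ka t = box_content mu r"
  note 1 = addsD[OF assms(1)] and 2 = addsD[OF assms(2)] and 3 = addsD[OF assms(3)]
  have kanu: "nu x \<le> ka x" for x
    using 2(4) 2(5)[of x] by (cases "x = s") auto
  have numu: "mu x \<le> nu x" for x
    using 1(4) 1(5)[of x] by (cases "x = r") auto
  have e: "int (ka t) - int t = int (mu r) - int r"
    using eq by (simp add: box_content_def)
  show False
  proof (cases r t rule: linorder_cases)
    case equal
    then show False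
      using e 1(4) kanu[of r] by simp
  next
    case greater
    then show False
      using partition_antimono[OF 2(2), of t r] e kanu[of r] 1(4) 3(3) by simp
  next
    case less
    have a: "ka t < ka (t - 1)"
      using adds_prev[OF assms(3)] less 1(3) by simp
    have "ka (t - 1) \<le> ka r"
      using partition_antimono[OF 2(2), of r "t - 1"] less 1(3) by simp
    then have row1: "nu r < ka r"
      using a e less 1(4) by linarith
    then have s: "s = r"
      using 2(5)[of r] by auto
    have "ka t \<le> ka (Suc r)"
      using partition_antimono[OF 2(2), of "Suc r" t] less by simp
    moreover have "ka (Suc r) = mu (Suc r)"
      using s 2(5)[of "Suc r"] 1(5)[of "Suc r"] by simp
    moreover have "mu (Suc r) \<le> mu r"
      using partition_antimono[OF 1(1), of r "Suc r"] 1(3) by simp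
    ultimately show False
      using e less by linarith
  qed
qed

lemma tableaux_iff:
  "T \<in> tableaux a b p q k lam \<longleftrightarrow> length T = k + 1 \<and> T ! k = lam \<and> T ! 0 \<in> P0 a b p q \<and>
     (\<forall>i<k. adds_box (T ! i) (T ! (i + 1)))"
proof -
  have "T ! i \<in> Pset a b p q i"
    if "T ! 0 \<in> P0 a b p q" "\<forall>i<k. adds_box (T ! i) (T ! (i + 1))" "i \<le> k" for i
    using that(3)
  proof (induction i)
    case (Suc i)
    then have "adds_box (T ! i) (T ! Suc i)" "T ! i \<in> Pset a b p q i"
      using that(2) by auto
    then show ?case
      by auto
  qed (use that in simp)
  then show ?thesis
    by (auto simp: tableaux_def)
qed

lemma tableaux_partition:
  assumes "T \<in> tableaux a b p q k lam" "i \<le> k"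
  shows "is_partition (T ! i)"
proof (cases i)
  case 0
  then show ?thesis
    using assms by (simp add: tableaux_iff P0_def)
next
  case (Suc j)
  then show ?thesis
    using assms by (auto simp: tableaux_iff adds_box_def)
qed

section \<open>The partitions in P_0 and the boxes that can be added to them\<close>

locale seminormal_parameters = boundary_parameters a b p q for a b p q :: nat +
  assumes a_pos: "0 < a" and b_pos: "0 < b" and p_pos: "0 < p" and q_pos: "0 < q" and q_le_p: "q \<le> p"
begin

abbreviation "P \<equiv> P0 a b p q"

text \<open>The image of row i under the rotation by 180 degrees of the rectangle with p + q rows
  and a + b columns. For i in {1..q}, the two rows of an element of \<open>P\<close> have
  complementary lengths.\<close>

definition conj_row :: "nat \<Rightarrow> nat" where
  "conj_row i = p + q + 1 - i"

lemma P_D: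
  assumes "mu \<in> P"
  shows "is_partition mu" "r > p + q \<Longrightarrow> mu r = 0" "q < r \<Longrightarrow> r \<le> p \<Longrightarrow> mu r = a"
    "a \<le> mu q" "b \<le> mu q" "i \<in> {1..q} \<Longrightarrow> mu i + mu (conj_row i) = a + b"
  using assms by (auto simp: P0_def conj_row_def Suc_diff_le)

lemma P_top:
  assumes "mu \<in> P" "i \<in> {1..q}"
  shows "a \<le> mu i" "b \<le> mu i" "mu i \<le> a + b"
  using P_D(4,5)[OF assms(1)] partition_antimono[OF P_D(1)[OF assms(1)], of i q] P_D(6)[OF assms] assms(2)
  by auto

lemma conj_row_range: "i \<in> {1..q} \<Longrightarrow> p < conj_row i \<and> conj_row i \<le> p + q"
  by (auto simp: conj_row_def)

lemma P_I:
  assumes "is_partition mu" "\<And>i. i \<in> {1..q} \<Longrightarrow> mu i + mu (conj_row i) = a + b"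
    "\<And>r. r > p + q \<Longrightarrow> mu r = 0" "\<And>r. q < r \<Longrightarrow> r \<le> p \<Longrightarrow> mu r = a" "max a b \<le> mu q"
  shows "mu \<in> P"
  using assms by (auto simp: P0_def conj_row_def Suc_diff_le)

lemma P_modify:
  assumes mu: "mu \<in> P" and i: "i \<in> {1..q}"
    and nu: "is_partition nu" "nu i + nu (conj_row i) = a + b" "max a b \<le> nu q"
    and rest: "\<And>r. r \<noteq> i \<Longrightarrow> r \<noteq> conj_row i \<Longrightarrow> nu r = mu r"
  shows "nu \<in> P"
proof (rule P_I[OF nu(1) _ _ _ nu(3)])
  have j: "p < conj_row i" "conj_row i \<le> p + q" "i \<le> q"
    using conj_row_range[OF i] i by auto
  show "nu i' + nu (conj_row i') = a + b" if "i' \<in> {1..q}" for i'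
  proof (cases "i' = i")
    case False
    then have "conj_row i' \<noteq> i" "i' \<noteq> conj_row i" "conj_row i' \<noteq> conj_row i"
      using that i q_le_p by (auto simp: conj_row_def)
    then show ?thesis
      using P_D(6)[OF mu that] rest False by simp
  qed (use nu(2) in simp)
  show "nu r = 0" if "r > p + q" for r
    using that j P_D(2)[OF mu that] rest[of r] by simp
  show "nu r = a" if "q < r" "r \<le> p" for r
    using that j P_D(3)[OF mu that] rest[of r] by simp
qed

lemma conj_row_q: "conj_row q = p + 1"
  by (simp add: conj_row_def)

lemma P_ext:
  assumes "mu \<in> P" "nu \<in> P" "\<And>i. i \<in> {1..q} \<Longrightarrow> mu i = nu i"
  shows "mu = nu"
proof
  fix r
  consider "r = 0" | "r \<in> {1..q}" | "q < r" "r \<le> p" | "p < r" "r \<le> p + q" | "p + q < r"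
    using q_le_p by force
  then show "mu r = nu r"
  proof cases
    case 1
    then show ?thesis
      using assms by (auto dest!: P_D(1) partition_zero)
  next
    case 4
    define i where "i = p + q + 1 - r"
    have i: "i \<in> {1..q}" "conj_row i = r"
      using 4 by (auto simp: i_def conj_row_def)
    show ?thesis
      using P_D(6)[OF assms(1) i(1)] P_D(6)[OF assms(2) i(1)] assms(3)[OF i(1)] i(2) by simp
  next
    case 3
    then show ?thesis
      using P_D(3)[OF assms(1)] P_D(3)[OF assms(2)] by simp
  next
    case 5
    then show ?thesis
      using P_D(2)[OF assms(1)] P_D(2)[OF assms(2)] by simp
  qed (use assms in auto)
qed

text \<open>These are the pairs exchanged by s_0: one box moves between a row and its rotated row,
  and the union of the two partitions is the common T^(1).\<close>

definition paired :: "partition \<Rightarrow> partition \<Rightarrow> nat \<Rightarrow> bool" where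
  "paired mu nu i \<longleftrightarrow> mu \<in> P \<and> nu \<in> P \<and> i \<in> {1..q} \<and> nu i = Suc (mu i) \<and> mu (conj_row i) = Suc (nu (conj_row i)) \<and>
     (\<forall>r. r \<noteq> i \<longrightarrow> r \<noteq> conj_row i \<longrightarrow> nu r = mu r)"

lemma paired_up:
  assumes "mu \<in> P" "i \<in> {1..q}" "mu i < a + b" "i = 1 \<or> mu i < mu (i - 1)"
  shows "paired mu (mu(i := Suc (mu i), conj_row i := mu (conj_row i) - 1)) i"
proof -
  let ?j = "conj_row i" and ?nu = "mu(i := Suc (mu i), conj_row i := mu (conj_row i) - 1)"
  note D = P_D[OF assms(1)]
  have j: "p < ?j" "?j \<le> p + q" "i < ?j"
    using conj_row_range[OF assms(2)] assms(2) q_le_p by auto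
  have sum: "mu i + mu ?j = a + b"
    using D(6)[OF assms(2)] .
  \<comment> \<open>The complementary rows i - 1 and \<open>Suc ?j\<close> carry the strict descent
    above row i over to one below row \<open>?j\<close>.\<close>
  have below: "mu (Suc ?j) \<le> mu ?j - 1"
  proof (cases "i = 1")
    case True
    then show ?thesis
      using D(2)[of "Suc ?j"] by (simp add: conj_row_def)
  next
    case False
    then have i: "i - 1 \<in> {1..q}" "conj_row (i - 1) = Suc ?j"
      using assms(2) by (auto simp: conj_row_def)
    show ?thesis
      using D(6)[OF i(1)] i(2) sum assms(4) False by simp
  qed
  have "is_partition ?nu"
  proof (rule is_partitionI[OF D(1)])
    show "?nu 0 = 0"
      using assms(2) j D(1) partition_zero by auto
    have "{r. ?nu r \<noteq> mu r} \<subseteq> {i, ?j}"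
      by auto
    then show "finite {r. ?nu r \<noteq> mu r}"
      by (rule finite_subset) simp
    fix r :: nat assume r: "1 \<le> r"
    have mono: "mu (Suc r) \<le> mu r"
      using D(1) r by (simp add: is_partition_def)
    show "?nu (Suc r) \<le> ?nu r"
    proof (cases "Suc r = i")
      case True
      then have "mu i < mu r"
        using assms(4) r by auto
      then show ?thesis
        using True j by auto
    next
      case False
      show ?thesis
      proof (cases "Suc r = ?j")
        case True
        then have "r \<noteq> ?j" "mu ?j \<le> mu r"
          using mono by auto
        then show ?thesis
          using True by auto
      next
        case nj: False
        show ?thesis
          using mono below False nj j by (cases "r = ?j") auto
      qed
    qed
  qed
  moreover have "?nu i + ?nu ?j = a + b" "max a b \<le> ?nu q"
    using sum assms(2,3) D(4,5) j q_le_p by auto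
  ultimately have "?nu \<in> P"
    by (intro P_modify[OF assms(1,2)]) auto
  then show ?thesis
    using assms j sum by (auto simp: paired_def)
qed

lemma paired_down:
  assumes "mu \<in> P" "i \<in> {1..q}" "adds mu (conj_row i) ka" "i = q \<longrightarrow> max a b < mu q"
  shows "paired (mu(i := mu i - 1, conj_row i := Suc (mu (conj_row i)))) mu i"
proof -
  let ?j = "conj_row i" and ?nu = "mu(i := mu i - 1, conj_row i := Suc (mu (conj_row i)))"
  note D = P_D[OF assms(1)]
  have j: "p < ?j" "?j \<le> p + q" "i < ?j"
    using conj_row_range[OF assms(2)] assms(2) q_le_p by auto
  have sum: "mu i + mu ?j = a + b"
    using D(6)[OF assms(2)] .
  have mui: "0 < mu i"
    using P_top(1)[OF assms(1,2)] a_pos by simp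
  have prev: "mu ?j < mu (?j - 1)"
    using adds_prev[OF assms(3)] j p_pos by simp
  \<comment> \<open>The same transfer in the other direction. For i = q the bound max a b < mu q
    takes its place: the next row has length a or, if p = q, is row \<open>?j\<close>
    itself.\<close>
  have after: "?nu (Suc i) \<le> mu i - 1"
  proof (cases "i = q")
    case False
    then have i: "i + 1 \<in> {1..q}" "conj_row (i + 1) = ?j - 1"
      using assms(2) by (auto simp: conj_row_def)
    have "Suc i \<noteq> ?j"
      using False assms(2) j q_le_p by auto
    then show ?thesis
      using D(6)[OF i(1)] i(2) sum prev by auto
  next
    case True
    show ?thesis
    proof (cases "q < p")
      case True
      then have "Suc i \<noteq> ?j" "mu (Suc i) = a"
        using \<open>i = q\<close> j D(3)[of "Suc q"] by auto
      then show ?thesis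
        using assms(4) \<open>i = q\<close> by auto
    next
      case False
      then have "Suc i = ?j"
        using \<open>i = q\<close> q_le_p conj_row_q by simp
      then show ?thesis
        using assms(4) \<open>i = q\<close> sum by auto
    qed
  qed
  have "is_partition ?nu"
  proof (rule is_partitionI[OF D(1)])
    show "?nu 0 = 0"
      using assms(2) j D(1) partition_zero by auto
    have "{r. ?nu r \<noteq> mu r} \<subseteq> {i, ?j}"
      by auto
    then show "finite {r. ?nu r \<noteq> mu r}"
      by (rule finite_subset) simp
    fix r :: nat assume r: "1 \<le> r"
    have mono: "mu (Suc r) \<le> mu r"
      using D(1) r by (simp add: is_partition_def)
    show "?nu (Suc r) \<le> ?nu r"
    proof (cases "r = i")
      case True
      then show ?thesis
        using after j by auto
    next
      case False
      have "mu ?j < mu r" if "Suc r = ?j"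
        using prev that by (metis diff_Suc_1)
      then show ?thesis
        using False mono j by auto
    qed
  qed
  moreover have "?nu i + ?nu ?j = a + b" "max a b \<le> ?nu q"
    using sum mui D(4,5) assms(4) j q_le_p by auto
  ultimately have "?nu \<in> P"
    by (intro P_modify[OF assms(1,2)]) auto
  then show ?thesis
    using assms j mui by (auto simp: paired_def)
qed

definition initial_cont :: "partition \<Rightarrow> real" where
  "initial_cont mu = real a * real b * real q
     - (real (card (low_boxes p mu)) + 1/2) * (real a - real p + real b - real q)
     + 2 * (\<Sum>B\<in>low_boxes p mu. real_of_int (content B))"

definition shifted :: "partition \<Rightarrow> nat \<Rightarrow> real" where
  "shifted mu r = real_of_int (box_content mu r) - h"

lemma finite_boxes: "is_partition mu \<Longrightarrow> finite (boxes mu)"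
proof -
  assume mu: "is_partition mu"
  have "boxes mu \<subseteq> Sigma {r. mu r \<noteq> 0} (\<lambda>r. {..mu r})"
    by (auto simp: boxes_def)
  then show ?thesis
    by (rule finite_subset) (use mu in \<open>auto simp: is_partition_def\<close>)
qed

text \<open>The two boxes in which \<open>mu\<close> and \<open>nu\<close> differ are exchanged by
  the rotation of the rectangle, so their contents add up to a + b - p - q = 2 h; losing the lower
  one changes c_0 by minus twice its shifted content. The bounds come from max a b \<le> mu i < a +
  b and 1 \<le> i \<le> q \<le> p.\<close>

lemma paired_facts:
  assumes "paired mu nu i"
  defines "ka \<equiv> mu(i := Suc (mu i))"
  shows "adds mu i ka" "adds nu (conj_row i) ka" "mu \<noteq> nu"
    "shifted nu (conj_row i) = - shifted mu i" "\<bar>D\<bar> < shifted mu i" "shifted mu i < A"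
    "initial_cont nu = initial_cont mu + 2 * shifted mu i"
proof -
  let ?j = "conj_row i"
  have P: "mu \<in> P" "nu \<in> P" and i: "i \<in> {1..q}" and nui: "nu i = Suc (mu i)"
    and muj: "mu ?j = Suc (nu ?j)" and rest: "\<And>r. r \<noteq> i \<Longrightarrow> r \<noteq> ?j \<Longrightarrow> nu r = mu r"
    using assms(1) by (auto simp: paired_def)
  have j: "p < ?j" "?j \<le> p + q" "i < ?j"
    using conj_row_range[OF i] i q_le_p by auto
  have "i = 1 \<or> mu i < mu (i - 1)"
  proof (cases "i = 1")
    case False
    then have "1 \<le> i - 1"
      using i by auto
    then have "nu i \<le> nu (i - 1)"
      using partition_antimono[OF P_D(1)[OF P(2)], of "i - 1" i] by simp
    then show ?thesis
      using nui rest[of "i - 1"] j i False by auto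
  qed simp
  then have ka: "is_partition ka"
    unfolding ka_def using is_partition_upd[OF P_D(1)[OF P(1)], of i] i by simp
  then show "adds mu i ka"
    using P_D(1)[OF P(1)] i by (simp add: adds_def ka_def)
  have "ka = nu(?j := Suc (nu ?j))"
    using nui muj rest j by (auto simp: ka_def fun_eq_iff)
  then show "adds nu ?j ka"
    using ka P_D(1)[OF P(2)] j by (simp add: adds_def)
  show "mu \<noteq> nu"
    using nui by auto
  have sum: "mu i + mu ?j = a + b"
    using P_D(6)[OF P(1) i] .
  have jr: "real ?j = real p + real q + 1 - real i"
    using i by (simp add: conj_row_def of_nat_diff)
  have sumr: "real (mu i) + real (mu ?j) = real a + real b"
    using sum by (metis of_nat_add)
  show sh: "shifted nu ?j = - shifted mu i"
    using sumr jr muj by (simp add: shifted_def box_content_def half_shift_def field_simps)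
  have top: "a \<le> mu i" "b \<le> mu i" "Suc (mu i) \<le> a + b"
    using P_top[OF P(1) i] P_top(3)[OF P(2) i] nui by auto
  have r: "real a \<le> real (mu i)" "real b \<le> real (mu i)" "real (mu i) + 1 \<le> real a + real b"
    "1 \<le> real i" "real i \<le> real q" "real q \<le> real p"
    using top i q_le_p by (auto simp: of_nat_add[symmetric] simp del: of_nat_add)
  show "\<bar>D\<bar> < shifted mu i" "shifted mu i < A"
    using r by (auto simp: shifted_def box_content_def half_shift_def half_diff_def half_sum_def field_simps abs_if)
  have low: "low_boxes p mu = insert (?j, mu ?j) (low_boxes p nu)" "(?j, mu ?j) \<notin> low_boxes p nu"
  proof -
    have row: "mu r = nu r" if "p < r" "r \<noteq> ?j" for r
      using rest[of r] that i q_le_p by auto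
    show "low_boxes p mu = insert (?j, mu ?j) (low_boxes p nu)"
    proof (rule Set.set_eqI)
      fix B :: "nat \<times> nat"
      obtain r c where B: "B = (r, c)"
        by (cases B)
      consider "r = ?j" | "r \<noteq> ?j" "p < r" | "r \<noteq> ?j" "r \<le> p"
        by linarith
      then show "B \<in> low_boxes p mu \<longleftrightarrow> B \<in> insert (?j, mu ?j) (low_boxes p nu)"
      proof cases
        case 1
        then show ?thesis
          using j by (auto simp: B low_boxes_def boxes_def muj le_Suc_eq)
      next
        case 2
        then show ?thesis
          using row[of r] by (simp add: B low_boxes_def boxes_def)
      next
        case 3
        then show ?thesis
          using j by (simp add: B low_boxes_def boxes_def)
      qed
    qed
    show "(?j, mu ?j) \<notin> low_boxes p nu"
      using muj by (simp add: low_boxes_def boxes_def)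
  qed
  have fin: "finite (low_boxes p nu)"
    using finite_boxes[OF P_D(1)[OF P(2)]] by (simp add: low_boxes_def)
  have "initial_cont mu = initial_cont nu + 2 * shifted nu ?j"
    using low fin muj
    by (simp add: initial_cont_def shifted_def box_content_def content_def half_shift_def field_simps)
  then show "initial_cont nu = initial_cont mu + 2 * shifted mu i"
    using sh by simp
qed

text \<open>\<open>up\<close> and \<open>down\<close> are the boxes that lead to a second element of
  \<open>P\<close> below \<open>ka\<close>. In the other four positions the constraints of
  \<open>P\<close> block the exchange; there the shifted contents are A, D, D or -D, and -A, in this
  order.\<close>

lemma P_box_cases:
  assumes "mu \<in> P" "adds mu r ka"
  obtains (up) nu where "paired mu nu r" "r \<in> {1..q}"
  | (down) i nu where "paired nu mu i" "r = conj_row i" "i \<in> {1..q}"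
  | (first) "r = 1" "mu r = a + b"
  | (middle) "r = q + 1" "q < p" "mu r = a" "a < mu q"
  | (lower) "r = p + 1" "mu q = max a b" "mu r = min a b" "if q < p then b < a else a \<noteq> b"
  | (last) "r = p + q + 1" "mu r = 0" "0 < mu (p + q)"
proof -
  note D = P_D[OF assms(1)]
  note M = addsD[OF assms(2)]
  have prev: "mu r < mu (r - 1)" if "2 \<le> r"
    using adds_prev[OF assms(2) that] .
  consider "r \<in> {1..q}" | "q < r" "r \<le> p" | "p < r" "r \<le> p + q" | "p + q < r"
    using M(3) q_le_p by force
  then show ?thesis
  proof cases
    case 1
    show ?thesis
    proof (cases "mu r < a + b")
      case True
      have "r = 1 \<or> mu r < mu (r - 1)"
        using prev 1 by force
      then show ?thesis
        using up paired_up[OF assms(1) 1 True] 1 by blast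
    next
      case False
      then have top: "mu r = a + b"
        using P_top(3)[OF assms(1) 1] by simp
      have "r = 1"
      proof (rule ccontr)
        assume "r \<noteq> 1"
        then have "r - 1 \<in> {1..q}" "2 \<le> r"
          using 1 by auto
        then show False
          using prev P_top(3)[OF assms(1), of "r - 1"] top by simp
      qed
      then show ?thesis
        using first top by blast
    qed
  next
    case 2
    have r: "r = q + 1"
    proof (rule ccontr)
      assume "r \<noteq> q + 1"
      then have "q < r - 1" "r - 1 \<le> p" "2 \<le> r"
        using 2 by auto
      then show False
        using prev D(3)[of r] D(3)[of "r - 1"] 2 by simp
    qed
    then show ?thesis
      using middle prev D(3)[of r] 2 q_pos by simp
  next
    case 3
    define i where "i = p + q + 1 - r"
    have i: "i \<in> {1..q}" "r = conj_row i"
      using 3 by (auto simp: i_def conj_row_def)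
    show ?thesis
    proof (cases "i = q \<longrightarrow> max a b < mu q")
      case True
      then show ?thesis
        using down paired_down[OF assms(1) i(1), of ka] assms(2) i by blast
    next
      case False
      then have iq: "i = q" and eq: "mu q = max a b"
        using D(4,5) by auto
      have r: "r = p + 1"
        using i iq by (simp add: conj_row_def)
      have low: "mu r = min a b"
        using D(6)[OF i(1)] i(2) iq eq by simp
      have pr: "min a b < mu p"
        using prev[unfolded r] low r p_pos by simp
      \<comment> \<open>The row above has length a if q < p and max a b if p = q, and it must exceed
        min a b.\<close>
      have "if q < p then b < a else a \<noteq> b"
      proof (cases "q < p")
        case True
        then show ?thesis
          using pr D(3)[of p] by auto
      next
        case False
        then have "p = q"
          using q_le_p by simp
        then show ?thesis
          using pr eq by auto
      qed
      then show ?thesis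
        using lower r eq low by blast
    qed
  next
    case 4
    have r: "r = p + q + 1"
    proof (rule ccontr)
      assume "r \<noteq> p + q + 1"
      then have "p + q < r - 1" "2 \<le> r"
        using 4 p_pos by linarith+
      then show False
        using prev D(2)[of "r - 1"] by simp
    qed
    then show ?thesis
      using last prev D(2)[of r] p_pos by simp
  qed
qed

definition special :: "real \<Rightarrow> bool" where
  "special c \<longleftrightarrow> c \<in> {A, - A, D, - D}"

lemma A_pos: "\<bar>D\<bar> < A"
  using a_pos b_pos p_pos q_pos by (auto simp: half_sum_def half_diff_def abs_if field_simps)

lemma special_w: "special c \<Longrightarrow> w c = 0"
  by (auto simp: special_def x_amp_def)

lemma special_admissible: "special c \<Longrightarrow> admissible c"
  using A_pos by (auto simp: special_def admissible_def)

lemma P_box_shifted: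
  assumes "mu \<in> P" "adds mu r ka"
  shows "admissible (shifted mu r)" (is ?A)
    and "\<not> special (shifted mu r) \<Longrightarrow> \<exists>nu s. nu \<in> P \<and> nu \<noteq> mu \<and> adds nu s ka \<and> shifted nu s = - shifted mu r \<and>
      initial_cont nu = initial_cont mu + 2 * shifted mu r" (is "_ \<Longrightarrow> ?B")
    and "special (shifted mu r) \<or> \<bar>D\<bar> < \<bar>shifted mu r\<bar>" (is ?C)
proof -
  have gen: "admissible c \<and> (\<bar>D\<bar> < \<bar>c\<bar>)" if "\<bar>D\<bar> < \<bar>c\<bar>" "\<bar>c\<bar> < A" for c
    using that by (auto simp: admissible_def)
  have "?A \<and> ?C \<and> (\<not> special (shifted mu r) \<longrightarrow> ?B)"
    using assms
  proof (cases rule: P_box_cases)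
    case (up nu)
    note F = paired_facts[OF up(1)]
    have "ka = mu(r := Suc (mu r))"
      using addsD(6)[OF assms(2)] .
    moreover have "\<bar>D\<bar> < \<bar>shifted mu r\<bar>" "\<bar>shifted mu r\<bar> < A"
      using F(5,6) by linarith+
    moreover have "nu \<in> P" "nu \<noteq> mu"
      using up(1) F(3) by (auto simp: paired_def)
    ultimately show ?thesis
      using gen F(2,4,7) by metis
  next
    case (down i nu)
    note F = paired_facts[OF down(1)]
    have ka: "ka = nu(i := Suc (nu i))"
      using addsD(6)[OF assms(2)] addsD(6)[OF F(2)] down(2) by simp
    have sh: "shifted nu i = - shifted mu r"
      using F(4) down(2) by simp
    have "\<bar>D\<bar> < \<bar>shifted mu r\<bar>" "\<bar>shifted mu r\<bar> < A"
      using F(5,6) sh by linarith+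
    moreover have "nu \<in> P"
      using down(1) by (simp add: paired_def)
    moreover have "nu \<noteq> mu" "adds nu i ka" "initial_cont nu = initial_cont mu + 2 * shifted mu r"
      using F(1,3,7) sh unfolding ka by auto
    ultimately show ?thesis
      using gen sh by blast
  next
    case first
    then have "shifted mu r = A"
      by (simp add: shifted_def box_content_def half_shift_def half_sum_def field_simps)
    then show ?thesis
      using special_admissible by (simp add: special_def)
  next
    case middle
    then have "shifted mu r = D"
      by (simp add: shifted_def box_content_def half_shift_def half_diff_def field_simps)
    then show ?thesis
      using special_admissible by (simp add: special_def)
  next
    case lower
    have "shifted mu r = D \<or> shifted mu r = - D"
    proof -
      have sh: "shifted mu r = real (min a b) - real p - h"
        using lower by (simp add: shifted_def box_content_def)
      show ?thesis
      proof (cases "q < p")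
        case True
        then have "min a b = b"
          using lower(4) by simp
        then show ?thesis
          unfolding sh by (simp add: half_shift_def half_diff_def field_simps)
      next
        case False
        then have "real p = real q"
          using q_le_p by simp
        then show ?thesis
          unfolding sh half_shift_def half_diff_def by (cases "a \<le> b") (auto simp: min_def field_simps)
      qed
    qed
    then show ?thesis
      using special_admissible by (auto simp: special_def)
  next
    case last
    then have "shifted mu r = - A"
      by (simp add: shifted_def box_content_def half_shift_def half_sum_def field_simps)
    then show ?thesis
      using special_admissible by (simp add: special_def)
  qed
  then show ?A and ?C and "\<not> special (shifted mu r) \<Longrightarrow> ?B"
    by blast+
qed

text \<open>Complementary rows have a constant sum, so one shrinks only if the other grows. Hence
  \<open>nu\<close> must contain the new box, and in the top q rows it can differ from
  \<open>mu\<close> only in row r or in the row complementary to r.\<close>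

lemma P_other_unique:
  assumes "mu \<in> P" "adds mu r ka"
    and nu: "nu \<in> P" "nu \<noteq> mu" "boxes nu \<subseteq> boxes ka"
    and nu': "nu' \<in> P" "nu' \<noteq> mu" "boxes nu' \<subseteq> boxes ka"
  shows "nu = nu'"
proof -
  have key: "nu r = Suc (mu r)" "\<And>i. i \<in> {1..q} \<Longrightarrow> i \<noteq> r \<Longrightarrow> conj_row i \<noteq> r \<Longrightarrow> nu i = mu i"
    if nu: "nu \<in> P" "nu \<noteq> mu" "boxes nu \<subseteq> boxes ka" for nu
  proof -
    have le: "nu s \<le> ka s" for s
      using boxes_subset_iff[OF P_D(1)[OF nu(1)], of ka] nu(3) by blast
    then have le': "nu s \<le> mu s" if "s \<noteq> r" for s
      using addsD(5)[OF assms(2) that] by metis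
    have eq: "nu i = mu i" if "i \<in> {1..q}" "nu i \<le> mu i" "nu (conj_row i) \<le> mu (conj_row i)" for i
      using P_D(6)[OF assms(1) that(1)] P_D(6)[OF nu(1) that(1)] that by simp
    show "nu r = Suc (mu r)"
    proof (rule ccontr)
      assume "nu r \<noteq> Suc (mu r)"
      then have "nu s \<le> mu s" for s
        using le[of r] le'[of s] addsD(4)[OF assms(2)] by (cases "s = r") auto
      then have "nu = mu"
        using P_ext[OF nu(1) assms(1)] eq by blast
      then show False
        using nu(2) by simp
    qed
    show "nu i = mu i" if "i \<in> {1..q}" "i \<noteq> r" "conj_row i \<noteq> r" for i
      using eq[OF that(1)] le' that by blast
  qed
  show ?thesis
  proof (rule P_ext[OF nu(1) nu'(1)])
    fix i assume i: "i \<in> {1..q}"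
    show "nu i = nu' i"
    proof (cases "conj_row i = r")
      case True
      then show ?thesis
        using P_D(6)[OF nu(1) i] P_D(6)[OF nu'(1) i] key(1)[OF nu] key(1)[OF nu'] by simp
    next
      case False
      then show ?thesis
        using key[OF nu] key[OF nu'] i by (cases "i = r") auto
    qed
  qed
qed

end

section \<open>Weights of tableaux\<close>

context seminormal_parameters
begin

abbreviation "Tab \<equiv> tableaux a b p q"

text \<open>Beyond \<open>k\<close> the list index is out of range; the value 0 there makes equality
  of functions mean equality of the k + 1 contents.\<close>

definition weight :: "nat \<Rightarrow> tableau \<Rightarrow> nat \<Rightarrow> real" where
  "weight k T = (\<lambda>i. if i \<le> k then cont a b p q T i else 0)"

lemma cont_0: "cont a b p q T 0 = initial_cont (T ! 0)"
  by (simp add: cont_def initial_cont_def)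

lemma cont_Suc: "adds (T ! i) r (T ! Suc i) \<Longrightarrow> cont a b p q T (Suc i) = shifted (T ! i) r"
  by (simp add: cont_def shifted_def the_elem_adds content_def box_content_def)

lemma cont_cong:
  assumes "T ! i = S ! i" "i \<noteq> 0 \<Longrightarrow> T ! (i - 1) = S ! (i - 1)"
  shows "cont a b p q T i = cont a b p q S i"
  using assms by (auto simp: cont_def)

lemma tab_adds: "T \<in> Tab k lam \<Longrightarrow> i < k \<Longrightarrow> \<exists>r. adds (T ! i) r (T ! Suc i)"
  by (auto simp: tableaux_iff adds_box_iff)

lemma weight_inj:
  assumes T: "T \<in> Tab k lam" and S: "S \<in> Tab k lam" and eq: "weight k T = weight k S"
  shows "T = S"
proof -
  have down: "T ! (k - j) = S ! (k - j)" if "j \<le> k" for j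
    using that
  proof (induction j)
    case 0
    then show ?case
      using T S by (simp add: tableaux_iff)
  next
    case (Suc j)
    let ?i = "k - Suc j"
    have i: "Suc ?i = k - j" "?i < k"
      using Suc.prems by auto
    obtain r s where r: "adds (T ! ?i) r (T ! Suc ?i)" and s: "adds (S ! ?i) s (S ! Suc ?i)"
      using tab_adds[OF T i(2)] tab_adds[OF S i(2)] by blast
    have IH: "S ! Suc ?i = T ! Suc ?i"
      using Suc i by simp
    have "weight k T (Suc ?i) = weight k S (Suc ?i)"
      using eq by simp
    then have "shifted (T ! ?i) r = shifted (S ! ?i) s"
      using cont_Suc[OF r] cont_Suc[OF s] i by (simp add: weight_def)
    then have "int ((T ! Suc ?i) r) - int r = int ((T ! Suc ?i) s) - int s"
      using addsD(4)[OF r] addsD(4)[OF s] IH by (simp add: shifted_def box_content_def)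
    from adds_row_unique(2)[OF r s[unfolded IH] this] show ?case .
  qed
  show ?thesis
  proof (rule nth_equalityI)
    show "length T = length S"
      using T S by (simp add: tableaux_iff)
    fix i assume "i < length T"
    then have "i \<le> k"
      using T by (simp add: tableaux_iff)
    then show "T ! i = S ! i"
      using down[of "k - i"] by simp
  qed
qed

lemma shifted_gap:
  assumes "box_content mu r \<noteq> box_content nu s"
  shows "1 \<le> \<bar>shifted nu s - shifted mu r\<bar>"
proof -
  have "1 \<le> \<bar>box_content nu s - box_content mu r\<bar>"
    using assms by linarith
  then have "1 \<le> real_of_int \<bar>box_content nu s - box_content mu r\<bar>"
    by linarith
  then show ?thesis
    by (simp add: shifted_def)
qed

lemma tab_gap1:
  assumes "T \<in> Tab k lam" "i \<in> {1..k-1}"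
  shows "gap i (Suc i) (weight k T)"
proof -
  obtain j where i: "i = Suc j" "Suc j < k"
    using assms(2) by (cases i) auto
  obtain r s where "adds (T ! j) r (T ! Suc j)" "adds (T ! Suc j) s (T ! Suc (Suc j))"
    using tab_adds[OF assms(1), of j] tab_adds[OF assms(1), of "Suc j"] i by auto
  then show ?thesis
    using shifted_gap[OF consecutive_contents[symmetric]] i by (simp add: gap_def weight_def cont_Suc)
qed

lemma tab_gap2:
  assumes "T \<in> Tab k lam" "1 \<le> i" "Suc i \<le> k - 1"
  shows "gap i (Suc (Suc i)) (weight k T)"
proof -
  obtain j where i: "i = Suc j" "Suc (Suc j) < k"
    using assms(2,3) by (cases i) auto
  obtain r s t where "adds (T ! j) r (T ! Suc j)" "adds (T ! Suc j) s (T ! Suc (Suc j))"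
    "adds (T ! Suc (Suc j)) t (T ! Suc (Suc (Suc j)))"
    using tab_adds[OF assms(1), of j] tab_adds[OF assms(1), of "Suc j"] tab_adds[OF assms(1), of "Suc (Suc j)"] i
    by auto
  then show ?thesis
    using shifted_gap[OF alternate_contents[symmetric]] i by (simp add: gap_def weight_def cont_Suc)
qed

lemma swap_tableau:
  assumes T: "T \<in> Tab k lam" and i: "i \<in> {1..k-1}"
    and far: "\<bar>weight k T (Suc i) - weight k T i\<bar> \<noteq> 1"
  obtains S where "s_tab a b p q i T = Some S" "S \<in> Tab k lam" "weight k S = weight k T \<circ> adj i"
proof -
  obtain j where j: "i = Suc j" "Suc j < k"
    using i by (cases i) auto
  obtain r s where r: "adds (T ! j) r (T ! Suc j)" and s: "adds (T ! Suc j) s (T ! Suc (Suc j))"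
    using tab_adds[OF T, of j] tab_adds[OF T, of "Suc j"] j by auto
  have ci: "cont a b p q T i = shifted (T ! j) r" "cont a b p q T (Suc i) = shifted (T ! Suc j) s"
    using cont_Suc[OF r] cont_Suc[OF s] j by simp_all
  have ne: "\<bar>shifted (T ! Suc j) s - shifted (T ! j) r\<bar> \<noteq> 1"
    using far ci j by (simp add: weight_def)
  have "\<bar>box_content (T ! Suc j) s - box_content (T ! j) r\<bar> \<noteq> 1"
  proof
    assume "\<bar>box_content (T ! Suc j) s - box_content (T ! j) r\<bar> = 1"
    then have "real_of_int \<bar>box_content (T ! Suc j) s - box_content (T ! j) r\<bar> = 1"
      by simp
    then show False
      using ne by (simp add: shifted_def)
  qed
  note sw = swap_boxes[OF r s this]
  define mu' where "mu' = (T ! j)(s := Suc ((T ! j) s))"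
  define S where "S = T[i := mu']"
  have len: "length T = k + 1"
    using T by (simp add: tableaux_iff)
  have nth: "S ! i = mu'" "\<And>l. l \<noteq> i \<Longrightarrow> S ! l = T ! l"
    using len i by (auto simp: S_def)
  have mu': "mu' = (\<lambda>r. (T ! (i - 1)) r + ((T ! (i + 1)) r - (T ! i) r))"
    using sw(6) j by (simp add: mu'_def)
  have "s_tab a b p q i T = Some S"
    using ne ci unfolding s_tab_def S_def mu' by (auto simp: abs_if split: if_splits)
  moreover have a1: "adds (S ! j) s (S ! Suc j)" "adds (S ! Suc j) r (S ! Suc (Suc j))"
    using sw(2,3) nth j by (simp_all add: mu'_def)
  have "S \<in> Tab k lam"
    unfolding tableaux_iff
  proof (intro conjI allI impI)
    show "length S = k + 1"
      using len by (simp add: S_def)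
    show "S ! k = lam" "S ! 0 \<in> P0 a b p q"
      using T j nth by (auto simp: tableaux_iff)
    fix l assume l: "l < k"
    show "adds_box (S ! l) (S ! (l + 1))"
    proof (cases "l = j \<or> l = Suc j")
      case True
      then show ?thesis
        using a1 by (auto simp: adds_box_iff)
    next
      case False
      then show ?thesis
        using T l j nth by (auto simp: tableaux_iff)
    qed
  qed
  moreover have "weight k S = weight k T \<circ> adj i"
  proof
    fix l
    consider "l = i" | "l = Suc i" | "l \<noteq> i" "l \<noteq> Suc i"
      by blast
    then show "weight k S l = (weight k T \<circ> adj i) l"
    proof cases
      case 1
      then show ?thesis
        using cont_Suc[OF a1(1)] ci j nth sw(4) by (simp add: weight_def adj_apply shifted_def)
    next
      case 2
      then show ?thesis
        using cont_Suc[OF a1(2)] ci j nth sw(5) by (simp add: weight_def adj_apply shifted_def mu'_def)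
    next
      case 3
      have "cont a b p q S l = cont a b p q T l"
        by (rule cont_cong) (use 3 nth in auto)
      then show ?thesis
        using 3 by (simp add: weight_def adj_apply)
    qed
  qed
  ultimately show ?thesis
    using that by blast
qed

lemma first_box:
  assumes "T \<in> Tab k lam" "1 \<le> k"
  obtains r where "T ! 0 \<in> P" "adds (T ! 0) r (T ! 1)" "weight k T 1 = shifted (T ! 0) r"
  using tab_adds[OF assms(1), of 0] assms cont_Suc[of T 0] by (auto simp: tableaux_iff weight_def)

lemma negate_tableau:
  assumes T: "T \<in> Tab k lam" and k: "1 \<le> k" and ns: "\<not> special (weight k T 1)"
  obtains S where "s0_tab a b p q T = Some S" "S \<in> Tab k lam" "weight k S = negate (weight k T)"
    "S ! 0 \<noteq> T ! 0" "S ! 1 = T ! 1"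
proof -
  obtain r where P0: "T ! 0 \<in> P" and r: "adds (T ! 0) r (T ! 1)" and c: "weight k T 1 = shifted (T ! 0) r"
    using first_box[OF T k] .
  obtain nu s where nu: "nu \<in> P" "nu \<noteq> T ! 0" "adds nu s (T ! 1)" "shifted nu s = - shifted (T ! 0) r"
    "initial_cont nu = initial_cont (T ! 0) + 2 * shifted (T ! 0) r"
    using P_box_shifted(2)[OF P0 r] ns c by auto
  define S where "S = T[0 := nu]"
  have len: "length T = k + 1"
    using T by (simp add: tableaux_iff)
  have nth: "S ! 0 = nu" "\<And>l. l \<noteq> 0 \<Longrightarrow> S ! l = T ! l"
    using len by (auto simp: S_def)
  have sub: "boxes nu \<subseteq> boxes (T ! 1)"
    using adds_boxes(1)[OF nu(3)] by auto
  have "(THE nu. nu \<in> P0 a b p q \<and> nu \<noteq> T ! 0 \<and> boxes nu \<subseteq> boxes (T ! 1)) = nu"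
  proof (rule the_equality)
    show "nu \<in> P0 a b p q \<and> nu \<noteq> T ! 0 \<and> boxes nu \<subseteq> boxes (T ! 1)"
      using nu sub by blast
    show "nu' = nu" if "nu' \<in> P0 a b p q \<and> nu' \<noteq> T ! 0 \<and> boxes nu' \<subseteq> boxes (T ! 1)" for nu'
      using P_other_unique[OF P0 r _ _ _ nu(1,2) sub, of nu'] that by blast
  qed
  then have "s0_tab a b p q T = Some S"
    using ns k by (simp add: s0_tab_def S_def special_def weight_def)
  moreover have "S \<in> Tab k lam"
    unfolding tableaux_iff
  proof (intro conjI allI impI)
    show "length S = k + 1"
      using len by (simp add: S_def)
    show "S ! k = lam" "S ! 0 \<in> P0 a b p q"
      using T k nth nu by (auto simp: tableaux_iff)
    fix l assume l: "l < k"
    show "adds_box (S ! l) (S ! (l + 1))"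
    proof (cases "l = 0")
      case True
      then show ?thesis
        using nu nth by (auto simp: adds_box_iff)
    next
      case False
      then show ?thesis
        using T l nth by (auto simp: tableaux_iff)
    qed
  qed
  moreover have "weight k S = negate (weight k T)"
  proof
    fix l :: nat
    consider "l = 0" | "l = 1" | "2 \<le> l"
      by linarith
    then show "weight k S l = negate (weight k T) l"
    proof cases
      case 1
      then show ?thesis
        using c nu(5) nth k by (simp add: weight_def cont_0)
    next
      case 2
      have "adds (S ! 0) s (S ! Suc 0)"
        using nu nth by simp
      then show ?thesis
        using 2 c nu(4) nth k cont_Suc[of S 0 s] by (simp add: weight_def)
    next
      case 3
      have "cont a b p q S l = cont a b p q T l"
        by (rule cont_cong) (use 3 nth in auto)
      then show ?thesis
        using 3 by (simp add: weight_def)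
    qed
  qed
  moreover have "S ! 0 \<noteq> T ! 0" "S ! 1 = T ! 1"
    using nth nu(2) by simp_all
  ultimately show ?thesis
    using that by blast
qed

text \<open>When \<open>c\<^sub>1 + c\<^sub>2 = 0\<close> the coefficient \<open>1 / (c\<^sub>1 + c\<^sub>2)\<close> of the boundary braid relation is
  singular.  This does happen, but only when both off-diagonal amplitudes vanish.\<close>

lemma special_opposite:
  assumes "mu \<in> P" "adds mu r ka" "adds ka s la" "special (shifted mu r)" "shifted ka s = - shifted mu r"
  shows "\<bar>shifted ka s - shifted mu r\<bar> = 1"
proof -
  note D = P_D[OF assms(1)] and M = addsD[OF assms(2)] and K = addsD[OF assms(3)]
  have prev: "ka s < ka (s - 1)" if "2 \<le> s"
    using adds_prev[OF assms(3) that] .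
  have "real_of_int (box_content ka s + box_content mu r) = 2 * h"
    using assms(5) by (simp add: shifted_def)
  then have "real_of_int (box_content ka s + box_content mu r) = real_of_int (int a - int p + int b - int q)"
    by (simp add: half_shift_def)
  \<comment> \<open>This fixes the diagonal of the second box. After three of the four exceptional
    first boxes no box can be added on it; after \<open>middle\<close> only a box adjacent to the
    first remains.\<close>
  then have op: "box_content ka s + box_content mu r = int a - int p + int b - int q"
    by linarith
  have bc: "box_content ka s = int (ka s) + 1 - int s"
    by (simp add: box_content_def)
  have goal: ?thesis if "\<bar>box_content ka s - box_content mu r\<bar> = 1"
  proof -
    have "real_of_int \<bar>box_content ka s - box_content mu r\<bar> = 1"
      using that by simp
    then show ?thesis
      by (simp add: shifted_def)
  qed
  have one: "1 \<in> {1..q}" "conj_row 1 = p + q"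
    using q_pos by (auto simp: conj_row_def)
  from assms(1,2) show ?thesis
  proof (cases rule: P_box_cases)
    case (up nu)
    then show ?thesis
      using paired_facts(5,6)[OF up(1)] assms(4) A_pos by (auto simp: special_def)
  next
    case (down i nu)
    then have "shifted mu r = - shifted nu i"
      using paired_facts(4)[OF down(1)] by simp
    then show ?thesis
      using paired_facts(5,6)[OF down(1)] assms(4) A_pos by (auto simp: special_def)
  next
    case first
    then have "int s = int (ka s) + 1 + int p + int q"
      using op bc by (simp add: box_content_def)
    then have s: "p + q < s"
      by linarith
    then have "ka s = 0"
      using D(2)[of s] M(5)[of s] first q_pos p_pos by simp
    then have s: "s = p + q + 1"
      using \<open>int s = int (ka s) + 1 + int p + int q\<close> by linarith
    have "ka (p + q) = mu (p + q)"
      using M(5)[of "p + q"] first p_pos q_pos by simp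
    also have "\<dots> = 0"
      using D(6)[OF one(1)] one(2) first by simp
    finally show ?thesis
      using prev s p_pos by simp
  next
    case last
    then have "int (ka s) = int a + int b + int s - 1"
      using op bc by (simp add: box_content_def)
    moreover have "ka s \<le> ka 1"
      using partition_antimono[OF M(2), of 1 s] K(3) by simp
    moreover have "ka 1 = mu 1"
      using M(5)[of 1] last p_pos by simp
    moreover have "mu 1 + mu (p + q) = a + b"
      using D(6)[OF one(1)] one(2) by simp
    ultimately show ?thesis
      using last K(3) by linarith
  next
    case middle
    then have bm: "box_content mu r = int a - int q"
      by (simp add: box_content_def)
    then have e: "int (ka s) = int b + int s - int p - 1"
      using op bc by simp
    have kaeq: "ka x = mu x" if "x \<noteq> q + 1" for x
      using M(5)[of x] that middle by simp
    \<comment> \<open>Rows q + 1 and q + 2 hold the boxes to the right of and below the first one.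
      In the other rows the length demanded by \<open>e\<close>, or the shape of \<open>ka\<close>,
      gives a contradiction.\<close>
    consider "s \<in> {1..q}" | "s = q + 1" | "s = q + 2" "s \<le> p" | "q + 2 < s" "s \<le> p" | "p < s" "s \<le> p + q" | "p + q < s"
      using K(3) middle by force
    then show ?thesis
    proof cases
      case 1
      then show ?thesis
        using e kaeq[of s] P_top(2)[OF assms(1) 1] q_le_p by auto
    next
      case 2
      then have "ka s = a + 1"
        using M(4) middle by simp
      then show ?thesis
        using goal bm bc 2 by simp
    next
      case 3
      then have "ka s = a"
        using kaeq[of s] D(3)[of s] by simp
      then show ?thesis
        using goal bm bc 3 by simp
    next
      case 4
      then have "ka s = a" "ka (s - 1) = a"
        using kaeq[of s] kaeq[of "s - 1"] D(3)[of s] D(3)[of "s - 1"] by simp_all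
      then show ?thesis
        using prev 4 by simp
    next
      case 5
      define i where "i = p + q + 1 - s"
      have i: "i \<in> {1..q}" "conj_row i = s"
        using 5 by (auto simp: i_def conj_row_def)
      have "mu q \<le> mu i"
        using partition_antimono[OF D(1), of i q] i by simp
      then have "mu s < b"
        using D(6)[OF i(1)] i(2) middle by simp
      then show ?thesis
        using e kaeq[of s] 5 middle by linarith
    next
      case 6
      then show ?thesis
        using e kaeq[of s] D(2)[of s] middle b_pos by simp
    qed
  next
    case lower
    have qs: "ka q = mu q"
      using M(5)[of q] lower q_le_p by simp
    \<comment> \<open>This length is too small for a row s \<le> q, equals that of row q for s = q +
      1, and is too large further down; none of these rows admits the box.\<close>
    have "int (ka s) = int (mu q) + int s - 1 - int q"
    proof (cases "q < p")
      case True
      then show ?thesis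
        using op bc lower by (simp add: box_content_def)
    next
      case False
      have "int (max a b) + int (min a b) = int a + int b"
        by (simp add: max_def min_def)
      then show ?thesis
        using False q_le_p op bc lower by (simp add: box_content_def)
    qed
    moreover have "mu q \<le> ka s" if "s \<le> q"
      using partition_antimono[OF D(1) K(3) that] M(5)[of s] lower q_le_p that by simp
    moreover have "ka s < mu q" if "s = q + 1"
      using prev qs q_pos that by simp
    moreover have "ka s \<le> mu q" if "q + 1 < s"
      using partition_antimono[OF M(2), of q s] qs q_pos that by simp
    ultimately show ?thesis
      by (cases s "q + 1" rule: linorder_cases) linarith+
  qed
qed

lemma tab_regular:
  assumes T: "T \<in> Tab k lam" and k: "2 \<le> k"
  defines "c \<equiv> weight k T"
  shows "w (c 1) = 0 \<and> t_amp (c 1) (c 2) = 0 \<or> c 1 + c 2 \<noteq> 0 \<and> (c 2 = 0 \<longrightarrow> D = 0)"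
proof -
  have k1: "1 \<le> k" "1 \<in> {1..k-1}"
    using k by auto
  obtain r where P0: "T ! 0 \<in> P" and r: "adds (T ! 0) r (T ! 1)" and c1: "c 1 = shifted (T ! 0) r"
    using first_box[OF T k1(1)] unfolding c_def .
  obtain s where s: "adds (T ! 1) s (T ! 2)"
    using tab_adds[OF T, of 1] k by (auto simp: numeral_2_eq_2)
  have c2: "c 2 = shifted (T ! 1) s"
    using cont_Suc[of T 1 s] s k by (simp add: c_def weight_def numeral_2_eq_2)
  have adjacent: "t_amp (c 1) (c 2) = 0" if "\<bar>c 2 - c 1\<bar> = 1"
    using that by (rule t_amp_zero)
  show ?thesis
  proof (cases "c 1 + c 2 = 0")
    case True
    have sp: "special (c 1)"
    proof (rule ccontr)
      assume "\<not> special (c 1)"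
      then obtain S where S: "S \<in> Tab k lam" "weight k S = negate c"
        using negate_tableau[OF T k1(1)] unfolding c_def by metis
      \<comment> \<open>In the negated weight the first two entries would coincide.\<close>
      have "gap 1 (Suc 1) (negate c)"
        using tab_gap1[OF S(1) k1(2)] S(2) by simp
      then show False
        using True by (simp add: gap_def numeral_2_eq_2)
    qed
    then have "\<bar>c 2 - c 1\<bar> = 1"
      using special_opposite[OF P0 r s] True c1 c2 by simp
    then show ?thesis
      using adjacent special_w[OF sp] by blast
  next
    case ne: False
    show ?thesis
    proof (cases "c 2 = 0 \<and> D \<noteq> 0")
      case True
      \<comment> \<open>Otherwise s_1 would make 0 the first content of a tableau, but a first
        content has absolute value at least |D|, and D is nonzero here.\<close>
      have one: "\<bar>c 2 - c 1\<bar> = 1"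
      proof (rule ccontr)
        assume "\<bar>c 2 - c 1\<bar> \<noteq> 1"
        then obtain S where S: "S \<in> Tab k lam" "weight k S = c \<circ> adj 1"
          using swap_tableau[OF T k1(2)] unfolding c_def by (metis Suc_1)
        obtain r' where r': "S ! 0 \<in> P" "adds (S ! 0) r' (S ! 1)" "weight k S 1 = shifted (S ! 0) r'"
          using first_box[OF S(1) k1(1)] .
        have "weight k S 1 = 0"
          using S(2) True by (simp add: adj_apply numeral_2_eq_2)
        then show False
          using P_box_shifted(3)[OF r'(1,2)] r'(3) True A_pos by (auto simp: special_def)
      qed
      \<comment> \<open>D differs from -c_2 = 0 by an integer, so |D| is at least 1 = |c_1|, and
        this leaves only a special c_1.\<close>
      have "D = real_of_int (int a - int q - box_content (T ! 1) s)"
        using True c2 by (simp add: shifted_def half_diff_def half_shift_def field_simps)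
      moreover have "1 \<le> \<bar>real_of_int z\<bar>" if "real_of_int z \<noteq> 0" for z
      proof -
        have "1 \<le> \<bar>z\<bar>"
          using that by auto
        then show ?thesis
          by linarith
      qed
      ultimately have "1 \<le> \<bar>D\<bar>"
        using True by metis
      then have "special (c 1)"
        using P_box_shifted(3)[OF P0 r] one True c1 by auto
      then show ?thesis
        using adjacent[OF one] special_w by blast
    next
      case False
      then show ?thesis
        using ne by blast
    qed
  qed
qed

lemma weight_set_tableaux:
  assumes k: "1 \<le> k"
  shows "weight_set a b p q k (weight k ` Tab k lam)"
proof
  fix c assume "c \<in> weight k ` Tab k lam"
  then obtain T where T: "T \<in> Tab k lam" and c: "c = weight k T"
    by blast
  show "c \<circ> adj i \<in> weight k ` Tab k lam" if "i \<in> {1..k-1}" "t_amp (c i) (c (Suc i)) \<noteq> 0" for i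
    using swap_tableau[OF T that(1)] that(2) t_amp_zero unfolding c by (metis image_eqI)
  show "gap i (Suc i) c" if "i \<in> {1..k-1}" for i
    using tab_gap1[OF T that] c by simp
  show "gap i (Suc (Suc i)) c" if "1 \<le> i" "Suc i \<le> k - 1" for i
    using tab_gap2[OF T that] c by simp
  show "negate c \<in> weight k ` Tab k lam" if "w (c 1) \<noteq> 0"
    using negate_tableau[OF T k] that special_w unfolding c by (metis image_eqI)
  show "admissible (c 1)"
    using first_box[OF T k] P_box_shifted(1) c by metis
  show "w (c 1) = 0 \<and> t_amp (c 1) (c 2) = 0 \<or> c 1 + c 2 \<noteq> 0 \<and> (c 2 = 0 \<longrightarrow> D = 0)" if "2 \<le> k"
    using tab_regular[OF T that] c by simp
qed (rule k)

end

section \<open>Connectivity of the set of tableaux\<close>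

lemma adds_card:
  assumes "adds mu r nu" "finite (boxes mu)"
  shows "card (boxes nu) = Suc (card (boxes mu))"
  using adds_boxes[OF assms(1)] assms(2) by simp

lemma adds_le: "adds mu r nu \<Longrightarrow> mu x \<le> nu x"
  by (auto simp: adds_def)

lemma boxes_eq_imp_eq: "is_partition mu \<Longrightarrow> is_partition nu \<Longrightarrow> boxes mu = boxes nu \<Longrightarrow> mu = nu"
  using boxes_subset_iff[of mu nu] boxes_subset_iff[of nu mu] by (auto simp: fun_eq_iff intro: antisym)

context seminormal_parameters
begin

lemma chain_exists:
  assumes "is_partition mu" "is_partition ka" "\<And>r. mu r \<le> ka r" "card (boxes ka) = card (boxes mu) + n"
  shows "\<exists>R. length R = n + 1 \<and> R ! 0 = mu \<and> R ! n = ka \<and> (\<forall>i<n. adds_box (R ! i) (R ! (i + 1)))"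
  using assms(2-4)
proof (induction n arbitrary: ka)
  case 0
  have "boxes mu = boxes ka"
    using card_subset_eq[OF finite_boxes[OF 0(1)], of "boxes mu"] boxes_subset_iff[OF assms(1), of ka] 0 by simp
  then have "mu = ka"
    using boxes_eq_imp_eq[OF assms(1) 0(1)] by simp
  then show ?case
    by (intro exI[of _ "[mu]"]) simp
next
  case (Suc n)
  let ?X = "{r. mu r < ka r}"
  have fin: "finite ?X"
    by (rule finite_subset[of _ "{r. ka r \<noteq> 0}"]) (use Suc.prems(1) in \<open>auto simp: is_partition_def\<close>)
  have "?X \<noteq> {}"
  proof
    assume "?X = {}"
    then have "mu = ka"
      using Suc.prems(2) by (auto simp: fun_eq_iff intro!: antisym) (meson not_le)
    then show False
      using Suc.prems(3) by simp
  qed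
  \<comment> \<open>The lowest row in which \<open>ka\<close> exceeds \<open>mu\<close> ends in a
    removable box: the next row of \<open>ka\<close> agrees with that of \<open>mu\<close>, which is
    at most \<open>mu r < ka r\<close>.\<close>
  define r where "r = Max ?X"
  have r: "mu r < ka r" and above: "\<And>s. r < s \<Longrightarrow> ka s = mu s"
    using Max_in[OF fin \<open>?X \<noteq> {}\<close>] Max_ge[OF fin] Suc.prems(2) unfolding r_def
    by (auto intro!: antisym) (meson not_le)
  have r1: "1 \<le> r"
    using r partition_zero[OF Suc.prems(1)] by (cases r) auto
  define nu where "nu = ka(r := ka r - 1)"
  have nu: "is_partition nu"
  proof (rule is_partitionI[OF Suc.prems(1)])
    show "nu 0 = 0"
      using r1 partition_zero[OF Suc.prems(1)] by (simp add: nu_def)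
    have "{s. nu s \<noteq> ka s} \<subseteq> {r}"
      by (auto simp: nu_def)
    then show "finite {s. nu s \<noteq> ka s}"
      by (rule finite_subset) simp
    fix s :: nat assume s: "1 \<le> s"
    show "nu (Suc s) \<le> nu s"
    proof (cases "s = r")
      case True
      have "mu (Suc r) \<le> mu r"
        using partition_antimono[OF assms(1) r1, of "Suc r"] by simp
      then show ?thesis
        using True r above[of "Suc r"] by (simp add: nu_def)
    next
      case False
      then show ?thesis
        using partition_antimono[OF Suc.prems(1) s, of "Suc s"] by (auto simp: nu_def)
    qed
  qed
  have add: "adds nu r ka"
    using nu Suc.prems(1) r r1 by (auto simp: adds_def nu_def)
  have "card (boxes nu) = card (boxes mu) + n"
    using adds_card[OF add finite_boxes[OF nu]] Suc.prems(3) by simp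
  moreover have "mu s \<le> nu s" for s
    using Suc.prems(2)[of s] r by (auto simp: nu_def)
  ultimately obtain R where R: "length R = n + 1" "R ! 0 = mu" "R ! n = nu" "\<forall>i<n. adds_box (R ! i) (R ! (i + 1))"
    using Suc.IH[OF nu] by blast
  have "adds_box ((R @ [ka]) ! i) ((R @ [ka]) ! (i + 1))" if "i < Suc n" for i
  proof (cases "i = n")
    case True
    then show ?thesis
      using R add by (auto simp: nth_append adds_box_iff)
  next
    case False
    then show ?thesis
      using R that by (auto simp: nth_append)
  qed
  then show ?case
    using R by (intro exI[of _ "R @ [ka]"]) (auto simp: nth_append)
qed

lemma tab_chain:
  assumes "T \<in> Tab k lam" "i \<le> k"
  shows "(T ! 0) r \<le> (T ! i) r" "card (boxes (T ! i)) = card (boxes (T ! 0)) + i"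
proof -
  have "(T ! 0) r \<le> (T ! i) r \<and> card (boxes (T ! i)) = card (boxes (T ! 0)) + i"
    using assms(2)
  proof (induction i)
    case (Suc i)
    then obtain s where s: "adds (T ! i) s (T ! Suc i)"
      using tab_adds[OF assms(1), of i] by auto
    show ?case
      using Suc adds_le[OF s, of r] adds_card[OF s finite_boxes[OF addsD(1)[OF s]]] by auto
  qed simp
  then show "(T ! 0) r \<le> (T ! i) r" "card (boxes (T ! i)) = card (boxes (T ! 0)) + i"
    by auto
qed

section \<open>Moves between tableaux\<close>

definition step :: "nat \<Rightarrow> partition \<Rightarrow> tableau \<Rightarrow> tableau \<Rightarrow> bool" where
  "step k lam T S \<longleftrightarrow> T \<in> Tab k lam \<and> S \<in> Tab k lam \<and>
     ((\<exists>i\<in>{1..k-1}. s_tab a b p q i T = Some S) \<or> 1 \<le> k \<and> s0_tab a b p q T = Some S)"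

lemma s_tab_far: "s_tab a b p q i T = Some S \<Longrightarrow> i < k \<Longrightarrow> \<bar>weight k T (Suc i) - weight k T i\<bar> \<noteq> 1"
  by (auto simp: s_tab_def weight_def abs_if split: if_splits)

lemma s0_tab_special: "s0_tab a b p q T = Some S \<Longrightarrow> 1 \<le> k \<Longrightarrow> \<not> special (weight k T 1)"
  by (auto simp: s0_tab_def weight_def special_def split: if_splits)

text \<open>Both reflections of weights are involutions and the weight determines the tableau, so
  the same move leads back.\<close>

lemma step_sym:
  assumes "step k lam T S"
  shows "step k lam S T"
proof -
  have T: "T \<in> Tab k lam" and S: "S \<in> Tab k lam"
    using assms by (auto simp: step_def)
  consider i where "i \<in> {1..k-1}" "s_tab a b p q i T = Some S" | "1 \<le> k" "s0_tab a b p q T = Some S"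
    using assms by (auto simp: step_def)
  then show ?thesis
  proof cases
    case 1
    have ik: "i < k"
      using 1 by auto
    note far = s_tab_far[OF 1(2) ik]
    have wS: "weight k S = weight k T \<circ> adj i"
      using swap_tableau[OF T 1(1) far] 1(2) by (metis option.inject)
    have "\<bar>weight k S (Suc i) - weight k S i\<bar> \<noteq> 1"
      using far by (simp add: wS adj_apply abs_minus_commute)
    then obtain T' where T': "s_tab a b p q i S = Some T'" "T' \<in> Tab k lam" "weight k T' = weight k S \<circ> adj i"
      using swap_tableau[OF S 1(1)] by blast
    have "T' = T"
      using weight_inj[OF T'(2) T] T'(3) wS by simp
    then show ?thesis
      using S T 1 T'(1) by (auto simp: step_def)
  next
    case 2
    note ns = s0_tab_special[OF 2(2,1)]
    have wS: "weight k S = negate (weight k T)"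
      using negate_tableau[OF T 2(1) ns] 2(2) by (metis option.inject)
    have "\<not> special (weight k S 1)"
      using ns by (auto simp: wS special_def)
    then obtain T' where T': "s0_tab a b p q S = Some T'" "T' \<in> Tab k lam" "weight k T' = negate (weight k S)"
      using negate_tableau[OF S 2(1)] by blast
    have "T' = T"
      using weight_inj[OF T'(2) T] T'(3) wS by simp
    then show ?thesis
      using S T 2 T'(1) by (auto simp: step_def)
  qed
qed

lemma tab_append:
  assumes "T \<in> Tab k ka" "adds_box ka lam"
  shows "T @ [lam] \<in> Tab (Suc k) lam"
proof -
  have "adds_box ((T @ [lam]) ! i) ((T @ [lam]) ! (i + 1))" if "i < Suc k" for i
    using assms that by (cases "i = k") (auto simp: tableaux_iff nth_append)
  then show ?thesis
    using assms by (auto simp: tableaux_iff nth_append)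
qed

lemma tab_split:
  assumes "T \<in> Tab (Suc k) lam"
  shows "T = take (Suc k) T @ [lam]" "take (Suc k) T \<in> Tab k (T ! k)" "adds_box (T ! k) lam"
proof -
  have T: "length T = Suc (Suc k)" "T ! Suc k = lam"
    using assms by (auto simp: tableaux_iff)
  then show "T = take (Suc k) T @ [lam]"
    by (metis lessI order_refl take_Suc_conv_app_nth take_all)
  show "take (Suc k) T \<in> Tab k (T ! k)" "adds_box (T ! k) lam"
    using assms by (auto simp: tableaux_iff)
qed

lemma cont_append: "i < length T \<Longrightarrow> cont a b p q (T @ [lam]) i = cont a b p q T i"
  by (rule cont_cong) (auto simp: nth_append)

lemma step_append:
  assumes "step k ka T S" "adds_box ka lam"
  shows "step (Suc k) lam (T @ [lam]) (S @ [lam])"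
proof -
  have T: "T \<in> Tab k ka" and S: "S \<in> Tab k ka"
    using assms by (auto simp: step_def)
  have len: "length T = Suc k"
    using T by (simp add: tableaux_iff)
  consider i where "i \<in> {1..k-1}" "s_tab a b p q i T = Some S" | "1 \<le> k" "s0_tab a b p q T = Some S"
    using assms by (auto simp: step_def)
  then have "(\<exists>i\<in>{1..k}. s_tab a b p q i (T @ [lam]) = Some (S @ [lam])) \<or> s0_tab a b p q (T @ [lam]) = Some (S @ [lam])"
  proof cases
    case 1
    then have i: "i < length T" "i + 1 < length T" "i - 1 < length T"
      using len by auto
    have "s_tab a b p q i (T @ [lam]) = map_option (\<lambda>S. S @ [lam]) (s_tab a b p q i T)"
      using i by (simp add: s_tab_def cont_append nth_append list_update_append)
    then show ?thesis
      using 1 by (intro disjI1 bexI[of _ i]) auto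
  next
    case 2
    then have i: "0 < length T" "1 < length T"
      using len by auto
    have "s0_tab a b p q (T @ [lam]) = map_option (\<lambda>S. S @ [lam]) (s0_tab a b p q T)"
      using i by (simp add: s0_tab_def cont_append nth_append list_update_append)
    then show ?thesis
      using 2 by simp
  qed
  then show ?thesis
    using tab_append[OF T assms(2)] tab_append[OF S assms(2)] by (simp add: step_def)
qed

lemma steps_append:
  assumes "(step k ka)\<^sup>*\<^sup>* T S" "adds_box ka lam"
  shows "(step (Suc k) lam)\<^sup>*\<^sup>* (T @ [lam]) (S @ [lam])"
  using assms(1)
proof (induction rule: rtranclp_induct)
  case (step S S')
  then show ?case
    using step_append[OF _ assms(2)] by (meson rtranclp.rtrancl_into_rtrancl)
qed simp

text \<open>\<open>nu\<close> is the intersection of \<open>ka\<close> and \<open>ka'\<close>. The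
  two boxes it lacks are removable from \<open>lam\<close>, and distinct removable boxes never lie
  on equal or neighbouring diagonals.\<close>

lemma common_lower:
  assumes "adds ka r lam" "adds ka' s lam" "ka \<noteq> ka'"
  obtains nu where "adds nu s ka" "adds nu r ka'" "r \<noteq> s" "2 \<le> \<bar>box_content ka r - box_content nu s\<bar>"
    and "\<And>x. nu x = min (ka x) (ka' x)"
proof -
  note 1 = addsD[OF assms(1)] and 2 = addsD[OF assms(2)]
  have rs: "r \<noteq> s"
    using adds_row_unique(2)[OF assms(1,2)] assms(3) by auto
  define nu where "nu x = min (ka x) (ka' x)" for x
  have vals: "ka s = Suc (nu s)" "ka' r = Suc (nu r)" "\<And>x. x \<noteq> s \<Longrightarrow> nu x = ka x" "\<And>x. x \<noteq> r \<Longrightarrow> nu x = ka' x"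
  proof -
    have "ka s = lam s" "ka' r = lam r" "lam s = Suc (ka' s)" "lam r = Suc (ka r)"
      using 1(5)[of s] 2(5)[of r] 1(4) 2(4) rs by auto
    then show "ka s = Suc (nu s)" "ka' r = Suc (nu r)"
      by (auto simp: nu_def)
    show "nu x = ka x" if "x \<noteq> s" for x
      using 1(4) 1(5)[of x] 2(5)[of x] that by (cases "x = r") (auto simp: nu_def)
    show "nu x = ka' x" if "x \<noteq> r" for x
      using 2(4) 1(5)[of x] 2(5)[of x] that by (cases "x = s") (auto simp: nu_def)
  qed
  have nu: "is_partition nu"
  proof (rule is_partitionI[OF 1(1)])
    show "nu 0 = 0"
      using partition_zero[OF 1(1)] by (simp add: nu_def)
    have "{x. nu x \<noteq> ka x} \<subseteq> {s}"
      using vals(3) by auto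
    then show "finite {x. nu x \<noteq> ka x}"
      by (rule finite_subset) simp
    show "nu (Suc x) \<le> nu x" if "1 \<le> x" for x
      using partition_antimono[OF 1(1) that, of "Suc x"] partition_antimono[OF 2(1) that, of "Suc x"]
      by (auto simp: nu_def)
  qed
  have a1: "adds nu s ka"
    using nu 1(1) 2(3) vals by (auto simp: adds_def fun_eq_iff)
  moreover have "adds nu r ka'"
    using nu 2(1) 1(3) vals by (auto simp: adds_def fun_eq_iff)
  moreover have "2 \<le> \<bar>box_content ka r - box_content nu s\<bar>"
  proof -
    have e: "ka s = lam s" "ka' r = lam r" "lam r = Suc (ka r)" "lam s = Suc (ka' s)"
      using 1(4) 1(5)[of s] 2(4) 2(5)[of r] rs by auto
    consider "r < s" | "s < r"
      using rs by linarith
    then show ?thesis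
    proof cases
      case 1
      then have "ka s \<le> ka r"
        using partition_antimono[OF \<open>is_partition ka\<close> \<open>1 \<le> r\<close>, of s] by simp
      then show ?thesis
        using 1 vals(1) by (simp add: box_content_def)
    next
      case 2
      then have "ka' r \<le> ka' s"
        using partition_antimono[OF \<open>is_partition ka'\<close> \<open>1 \<le> s\<close>, of r] by simp
      then show ?thesis
        using 2 vals(1) e by (simp add: box_content_def)
    qed
  qed
  ultimately show ?thesis
    using that rs nu_def by blast
qed

text \<open>If the last steps differ, induction joins both tableaux to tableaux through the
  intersection of \<open>T ! k\<close> and \<open>S ! k\<close>, and these two differ by one move
  s_k. A chain \<open>R\<close> to the intersection exists because the intersection contains the
  common start.\<close>

lemma connected_same_start:
  "T \<in> Tab k lam \<Longrightarrow> S \<in> Tab k lam \<Longrightarrow> T ! 0 = S ! 0 \<Longrightarrow> (step k lam)\<^sup>*\<^sup>* T S"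
proof (induction k arbitrary: lam T S)
  case 0
  then have "T = S"
    by (intro nth_equalityI) (auto simp: tableaux_iff)
  then show ?case by simp
next
  case (Suc k)
  note T = tab_split[OF Suc.prems(1)] and S = tab_split[OF Suc.prems(2)]
  let ?T = "take (Suc k) T" and ?S = "take (Suc k) S"
  have start: "?T ! 0 = T ! 0" "?S ! 0 = T ! 0"
    using Suc.prems(3) by simp_all
  show ?case
  proof (cases "T ! k = S ! k")
    case True
    have "(step k (T ! k))\<^sup>*\<^sup>* ?T ?S"
      by (rule Suc.IH[OF T(2)]) (use S(2) True start in auto)
    from steps_append[OF this T(3)] show ?thesis
      using T(1) S(1) by simp
  next
    case False
    then have "k \<noteq> 0"
      using Suc.prems(3) by auto
    then obtain j where k: "k = Suc j"
      by (cases k) auto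
    obtain r s where r: "adds (T ! k) r lam" and s: "adds (S ! k) s lam"
      using T(3) S(3) by (auto simp: adds_box_iff)
    obtain nu where nu: "adds nu s (T ! k)" "adds nu r (S ! k)" "r \<noteq> s"
      "2 \<le> \<bar>box_content (T ! k) r - box_content nu s\<bar>" "\<And>x. nu x = min ((T ! k) x) ((S ! k) x)"
      using common_lower[OF r s False] by blast
    have part: "is_partition (T ! 0)"
      using tableaux_partition[OF Suc.prems(1)] by simp
    have le: "(T ! 0) x \<le> nu x" for x
      using tab_chain(1)[OF Suc.prems(1), of k x] tab_chain(1)[OF Suc.prems(2), of k x] Suc.prems(3) nu(5)
      by simp
    have "card (boxes (T ! k)) = card (boxes (T ! 0)) + k"
      using tab_chain(2)[OF Suc.prems(1), of k] by simp
    then have "card (boxes nu) = card (boxes (T ! 0)) + j"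
      using adds_card[OF nu(1) finite_boxes[OF addsD(1)[OF nu(1)]]] k by simp
    from chain_exists[OF part addsD(1)[OF nu(1)] le this]
    obtain R where R: "length R = j + 1" "R ! 0 = T ! 0" "R ! j = nu" "\<forall>i<j. adds_box (R ! i) (R ! (i + 1))"
      by blast
    have RT: "R \<in> Tab j nu"
      using R Suc.prems(1) by (auto simp: tableaux_iff)
    have ab: "adds_box nu (T ! k)" "adds_box nu (S ! k)"
      using nu(1,2) by (auto simp: adds_box_iff)
    note U = tab_append[OF RT ab(1), folded k] and V = tab_append[OF RT ab(2), folded k]
    note U' = tab_append[OF U T(3)] and V' = tab_append[OF V S(3)]
    have R0: "(R @ [x]) ! 0 = T ! 0" for x
      using R by (simp add: nth_append)
    have 1: "(step (Suc k) lam)\<^sup>*\<^sup>* T ((R @ [T ! k]) @ [lam])"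
    proof -
      have "(step k (T ! k))\<^sup>*\<^sup>* ?T (R @ [T ! k])"
        by (rule Suc.IH[OF T(2) U]) (simp add: R0)
      from steps_append[OF this T(3)] show ?thesis
        using T(1) by simp
    qed
    have 2: "(step (Suc k) lam)\<^sup>*\<^sup>* ((R @ [S ! k]) @ [lam]) S"
    proof -
      have "(step k (S ! k))\<^sup>*\<^sup>* (R @ [S ! k]) ?S"
        by (rule Suc.IH[OF V S(2)]) (use R0 Suc.prems(3) in simp)
      from steps_append[OF this S(3)] show ?thesis
        using S(1) by simp
    qed
    let ?U = "(R @ [T ! k]) @ [lam]" and ?V = "(R @ [S ! k]) @ [lam]"
    have nth: "?U ! j = nu" "?U ! Suc j = T ! k" "?U ! Suc (Suc j) = lam"
      using R by (simp_all add: nth_append)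
    have c: "cont a b p q ?U k = shifted nu s" "cont a b p q ?U (Suc k) = shifted (T ! k) r"
      using cont_Suc[of ?U j s] cont_Suc[of ?U k r] nu(1) r nth k by simp_all
    have far: "\<bar>shifted (T ! k) r - shifted nu s\<bar> \<ge> 2"
    proof -
      have "2 \<le> real_of_int \<bar>box_content (T ! k) r - box_content nu s\<bar>"
        using nu(4) by linarith
      then show ?thesis
        by (simp add: shifted_def)
    qed
    have new: "(\<lambda>x. (?U ! (k - 1)) x + ((?U ! (k + 1)) x - (?U ! k) x)) = S ! k"
    proof
      fix x
      have "nu x + (lam x - (T ! k) x) = (S ! k) x"
        using addsD(4)[OF r] addsD(5)[OF r, of x] addsD(4)[OF nu(2)] addsD(5)[OF nu(2), of x] by (cases "x = r") auto
      then show "(?U ! (k - 1)) x + ((?U ! (k + 1)) x - (?U ! k) x) = (S ! k) x"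
        using nth k by simp
    qed
    have upd: "?U[k := S ! k] = ?V"
      using R k by (simp add: list_update_append)
    have "s_tab a b p q k ?U = Some ?V"
      unfolding s_tab_def new upd using c far by auto
    then have "step (Suc k) lam ?U ?V"
      using U' V' k by (auto simp: step_def)
    then show ?thesis
      using 1 2 by (meson converse_rtranclp_into_rtranclp rtranclp_trans)
  qed
qed

section \<open>Tableaux with different initial partitions\<close>

definition top_dist :: "partition \<Rightarrow> partition \<Rightarrow> nat" where
  "top_dist mu nu = (\<Sum>i\<in>{1..q}. nat \<bar>int (mu i) - int (nu i)\<bar>)"

lemma top_dist_sym: "top_dist mu nu = top_dist nu mu"
  by (simp add: top_dist_def abs_minus_commute)

lemma approach:
  assumes T: "T \<in> Tab k lam" and S: "S \<in> Tab k lam" and k: "1 \<le> k"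
    and i: "i \<in> {1..q}" "(T ! 0) i < (S ! 0) i"
  obtains T' where "T' \<in> Tab k lam" "(step k lam)\<^sup>*\<^sup>* T T'" "top_dist (T' ! 0) (S ! 0) < top_dist (T ! 0) (S ! 0)"
proof -
  let ?mu = "T ! 0" and ?nu = "S ! 0"
  have P: "?mu \<in> P" "?nu \<in> P"
    using T S by (auto simp: tableaux_iff)
  \<comment> \<open>Minimality gives mu_j < nu_j \<le> nu_(j-1) \<le> mu_(j-1) for j > 1, so a box
    fits into row j of \<open>?mu\<close>.\<close>
  define j where "j = (LEAST j. j \<in> {1..q} \<and> ?mu j < ?nu j)"
  have j: "j \<in> {1..q}" "?mu j < ?nu j"
    using LeastI[of "\<lambda>j. j \<in> {1..q} \<and> ?mu j < ?nu j" i] i unfolding j_def by auto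
  have prev: "?nu (j - 1) \<le> ?mu (j - 1)" if "2 \<le> j"
  proof -
    have "\<not> (j - 1 \<in> {1..q} \<and> ?mu (j - 1) < ?nu (j - 1))"
      using not_less_Least[of "j - 1" "\<lambda>j. j \<in> {1..q} \<and> ?mu j < ?nu j"] that unfolding j_def by auto
    then show ?thesis
      using j(1) that by auto
  qed
  have lt: "?mu j < a + b"
    using j P_top(3)[OF P(2) j(1)] by simp
  have "j = 1 \<or> ?mu j < ?mu (j - 1)"
  proof (cases "2 \<le> j")
    case True
    then have "?nu j \<le> ?nu (j - 1)"
      using partition_antimono[OF P_D(1)[OF P(2)], of "j - 1" j] by simp
    then show ?thesis
      using prev[OF True] j by simp
  qed (use j in auto)
  then obtain mu' where pr: "paired ?mu mu' j"
    using paired_up[OF P(1) j(1) lt] by blast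
  define ka where "ka = ?mu(j := Suc (?mu j))"
  note F = paired_facts[OF pr, folded ka_def]
  have lam: "is_partition lam"
    using tableaux_partition[OF T, of k] T by (simp add: tableaux_iff)
  \<comment> \<open>The added box lies in \<open>?nu\<close> and hence in \<open>lam\<close>;
    therefore some tableau of shape \<open>lam\<close> begins with \<open>?mu\<close>,
    \<open>ka\<close>.\<close>
  have "ka x \<le> lam x" for x
  proof -
    have "?mu x \<le> lam x" "?nu x \<le> lam x"
      using tab_chain(1)[OF T, of k x] tab_chain(1)[OF S, of k x] T S by (simp_all add: tableaux_iff)
    then show ?thesis
      using j(2) by (auto simp: ka_def)
  qed
  moreover have "card (boxes lam) = card (boxes ka) + (k - 1)"
    using tab_chain(2)[OF T, of k] T adds_card[OF F(1) finite_boxes[OF addsD(1)[OF F(1)]]] k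
    by (simp add: tableaux_iff)
  ultimately obtain R where R: "length R = k - 1 + 1" "R ! 0 = ka" "R ! (k - 1) = lam"
    "\<forall>i<k - 1. adds_box (R ! i) (R ! (i + 1))"
    using chain_exists[OF addsD(2)[OF F(1)] lam] by blast
  define Q where "Q = ?mu # R"
  have Q: "Q \<in> Tab k lam"
    unfolding tableaux_iff
  proof (intro conjI allI impI)
    show "length Q = k + 1" "Q ! 0 \<in> P0 a b p q" "Q ! k = lam"
      using R P k by (auto simp: Q_def nth_Cons')
    show "adds_box (Q ! l) (Q ! (l + 1))" if "l < k" for l
    proof (cases l)
      case 0
      then show ?thesis
        using R F(1) by (auto simp: Q_def adds_box_iff)
    next
      case (Suc l')
      then show ?thesis
        using R that by (simp add: Q_def)
    qed
  qed
  have Q01: "Q ! 0 = ?mu" "Q ! 1 = ka"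
    using R by (simp_all add: Q_def)
  have TQ: "(step k lam)\<^sup>*\<^sup>* T Q"
    by (rule connected_same_start[OF T Q]) (simp add: Q01)
  have "weight k Q 1 = shifted ?mu j"
    using cont_Suc[of Q 0 j] F(1) Q01 k by (simp add: weight_def)
  then have "\<not> special (weight k Q 1)"
    using F(5,6) A_pos by (auto simp: special_def)
  then obtain T' where T': "s0_tab a b p q Q = Some T'" "T' \<in> Tab k lam" "T' ! 0 \<noteq> Q ! 0" "T' ! 1 = Q ! 1"
    using negate_tableau[OF Q k] by metis
  have "T' ! 0 = mu'"
  proof (rule P_other_unique[OF P(1) F(1)])
    show "T' ! 0 \<in> P" "T' ! 0 \<noteq> ?mu"
      using T' Q01 by (auto simp: tableaux_iff)
    have "adds_box (T' ! 0) (T' ! 1)"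
      using T'(2) k by (auto simp: tableaux_iff)
    then show "boxes (T' ! 0) \<subseteq> boxes ka"
      using T'(4) Q01 by (auto simp: adds_box_def)
    show "mu' \<in> P" "mu' \<noteq> ?mu" "boxes mu' \<subseteq> boxes ka"
      using pr F(3) adds_boxes(1)[OF F(2)] by (auto simp: paired_def)
  qed
  moreover have "top_dist mu' ?nu < top_dist ?mu ?nu"
  proof -
    have "mu' j = Suc (?mu j)"
      using pr by (simp add: paired_def)
    moreover have "mu' l = ?mu l" if "l \<in> {1..q}" "l \<noteq> j" for l
      using pr that conj_row_range[OF j(1)] q_le_p by (auto simp: paired_def)
    ultimately have le: "nat \<bar>int (mu' l) - int (?nu l)\<bar> \<le> nat \<bar>int (?mu l) - int (?nu l)\<bar>"
      and lt: "nat \<bar>int (mu' j) - int (?nu j)\<bar> < nat \<bar>int (?mu j) - int (?nu j)\<bar>"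
      if "l \<in> {1..q}" for l
      using j(2) that by (cases "l = j"; simp)+
    show ?thesis
      unfolding top_dist_def
    proof (rule sum_strict_mono_ex1)
      show "\<exists>l\<in>{1..q}. nat \<bar>int (mu' l) - int (?nu l)\<bar> < nat \<bar>int (?mu l) - int (?nu l)\<bar>"
        using lt[OF j(1)] j(1) by blast
    qed (use le in blast)+
  qed
  moreover have "(step k lam)\<^sup>*\<^sup>* T T'"
    using TQ Q T' k by (auto simp: step_def intro: rtranclp.rtrancl_into_rtrancl)
  ultimately show ?thesis
    using that T'(2) by simp
qed

lemma steps_sym: "(step k lam)\<^sup>*\<^sup>* T S \<Longrightarrow> (step k lam)\<^sup>*\<^sup>* S T"
  by (induction rule: rtranclp_induct) (auto intro: step_sym converse_rtranclp_into_rtranclp)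

lemma connected:
  assumes "T \<in> Tab k lam" "S \<in> Tab k lam" "1 \<le> k"
  shows "(step k lam)\<^sup>*\<^sup>* T S"
  using assms(1,2)
proof (induction "top_dist (T ! 0) (S ! 0)" arbitrary: T S rule: less_induct)
  case less
  note T = less.prems(1) and S = less.prems(2)
  show ?case
  proof (cases "T ! 0 = S ! 0")
    case True
    then show ?thesis
      using connected_same_start[OF T S] by simp
  next
    case False
    have "T ! 0 \<in> P" "S ! 0 \<in> P"
      using T S by (auto simp: tableaux_iff)
    with False obtain i where i: "i \<in> {1..q}" "(T ! 0) i \<noteq> (S ! 0) i"
      using P_ext by blast
    show ?thesis
    proof (cases "(T ! 0) i < (S ! 0) i")
      case True
      obtain T' where "T' \<in> Tab k lam" "(step k lam)\<^sup>*\<^sup>* T T'"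
        "top_dist (T' ! 0) (S ! 0) < top_dist (T ! 0) (S ! 0)"
        using approach[OF T S assms(3) i(1) True] .
      then show ?thesis
        using less.hyps[of T' S] S by (meson rtranclp_trans)
    next
      case False
      then have lt: "(S ! 0) i < (T ! 0) i"
        using i(2) by simp
      obtain S' where "S' \<in> Tab k lam" "(step k lam)\<^sup>*\<^sup>* S S'"
        "top_dist (S' ! 0) (T ! 0) < top_dist (S ! 0) (T ! 0)"
        using approach[OF S T assms(3) i(1) lt] .
      then show ?thesis
        using less.hyps[of T S'] T top_dist_sym steps_sym by (metis rtranclp_trans)
    qed
  qed
qed

lemma tableaux_nonempty:
  assumes "lam \<in> Pset a b p q k"
  shows "Tab k lam \<noteq> {}"
  using assms
proof (induction k arbitrary: lam)
  case 0
  then have "[lam] \<in> Tab 0 lam"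
    by (simp add: tableaux_iff)
  then show ?case by blast
next
  case (Suc k)
  then obtain ka T where "adds_box ka lam" "T \<in> Tab k ka"
    by fastforce
  then show ?case
    using tab_append by blast
qed

end

section \<open>Modules over the extended algebra\<close>

abbreviation F_alg :: "nat \<Rightarrow> (letter word \<Rightarrow>\<^sub>0 complex) ring" where
  "F_alg k \<equiv> free_algebra (alphabet k)"

lemma gen_letters:
  "w permutes {1..k} \<Longrightarrow> tt w \<in> carrier (F_alg k)"
  "i \<in> {1..k} \<Longrightarrow> xx i \<in> carrier (F_alg k)"
  "i \<in> {1..k} \<Longrightarrow> yy i \<in> carrier (F_alg k)"
  "i \<in> {0..k} \<Longrightarrow> zz i \<in> carrier (F_alg k)"
  by (auto simp: alphabet_def intro!: free_gen)

lemma tt_adj: "i \<in> {1..k-1} \<Longrightarrow> tt (adj i) \<in> carrier (F_alg k)"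
  by (rule gen_letters(1)) (rule adj_permutes; auto)

lemmas free_intros = free_add free_diff free_mult free_one free_zero free_scal free_sum

lemma m_sum_carrier:
  assumes "j \<in> {1..k}"
  shows "m_sum j \<in> carrier (F_alg k)"
  unfolding m_sum_def
proof (rule free_sum)
  fix i assume i: "i \<in> {1..<j}"
  have "tt (adj (j - 1)) \<in> carrier (F_alg k)"
    by (rule tt_adj) (use i assms in auto)
  moreover have "tt (Transposition.transpose i (j - 1)) \<in> carrier (F_alg k)"
    by (rule gen_letters(1), rule permutes_swap_id) (use i assms in auto)
  moreover have "xx j \<in> carrier (F_alg k)" "xx (j - 1) \<in> carrier (F_alg k)"
    by (rule gen_letters(2); use i assms in auto)+
  ultimately show "m_pair i j \<in> carrier (F_alg k)"
    unfolding m_pair_def Let_def by (auto intro!: free_diff free_mult)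
qed

lemma G_rel_carrier:
  assumes "G_rel k u v"
  shows "u \<in> carrier (F_alg k) \<and> v \<in> carrier (F_alg k)"
  using assms
proof cases
  case (t_mult w w')
  then show ?thesis
    using permutes_compose[of w' "{1..k}" w] by (auto intro!: free_intros gen_letters)
next
  case t_id
  then show ?thesis
    using permutes_id by (auto intro!: free_intros gen_letters)
qed (auto intro!: free_intros gen_letters(2-4) tt_adj m_sum_carrier)

lemma H_rel_carrier:
  assumes "H_rel k a b p q u v" "1 \<le> k"
  shows "u \<in> carrier (F_alg k) \<and> v \<in> carrier (F_alg k)"
  using assms by cases (auto intro!: free_intros gen_letters(2-4) tt_adj)

context
  fixes k a b p q :: nat
  assumes k: "1 \<le> k"
begin

lemma G_gens: "{u - v | u v. G_rel k u v} \<subseteq> carrier (F_alg k)"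
  using G_rel_carrier free_diff by blast

lemma G_ideal: "ideal (G_ideal k) (F_alg k)"
  unfolding G_ideal_def by (rule ring.genideal_ideal[OF ring_free_algebra G_gens])

lemma G_ring: "ring (G_alg k)"
  unfolding G_alg_def by (rule ideal.quotient_is_ring[OF G_ideal])

lemma G_class_hom: "G_class k \<in> ring_hom (F_alg k) (G_alg k)"
  unfolding G_alg_def using ideal.rcos_ring_hom[OF G_ideal] by (simp add: G_class_def[abs_def])

lemma G_class_carrier: "u \<in> carrier (F_alg k) \<Longrightarrow> G_class k u \<in> carrier (G_alg k)"
  by (rule ring_hom_closed[OF G_class_hom])

lemma H_gens: "{G_class k (u - v) | u v. H_rel k a b p q u v} \<subseteq> carrier (G_alg k)"
  using H_rel_carrier[OF _ k] free_diff G_class_carrier by blast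

lemma H_ideal: "ideal (H_ideal k a b p q) (G_alg k)"
  unfolding H_ideal_def by (rule ring.genideal_ideal[OF G_ring H_gens])

lemma H_ring: "ring (H_ext k a b p q)"
  unfolding H_ext_def by (rule ideal.quotient_is_ring[OF H_ideal])

lemma H_class_hom: "H_class k a b p q \<in> ring_hom (F_alg k) (H_ext k a b p q)"
proof -
  have "(\<lambda>x. H_ideal k a b p q +>\<^bsub>G_alg k\<^esub> x) \<circ> G_class k \<in> ring_hom (F_alg k) (H_ext k a b p q)"
    unfolding H_ext_def by (rule ring_hom_trans[OF G_class_hom ideal.rcos_ring_hom[OF H_ideal]])
  then show ?thesis
    by (simp add: H_class_def[abs_def] comp_def)
qed

lemma H_class_surj:
  assumes "g \<in> carrier (H_ext k a b p q)"
  shows "\<exists>u\<in>carrier (F_alg k). g = H_class k a b p q u"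
proof -
  obtain x where x: "x \<in> carrier (G_alg k)" "g = H_ideal k a b p q +>\<^bsub>G_alg k\<^esub> x"
    using FactRing_carrier assms unfolding H_ext_def by blast
  obtain u where "u \<in> carrier (F_alg k)" "x = G_class k u"
    using FactRing_carrier x(1) unfolding G_alg_def G_class_def by blast
  then show ?thesis
    using x(2) by (auto simp: H_class_def)
qed

text \<open>The map is factored once through each of the two quotients. Their ideals are generated
  by differences u - v, which is where \<open>diff\<close> enters.\<close>

lemma H_ext_universal:
  fixes f :: "free \<Rightarrow> 'r::ring_1"
  assumes hom: "f \<in> ring_hom (F_alg k) (ring_of TYPE('r))"
    and diff: "\<And>u v. f (u - v) = f u - f v"
    and G: "\<And>u v. G_rel k u v \<Longrightarrow> f u = f v" and H: "\<And>u v. H_rel k a b p q u v \<Longrightarrow> f u = f v"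
  obtains f' where "f' \<in> ring_hom (H_ext k a b p q) (ring_of TYPE('r))"
    "\<And>u. u \<in> carrier (F_alg k) \<Longrightarrow> f' (H_class k a b p q u) = f u"
proof -
  have "f u = \<zero>\<^bsub>ring_of TYPE('r)\<^esub>" if "u \<in> G_ideal k" for u
    using that unfolding G_ideal_def
    by (rule ring_hom_vanish_genideal[OF ring_free_algebra ring_ring_of hom G_gens, rotated])
       (use G diff in auto)
  then obtain f1 where f1: "f1 \<in> ring_hom (G_alg k) (ring_of TYPE('r))"
    "\<And>u. u \<in> carrier (F_alg k) \<Longrightarrow> f1 (G_class k u) = f u"
    using ring_hom_factor[OF ring_free_algebra ring_ring_of hom G_ideal]
    unfolding G_alg_def[symmetric] G_class_def[symmetric] by metis
  have H0: "f1 x = \<zero>\<^bsub>ring_of TYPE('r)\<^esub>" if "x \<in> {G_class k (u - v) | u v. H_rel k a b p q u v}" for x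
  proof -
    obtain u v where uv: "x = G_class k (u - v)" "H_rel k a b p q u v"
      using \<open>x \<in> _\<close> by blast
    have "u - v \<in> carrier (F_alg k)"
      using H_rel_carrier[OF uv(2) k] free_diff by blast
    then show ?thesis
      using f1(2) uv H[OF uv(2)] diff by simp
  qed
  have "f1 x = \<zero>\<^bsub>ring_of TYPE('r)\<^esub>" if "x \<in> H_ideal k a b p q" for x
    using ring_hom_vanish_genideal[OF G_ring ring_ring_of f1(1) H_gens, of x] H0 that
    unfolding H_ideal_def by blast
  then obtain f2 where f2: "f2 \<in> ring_hom (H_ext k a b p q) (ring_of TYPE('r))"
    "\<And>x. x \<in> carrier (G_alg k) \<Longrightarrow> f2 (H_ideal k a b p q +>\<^bsub>G_alg k\<^esub> x) = f1 x"
    using ring_hom_factor[OF G_ring ring_ring_of f1(1) H_ideal]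
    unfolding H_ext_def[symmetric] by metis
  have "f2 (H_class k a b p q u) = f u" if "u \<in> carrier (F_alg k)" for u
    using f2(2)[OF G_class_carrier[OF that]] f1(2)[OF that] by (simp add: H_class_def)
  then show ?thesis
    using that f2(1) by blast
qed

end

lemma scal_central: "scal c * f = f * scal c"
proof -
  have "scal c * (\<Sum>u\<in>Poly_Mapping.keys f. Poly_Mapping.single u (Poly_Mapping.lookup f u))
      = (\<Sum>u\<in>Poly_Mapping.keys f. Poly_Mapping.single u (Poly_Mapping.lookup f u)) * scal c"
    by (simp add: scal_def sum_distrib_left sum_distrib_right mult_single mult.commute)
  then show ?thesis
    by (simp only: poly_mapping_as_sum[symmetric])
qed

section \<open>The presentation evaluated in an algebra\<close>

locale two_boundary_algebra = two_boundary_relations k \<rho> X Z + central_scalars \<kappa>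
  for k :: nat and \<rho> :: "(nat \<Rightarrow> nat) \<Rightarrow> 'r::ring_1" and X :: 'r and Z :: "nat \<Rightarrow> 'r" and \<kappa> :: "complex \<Rightarrow> 'r" +
  fixes a b p q :: nat
  assumes X_quad: "(X - \<kappa> (of_nat a)) * (X + \<kappa> (of_nat p)) = 0"
    and Y_quad: "(Z 1 - X - \<kappa> (of_nat b)) * (Z 1 - X + \<kappa> (of_nat q)) = 0"
begin

primrec letter_image :: "letter \<Rightarrow> 'r" where
  "letter_image (LT v) = \<rho> v"
| "letter_image (LX i) = tower X i"
| "letter_image (LY i) = tower Y i"
| "letter_image (LZ i) = Z i"

abbreviation "ev \<equiv> eval letter_image"

lemmas ev_simps = eval_add eval_diff eval_mult eval_sum eval_gen eval_scal eval_one eval_zero letter_image.simps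

lemma ev_m_sum:
  assumes "j \<in> {1..k}"
  shows "ev (m_sum j) = M j"
  unfolding m_sum_def M_def eval_sum
proof (rule sum.cong)
  fix i assume i: "i \<in> {1..<j}"
  have j: "j - 1 \<in> {1..k-1}" "Suc (j - 1) = j"
    using i assms by auto
  have d: "tower X j - \<rho> (adj (j - 1)) * tower X (j - 1) * \<rho> (adj (j - 1)) = \<rho> (adj (j - 1))"
    using tower_diff[OF j(1), of X] j(2) by (simp add: t_def)
  show "ev (m_pair i j) = \<rho> (Transposition.transpose i j)"
  proof (cases "i = j - 1")
    case True
    then show ?thesis
      using d j(2) by (simp add: m_pair_def Let_def ev_simps adj_def)
  next
    case False
    then have "i < j - 1"
      using i by auto
    then show ?thesis
      using False rho_transpose_step[of i j] i assms d by (simp add: m_pair_def Let_def ev_simps t_def)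
  qed
qed simp

lemma X_t': "i \<in> {2..k-1} \<Longrightarrow> t i * X = X * t i"
  using X_t by (simp add: t_def)

lemma X_X2': "2 \<le> k \<Longrightarrow> X * (t 1 * X * t 1 + t 1) = (t 1 * X * t 1 + t 1) * X"
  using X_X2 by (simp add: t_def)

lemma braid_tower:
  assumes "i \<in> {1..k-2}"
  shows "t i * t (Suc i) * (tower x (Suc i) - t i * tower x i * t i) * t (Suc i) * t i
    = tower x (Suc (Suc i)) - t (Suc i) * tower x (Suc i) * t (Suc i)"
proof -
  have i: "i \<in> {1..k-1}" "Suc i \<in> {1..k-1}"
    using assms by auto
  have "t i * t (Suc i) * t i * t (Suc i) * t i = t (Suc i) * t i * (t (Suc i) * t (Suc i)) * t i"
    using t_braid[OF assms] by (simp add: mult.assoc)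
  also have "\<dots> = t (Suc i)"
    using t_sq[OF i(1)] t_sq[OF i(2)] by (simp add: mult.assoc)
  finally show ?thesis
    unfolding tower_diff[OF i(1)] tower_diff[OF i(2)] .
qed

lemma G_rel_ev: "G_rel k u v \<Longrightarrow> ev u = ev v"
proof (induction rule: G_rel.induct)
  case (z_def i)
  then show ?case
    using Z_eq[of i] by (simp add: ev_simps ev_m_sum)
next
  case (x_braid i)
  then show ?case
    using braid_tower[of i X] by (simp add: ev_simps t_def[symmetric])
next
  case (y_braid i)
  then show ?case
    using braid_tower[of i Y] by (simp add: ev_simps t_def[symmetric])
next
  case (x_y i)
  then show ?case
    using tower_diff[of i X] tower_diff[of i Y] by (simp add: ev_simps t_def[symmetric])
next
  case (t_mult w w')
  then show ?case
    by (simp add: ev_simps rho_mult)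
next
  case t_id
  then show ?case
    by (simp only: ev_simps rho_id)
next
  case (x_comm i j)
  then show ?case
    using tower_commute[of X, OF X_t' X_X2'] by (simp add: ev_simps)
next
  case (y_comm i j)
  then show ?case
    using tower_commute[of Y, OF Y_t Y_Y2] by (simp add: ev_simps)
next
  case (t_x i j)
  then show ?case
    using t_tower_far[of X, OF X_t' X_X2'] by (simp add: ev_simps t_def[symmetric])
next
  case (t_y i j)
  then show ?case
    using t_tower_far[of Y, OF Y_t Y_Y2] by (simp add: ev_simps t_def[symmetric])
next
  case (zsum_x j i)
  then show ?case
    using zsum_tower[OF zsum_X, of j i] by (simp add: ev_simps)
next
  case (zsum_y j i)
  then show ?case
    using zsum_tower[OF zsum_Y, of j i] by (simp add: ev_simps)
next
  case (t_xsum i)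
  then show ?case
    using t_tower_sum[of i X] by (simp add: ev_simps t_def[symmetric])
next
  case (t_ysum i)
  then show ?case
    using t_tower_sum[of i Y] by (simp add: ev_simps t_def[symmetric])
qed (simp_all add: ev_simps Z_Z t_Z_far)

lemma H_rel_ev: "H_rel k a b p q u v \<Longrightarrow> ev u = ev v"
proof (induction rule: H_rel.induct)
  case (t_x i)
  then show ?case
    using t_tower[of i X] by (simp add: ev_simps t_def[symmetric])
next
  case (t_y i)
  then show ?case
    using t_tower[of i Y] by (simp add: ev_simps t_def[symmetric])
qed (use X_quad Y_quad in \<open>simp_all add: ev_simps\<close>)

lemma ev_hom: "ev \<in> ring_hom (F_alg k) (ring_of TYPE('r))"
  by (rule ring_hom_memI) (simp_all add: ev_simps)

text \<open>This is for the property of mapping functions supported on the weights of tableaux to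
  such functions.\<close>

lemma ev_preserves:
  assumes add: "\<And>r s. Q r \<Longrightarrow> Q s \<Longrightarrow> Q (r + s)" and mult: "\<And>r s. Q r \<Longrightarrow> Q s \<Longrightarrow> Q (r * s)"
    and neg: "\<And>r. Q r \<Longrightarrow> Q (- r)" and scalars: "\<And>c. Q (\<kappa> c)"
    and rho: "\<And>v. v permutes {1..k} \<Longrightarrow> Q (\<rho> v)" and X: "Q X" and Z: "\<And>i. i \<in> {0..k} \<Longrightarrow> Q (Z i)"
    and u: "u \<in> carrier (F_alg k)"
  shows "Q (ev u)"
proof -
  have one: "Q 1" and zero: "Q 0"
    using scalars[of 1] scalars[of 0] by (simp_all add: \<kappa>_one \<kappa>_zero)
  have Y: "Q Y"
    using add[OF Z[of 1] neg[OF X]] k_pos by simp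
  have tower: "Q (tower x i)" if "i \<in> {1..k}" "Q x" for x i
    using that
  proof (induction x i rule: tower.induct)
    case (3 x i)
    then have "Q (tower x (Suc i))" "Q (t (Suc i))"
      using rho[OF adj_perm[of "Suc i"]] by (auto simp: t_def)
    then show ?case
      using add mult by simp
  qed auto
  have letters: "Q (letter_image l)" if "l \<in> alphabet k" for l
    using that tower[OF _ X] tower[OF _ Y] rho Z by (auto simp: alphabet_def)
  have words: "Q (prod_list (map letter_image ls))" if "set ls \<subseteq> alphabet k" for ls
    using that by (induction ls) (auto intro: one mult letters)
  have sums: "Q (sum f A)" if "\<And>x. x \<in> A \<Longrightarrow> Q (f x)" for f :: "letter word \<Rightarrow> 'r" and A
    using that by (induction A rule: infinite_finite_induct) (auto intro: zero add)
  show ?thesis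
    unfolding eval_def using u by (intro sums mult scalars words) (simp add: keys_subset_letters)
qed

end

section \<open>The seminormal module\<close>

lemma central_scalars_op: "central_scalars (scalar_op :: complex \<Rightarrow> 'i op)"
proof
  fix c and r :: "'i op"
  show "scalar_op c * r = r * scalar_op c"
  proof (rule op_eqI)
    fix \<phi> :: "'i \<Rightarrow> complex" and x
    have "app (scalar_op c) \<phi> = (\<lambda>x. c * \<phi> x)"
      by auto
    then show "app (scalar_op c * r) \<phi> x = app (r * scalar_op c) \<phi> x"
      by (simp add: app_cmult_fun)
  qed
qed (rule op_eqI; simp add: algebra_simps)+

lemma sum_fun_apply: "(\<Sum>x\<in>A. f x) y = (\<Sum>x\<in>A. f x y)"
  by (induction A rule: infinite_finite_induct) auto

lemma span_basis_vec:
  assumes "finite B"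
  shows "cscale.span (basis_vec ` B) = {\<phi>. \<forall>T. T \<notin> B \<longrightarrow> \<phi> T = 0}"
proof
  have "cscale.subspace {\<phi>. \<forall>T. T \<notin> B \<longrightarrow> \<phi> T = 0}"
    by (rule cscale.subspaceI) (auto simp: cscale_def)
  then show "cscale.span (basis_vec ` B) \<subseteq> {\<phi>. \<forall>T. T \<notin> B \<longrightarrow> \<phi> T = 0}"
    by (intro cscale.span_minimal) (auto simp: basis_vec_def)
  show "{\<phi>. \<forall>T. T \<notin> B \<longrightarrow> \<phi> T = 0} \<subseteq> cscale.span (basis_vec ` B)"
  proof
    fix \<phi> :: "tableau \<Rightarrow> complex" assume "\<phi> \<in> {\<phi>. \<forall>T. T \<notin> B \<longrightarrow> \<phi> T = 0}"
    then have "\<phi> = (\<Sum>T\<in>B. cscale (\<phi> T) (basis_vec T))"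
      using assms by (auto simp: fun_eq_iff sum_fun_apply cscale_def basis_vec_def if_distrib[of "\<lambda>x. _ * x"] cong: if_cong)
    moreover have "(\<Sum>T\<in>B. cscale (\<phi> T) (basis_vec T)) \<in> cscale.span (basis_vec ` B)"
      by (intro cscale.span_sum cscale.span_scale cscale.span_base) auto
    ultimately show "\<phi> \<in> cscale.span (basis_vec ` B)"
      by simp
  qed
qed

lemma (in algebra_module) act_scale:
  assumes "g \<in> carrier R" "\<iota> c \<in> carrier R" "g \<otimes> \<iota> c = \<iota> c \<otimes> g" "u \<in> M"
  shows "act g (scl c u) = scl c (act g u)"
proof -
  have "act g (scl c u) = act (g \<otimes> \<iota> c) u"
    unfolding act_mult[OF assms(1,2,4)] act_scalar[OF assms(4)] ..
  also have "\<dots> = act (\<iota> c) (act g u)"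
    unfolding assms(3) act_mult[OF assms(2,1,4)] ..
  also have "\<dots> = scl c (act g u)"
    by (rule act_scalar[OF act_closed[OF assms(1,4)]])
  finally show ?thesis .
qed

context seminormal_parameters
begin

lemma finite_tableaux: "finite (Tab k lam)"
proof -
  let ?Q = "{mu. is_partition mu \<and> boxes mu \<subseteq> boxes lam}"
  have mem: "T \<in> {xs. set xs \<subseteq> ?Q \<and> length xs = k + 1}" and fin: "finite (boxes lam)" if T: "T \<in> Tab k lam" for T
  proof -
    have lam: "lam = T ! k"
      using T by (simp add: tableaux_iff)
    have up: "boxes (T ! (k - j)) \<subseteq> boxes lam" if "j \<le> k" for j
      using that
    proof (induction j)
      case (Suc j)
      let ?i = "k - Suc j"
      obtain r where "adds (T ! ?i) r (T ! Suc ?i)"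
        using tab_adds[OF T, of ?i] Suc.prems by auto
      moreover have "Suc ?i = k - j"
        using Suc.prems by simp
      ultimately show ?case
        using adds_boxes(1)[of "T ! ?i" r "T ! Suc ?i"] Suc by auto
    qed (simp add: lam)
    have "T ! i \<in> ?Q" if "i \<le> k" for i
      using up[of "k - i"] tableaux_partition[OF T that] that by simp
    moreover have len: "length T = k + 1"
      using T by (simp add: tableaux_iff)
    ultimately have "set T \<subseteq> ?Q"
      by (metis (no_types, lifting) Suc_eq_plus1 in_set_conv_nth less_Suc_eq_le subsetI)
    with len show "T \<in> {xs. set xs \<subseteq> ?Q \<and> length xs = k + 1}"
      by blast
    show "finite (boxes lam)"
      using finite_boxes tableaux_partition[OF T, of k] lam by simp
  qed
  have lists: "finite {xs. set xs \<subseteq> ?Q \<and> length xs = k + 1}" if "finite (boxes lam)"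
  proof (rule finite_lists_length_eq)
    show "finite ?Q"
    proof (rule inj_on_finite)
      show "inj_on boxes ?Q"
        using boxes_eq_imp_eq by (auto simp: inj_on_def)
      show "boxes ` ?Q \<subseteq> Pow (boxes lam)"
        by auto
    qed (use that in simp)
  qed
  show ?thesis
  proof (cases "Tab k lam = {}")
    case False
    then have "finite (boxes lam)"
      using fin by blast
    then have fl: "finite {xs. set xs \<subseteq> ?Q \<and> length xs = k + 1}"
      by (rule lists)
    have "Tab k lam \<subseteq> {xs. set xs \<subseteq> ?Q \<and> length xs = k + 1}"
      by (rule subsetI) (rule mem)
    then show ?thesis
      using fl by (rule finite_subset)
  qed simp
qed

lemma H_lam_eq: "H_lam k a b p q lam = {\<phi>. \<forall>T. T \<notin> Tab k lam \<longrightarrow> \<phi> T = 0}"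
  unfolding H_lam_def by (rule span_basis_vec[OF finite_tableaux])

lemma coefficients:
  assumes "1 \<le> k"
  shows "i \<in> {1..k-1} \<Longrightarrow> t_diag a b p q i T = t_coeff (weight k T i) (weight k T (Suc i))"
    "i \<in> {1..k-1} \<Longrightarrow> t_off a b p q i T = t_amp (weight k T i) (weight k T (Suc i))"
    "x_diag a b p q T = u (weight k T 1)" "x_off a b p q T = w (weight k T 1)"
  using assms
  by (auto simp: t_diag_def t_off_def t_coeff_def t_amp_def x_diag_def x_off_def x_coeff_def x_amp_def weight_def Let_def)

lemma s_tab_weight:
  assumes "T \<in> Tab k lam" "i \<in> {1..k-1}" "s_tab a b p q i T = Some S"
  shows "S \<in> Tab k lam" "weight k S = weight k T \<circ> adj i"
proof -
  have "i < k"
    using assms(2) by auto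
  then obtain S' where "s_tab a b p q i T = Some S'" "S' \<in> Tab k lam" "weight k S' = weight k T \<circ> adj i"
    using swap_tableau[OF assms(1,2) s_tab_far[OF assms(3)]] by blast
  then show "S \<in> Tab k lam" "weight k S = weight k T \<circ> adj i"
    using assms(3) by simp_all
qed

lemma s0_tab_weight:
  assumes "T \<in> Tab k lam" "1 \<le> k" "s0_tab a b p q T = Some S"
  shows "S \<in> Tab k lam" "weight k S = negate (weight k T)"
proof -
  obtain S' where "s0_tab a b p q T = Some S'" "S' \<in> Tab k lam" "weight k S' = negate (weight k T)"
    using negate_tableau[OF assms(1,2) s0_tab_special[OF assms(3,2)]] by blast
  then show "S \<in> Tab k lam" "weight k S = negate (weight k T)"
    using assms(3) by simp_all
qed

lemma s_tab_none:
  assumes "i \<in> {1..k-1}" "s_tab a b p q i T = None"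
  shows "t_amp (weight k T i) (weight k T (Suc i)) = 0"
proof (rule t_amp_zero)
  show "\<bar>weight k T (Suc i) - weight k T i\<bar> = 1"
    using assms by (auto simp: s_tab_def weight_def split: if_splits)
qed

lemma s0_tab_none: "1 \<le> k \<Longrightarrow> s0_tab a b p q T = None \<Longrightarrow> w (weight k T 1) = 0"
  by (rule special_w) (auto simp: s0_tab_def weight_def special_def split: if_splits)

text \<open>The representation on functions of weights is carried over to functions of tableaux
  along T \<mapsto> \<open>weight k T\<close>: \<open>up\<close> extends by zero,
  \<open>down\<close> restricts. Multiplicativity requires that every element preserves the
  functions vanishing outside \<open>V\<close>, and this is \<open>supp\<close>.\<close>

lemma module_exists:
  assumes k: "1 \<le> k"
  shows "\<exists>act. algebra_module (H_ext k a b p q) (\<lambda>c. H_class k a b p q (scal c)) cscale (H_lam k a b p q lam) act \<and>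
    seminormal_formulas k a b p q lam act"
proof -
  let ?Tab = "Tab k lam" and ?wt = "weight k" and ?H = "H_class k a b p q"
  let ?F = "F_alg k" and ?M = "H_lam k a b p q lam"
  define V where "V = ?wt ` ?Tab"
  interpret weight_set a b p q k V
    unfolding V_def by (rule weight_set_tableaux[OF k])
  obtain \<rho> where TB: "two_boundary_relations k \<rho> X Z" and \<rho>_adj: "\<And>i. i \<in> {1..k-1} \<Longrightarrow> \<rho> (adj i) = t i"
    and \<rho>_ind: "\<And>P w. w permutes {1..k} \<Longrightarrow> P 1 \<Longrightarrow> (\<And>r i. P r \<Longrightarrow> i \<in> {1..k-1} \<Longrightarrow> P (r * t i)) \<Longrightarrow> P (\<rho> w)"
    using representation by blast
  interpret TR: two_boundary_algebra k \<rho> X Z scalar_op a b p q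
  proof (intro two_boundary_algebra.intro TB two_boundary_algebra_axioms.intro)
    show "central_scalars (scalar_op :: complex \<Rightarrow> (nat \<Rightarrow> real) op)"
      by (rule central_scalars_op)
  qed (rule X_quadratic Y_quadratic)+
  obtain f where f: "f \<in> ring_hom (H_ext k a b p q) (ring_of TYPE((nat \<Rightarrow> real) op))"
    and f_class: "\<And>x. x \<in> carrier ?F \<Longrightarrow> f (?H x) = TR.ev x"
    using H_ext_universal[OF k TR.ev_hom TR.eval_diff TR.G_rel_ev TR.H_rel_ev] by blast
  define up :: "(tableau \<Rightarrow> complex) \<Rightarrow> (nat \<Rightarrow> real) \<Rightarrow> complex"
    where "up \<phi> c = (if c \<in> V then \<phi> (inv_into ?Tab ?wt c) else 0)" for \<phi> c
  define down :: "((nat \<Rightarrow> real) \<Rightarrow> complex) \<Rightarrow> tableau \<Rightarrow> complex"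
    where "down \<psi> T = (if T \<in> ?Tab then \<psi> (?wt T) else 0)" for \<psi> T
  define act where "act g \<phi> = down (app (f g) (up \<phi>))" for g \<phi>
  have inj: "inj_on ?wt ?Tab"
    using weight_inj by (auto simp: inj_on_def)
  have wtV: "?wt T \<in> V" if "T \<in> ?Tab" for T
    using that by (simp add: V_def)
  have up_wt: "up \<phi> (?wt T) = \<phi> T" if "T \<in> ?Tab" for \<phi> T
    using that inj wtV by (simp add: up_def)
  have down_M: "down \<psi> \<in> ?M" for \<psi>
    by (simp add: H_lam_eq down_def)
  have down_up: "down (up \<phi>) = \<phi>" if "\<phi> \<in> ?M" for \<phi>
    using that up_wt by (auto simp: H_lam_eq down_def fun_eq_iff)
  have up_down: "up (down \<psi>) = \<psi>" if "\<And>c. c \<notin> V \<Longrightarrow> \<psi> c = 0" for \<psi>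
  proof
    fix c
    show "up (down \<psi>) c = \<psi> c"
    proof (cases "c \<in> V")
      case True
      then obtain T where "T \<in> ?Tab" "c = ?wt T"
        by (auto simp: V_def)
      then show ?thesis
        using up_wt by (simp add: down_def)
    next
      case False
      then show ?thesis
        using that by (simp add: up_def)
    qed
  qed
  define supp where "supp G \<longleftrightarrow> (\<forall>\<psi>. (\<forall>c. c \<notin> V \<longrightarrow> \<psi> c = 0) \<longrightarrow> (\<forall>c. c \<notin> V \<longrightarrow> app G \<psi> c = 0))"
    for G :: "(nat \<Rightarrow> real) op"
  have supp_ev: "supp (TR.ev x)" if "x \<in> carrier ?F" for x
  proof (rule TR.ev_preserves[OF _ _ _ _ _ _ _ that])
    show "supp (\<rho> v)" if "v permutes {1..k}" for v
    proof (rule \<rho>_ind[OF that])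
      show "supp (r * t i)" if "supp r" for r i
        using that app_off(1) by (auto simp: supp_def)
    qed (simp add: supp_def)
  qed (auto simp: supp_def app_off)
  have up_off: "up \<phi> c = 0" if "c \<notin> V" for \<phi> c
    using that by (simp add: up_def)
  have supp_f: "app (f g) (up \<phi>) c = 0" if g: "g \<in> carrier (H_ext k a b p q)" and c: "c \<notin> V" for g c \<phi>
  proof -
    obtain x where "x \<in> carrier ?F" "g = ?H x"
      using H_class_surj[OF k g] by blast
    then show ?thesis
      using supp_ev[of x] f_class[of x] up_off c by (auto simp: supp_def)
  qed
  have "algebra_module (H_ext k a b p q) (\<lambda>c. ?H (scal c)) cscale ?M act"
  proof (intro algebra_module.intro algebra_module_axioms.intro H_ring[OF k] cscale.vector_space_axioms)
    show "cscale.subspace ?M"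
      by (simp add: H_lam_def)
    show "act g \<phi> \<in> ?M" for g \<phi>
      by (simp add: act_def down_M)
    show "act g (\<phi> + \<psi>) = act g \<phi> + act g \<psi>" for g \<phi> \<psi>
    proof -
      have "up (\<phi> + \<psi>) = (\<lambda>c. up \<phi> c + up \<psi> c)"
        by (auto simp: up_def)
      then show ?thesis
        by (auto simp: act_def down_def app_add_fun)
    qed
    show "act (g \<oplus>\<^bsub>H_ext k a b p q\<^esub> g') \<phi> = act g \<phi> + act g' \<phi>"
      if "g \<in> carrier (H_ext k a b p q)" "g' \<in> carrier (H_ext k a b p q)" for g g' \<phi>
      using ring_hom_add[OF f that] by (auto simp: act_def down_def)
    show "act (g \<otimes>\<^bsub>H_ext k a b p q\<^esub> g') \<phi> = act g (act g' \<phi>)"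
      if "g \<in> carrier (H_ext k a b p q)" "g' \<in> carrier (H_ext k a b p q)" for g g' \<phi>
    proof -
      have "up (act g' \<phi>) = app (f g') (up \<phi>)"
        unfolding act_def by (rule up_down) (rule supp_f[OF that(2)])
      then show ?thesis
        using ring_hom_mult[OF f that] by (simp add: act_def)
    qed
    show "act \<one>\<^bsub>H_ext k a b p q\<^esub> \<phi> = \<phi>" if "\<phi> \<in> ?M" for \<phi>
      using ring_hom_one[OF f] down_up[OF that] by (simp add: act_def)
    show "act (?H (scal c)) \<phi> = cscale c \<phi>" if "\<phi> \<in> ?M" for c \<phi>
    proof -
      have "act (?H (scal c)) \<phi> = down (\<lambda>x. c * up \<phi> x)"
        by (simp add: act_def f_class[OF free_scal] TR.eval_scal) (metis app_scalar_op)
      also have "\<dots> = cscale c (down (up \<phi>))"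
        by (auto simp: down_def cscale_def)
      finally show ?thesis
        using down_up[OF that] by simp
    qed
  qed
  moreover have "seminormal_formulas k a b p q lam act"
    unfolding seminormal_formulas_def
  proof (intro ballI conjI)
    fix T assume T: "T \<in> ?Tab"
    have up_basis: "up (basis_vec T) (?wt S) = (if S = T then 1 else 0)" if "S \<in> ?Tab" for S
      using up_wt[OF that] by (simp add: basis_vec_def)
    have outside: "basis_vec T S = 0" if "S \<notin> ?Tab" for S
      using T that by (auto simp: basis_vec_def)
    have up_other: "up (basis_vec T) c = (if c = ?wt T then 1 else 0)" for c
    proof (cases "c \<in> V")
      case True
      then obtain S where "S \<in> ?Tab" "c = ?wt S"
        by (auto simp: V_def)
      then show ?thesis
        using up_basis inj T by (auto simp: inj_on_def)
    next
      case False
      then show ?thesis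
        using up_off wtV[OF T] by auto
    qed
    have bv: "basis_vec S R = (if R = S then 1 else 0)" for S R
      by (simp add: basis_vec_def)
    \<comment> \<open>The operators act on coefficient functions, the formulas on basis vectors. The
      two matrices are transposes of each other and agree by symmetry, which is \<open>inv\<close>
      together with \<open>sym\<close>.\<close>
    have reflect: "act (?H l) (basis_vec T) = two_term (d (?wt T)) (e (?wt T)) T S'"
      if l: "\<And>c \<psi>. c \<in> V \<Longrightarrow> app (f (?H l)) \<psi> c = of_real (d c) * \<psi> c + of_real (e c) * \<psi> (\<sigma> c)"
        and inv: "\<And>c. \<sigma> (\<sigma> c) = c" and sym: "\<And>c. e (\<sigma> c) = e c"
        and some: "\<And>S. S' = Some S \<Longrightarrow> S \<in> ?Tab \<and> ?wt S = \<sigma> (?wt T)"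
        and none: "S' = None \<Longrightarrow> e (?wt T) = 0"
      for l d e \<sigma> S'
    proof
      fix R
      show "act (?H l) (basis_vec T) R = two_term (d (?wt T)) (e (?wt T)) T S' R"
      proof (cases "R \<in> ?Tab")
        case True
        have L: "act (?H l) (basis_vec T) R = of_real (d (?wt R)) * up (basis_vec T) (?wt R) +
            of_real (e (?wt R)) * up (basis_vec T) (\<sigma> (?wt R))"
          using True l[OF wtV[OF True]] by (simp add: act_def down_def)
        have e: "e (?wt R) = e (?wt T)" if "\<sigma> (?wt R) = ?wt T"
          using sym[of "?wt R"] that by simp
        show ?thesis
        proof (cases S')
          case None
          then show ?thesis
            unfolding L using none e up_basis[OF True] by (auto simp: two_term_def cscale_def bv up_other)
        next
          case (Some S)
          have "\<sigma> (?wt R) = ?wt T \<longleftrightarrow> R = S"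
            using some[OF Some] inv True inj by (metis inj_onD)
          then show ?thesis
            unfolding L using Some e up_basis[OF True] by (auto simp: two_term_def cscale_def bv up_other)
        qed
      next
        case False
        have "R \<noteq> T" "\<And>S. S' = Some S \<Longrightarrow> R \<noteq> S"
          using T some False by blast+
        then show ?thesis
          using False by (cases S') (simp_all add: act_def down_def two_term_def cscale_def bv)
      qed
    qed
    show "act (?H (ww a b p q i)) (basis_vec T) = cscale (of_real (cont a b p q T i)) (basis_vec T)"
      if "i \<in> {0..k}" for i
    proof -
      have "ww a b p q i \<in> carrier ?F"
        unfolding ww_def using that by (intro free_intros gen_letters)
      then have fH: "f (?H (ww a b p q i)) = Z i - scalar_op (of_real h)"
        by (simp add: f_class ww_def TR.ev_simps)
      have "app (f (?H (ww a b p q i))) (up (basis_vec T)) (?wt R)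
          = of_real (cont a b p q T i) * basis_vec T R" if R: "R \<in> ?Tab" for R
      proof -
        have "?wt R i = cont a b p q R i"
          using \<open>i \<in> {0..k}\<close> by (simp add: weight_def)
        then show ?thesis
          unfolding fH by (simp add: app_on(3)[OF wtV[OF R]] up_basis[OF R] bv)
      qed
      then show ?thesis
        using outside by (auto simp: act_def down_def cscale_def)
    qed
    show "act (?H (tt (adj i))) (basis_vec T) =
        two_term (t_diag a b p q i T) (t_off a b p q i T) T (s_tab a b p q i T)" if i: "i \<in> {1..k-1}" for i
      unfolding coefficients(1,2)[OF k i]
    proof (rule reflect[of _ "\<lambda>c. t_coeff (c i) (c (Suc i))" "\<lambda>c. t_amp (c i) (c (Suc i))"
          "\<lambda>c. c \<circ> adj i"])
      have "f (?H (tt (adj i))) = t i"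
        using f_class[OF tt_adj[OF i]] \<rho>_adj[OF i] by (simp add: TR.ev_simps)
      then show "app (f (?H (tt (adj i)))) \<psi> c = of_real (t_coeff (c i) (c (Suc i))) * \<psi> c +
          of_real (t_amp (c i) (c (Suc i))) * \<psi> (c \<circ> adj i)" if "c \<in> V" for c \<psi>
        using that by (simp add: app_on(1) swap_op_def)
      show "t_amp ((c \<circ> adj i) i) ((c \<circ> adj i) (Suc i)) = t_amp (c i) (c (Suc i))" for c
        using t_amp_swap[of "c (Suc i)"] by (simp add: adj_apply)
    qed (use s_tab_weight[OF T i] s_tab_none[OF i] in \<open>simp_all add: comp_def\<close>)
    show "act (?H (xx 1)) (basis_vec T) =
        two_term (x_diag a b p q T) (x_off a b p q T) T (s0_tab a b p q T)"
      unfolding coefficients(3,4)[OF k]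
    proof (rule reflect[of _ "\<lambda>c. u (c 1)" "\<lambda>c. w (c 1)" negate])
      have "f (?H (xx 1)) = X"
        using k by (simp add: f_class[OF gen_letters(2)] TR.ev_simps)
      then show "app (f (?H (xx 1))) \<psi> c = of_real (u (c 1)) * \<psi> c + of_real (w (c 1)) * \<psi> (negate c)"
        if "c \<in> V" for c \<psi>
        by (simp only: app_on(2)[OF that] neg_op_def)
    qed (use s0_tab_weight[OF T k] s0_tab_none[OF k] in \<open>simp_all add: x_amp_minus\<close>)
  qed
  ultimately show ?thesis
    by blast
qed

section \<open>Simplicity\<close>

lemma w_nonzero:
  assumes "admissible c" "\<not> special c"
  shows "w c \<noteq> 0"
proof
  assume "w c = 0"
  \<comment> \<open>The case c = 0 stems from the division by zero; if 0 is admissible, then D = 0,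
    so that 0 is special.\<close>
  then have "c = 0 \<or> special c"
    by (auto simp: x_amp_def special_def)
  then show False
    using assms by (auto simp: admissible_def special_def)
qed

lemma t_amp_nonzero: "1 \<le> \<bar>y - x\<bar> \<Longrightarrow> \<bar>y - x\<bar> \<noteq> 1 \<Longrightarrow> t_amp x y \<noteq> 0"
  by (auto simp: t_amp_def t_coeff_def power_divide abs_square_eq_1 divide_eq_1_iff)

lemma module_simple:
  assumes k: "1 \<le> k" and lam: "lam \<in> Pset a b p q k"
    and mod: "algebra_module (H_ext k a b p q) (\<lambda>c. H_class k a b p q (scal c)) cscale (H_lam k a b p q lam) act"
    and form: "seminormal_formulas k a b p q lam act"
  shows "simple_algebra_module (H_ext k a b p q) (\<lambda>c. H_class k a b p q (scal c)) cscale (H_lam k a b p q lam) act"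
proof -
  let ?R = "H_ext k a b p q" and ?H = "H_class k a b p q" and ?M = "H_lam k a b p q lam"
  let ?F = "F_alg k" and ?Tab = "Tab k lam"
  interpret algebra_module ?R "\<lambda>c. ?H (scal c)" cscale ?M act
    by (rule mod)
  have hom: "?H \<in> ring_hom ?F ?R"
    by (rule H_class_hom[OF k])
  have H_closed: "?H x \<in> carrier ?R" if "x \<in> carrier ?F" for x
    using ring_hom_closed[OF hom that] .
  have basis_M: "basis_vec T \<in> ?M" if "T \<in> ?Tab" for T
    unfolding H_lam_def using that by (intro cscale.span_base) simp
  \<comment> \<open>The module axioms provide additivity of \<open>act g\<close> and the action of
    scalars as elements of the algebra; complex linearity follows because scalars are
    central.\<close>
  have act_cscale: "act (?H x) (cscale c \<phi>) = cscale c (act (?H x) \<phi>)" if x: "x \<in> carrier ?F" and \<phi>: "\<phi> \<in> ?M" for x c \<phi>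
  proof (rule act_scale[OF H_closed[OF x] H_closed[OF free_scal] _ \<phi>])
    show "?H x \<otimes>\<^bsub>?R\<^esub> ?H (scal c) = ?H (scal c) \<otimes>\<^bsub>?R\<^esub> ?H x"
      using ring_hom_mult[OF hom x free_scal, of c] ring_hom_mult[OF hom free_scal x, of c]
      by (simp add: scal_central)
  qed
  have ww_carrier: "ww a b p q i \<in> carrier ?F" if "i \<in> {0..k}" for i
    unfolding ww_def using that by (intro free_intros gen_letters)
  have act_ww: "act (?H (ww a b p q i)) \<phi> = (\<lambda>T. of_real (cont a b p q T i) * \<phi> T)"
    if i: "i \<in> {0..k}" and \<phi>: "\<phi> \<in> ?M" for i \<phi>
  proof -
    let ?w = "?H (ww a b p q i)"
    note wc = H_closed[OF ww_carrier[OF i]]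
    have "\<phi> \<in> ?M \<and> act ?w \<phi> = (\<lambda>T. of_real (cont a b p q T i) * \<phi> T)"
      using \<phi>[unfolded H_lam_def]
    proof (induction rule: cscale.span_induct_alt)
      case base
      have "act ?w (cscale 0 0) = cscale 0 (act ?w 0)"
        by (rule act_cscale[OF ww_carrier[OF i]]) (rule cscale.subspace_0[OF subspace_M])
      then have "act ?w 0 = 0"
        by (simp only: cscale.scale_zero_left)
      then show ?case
        using cscale.subspace_0[OF subspace_M] by (simp add: zero_fun_def)
    next
      case (step c v \<psi>)
      then obtain T where T: "T \<in> ?Tab" "v = basis_vec T"
        by blast
      have v: "act ?w (cscale c v) = cscale c (cscale (of_real (cont a b p q T i)) (basis_vec T))"
        using act_cscale[OF ww_carrier[OF i] basis_M[OF T(1)]] form T i by (simp add: seminormal_formulas_def)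
      have cM: "cscale c v \<in> ?M"
        using cscale.subspace_scale[OF subspace_M basis_M[OF T(1)]] T(2) by simp
      have "act ?w (cscale c v + \<psi>) = act ?w (cscale c v) + act ?w \<psi>"
        using act_add_right[OF wc cM] step by blast
      moreover have IH: "act ?w \<psi> = (\<lambda>T. of_real (cont a b p q T i) * \<psi> T)" and \<psi>: "\<psi> \<in> ?M"
        using step by blast+
      ultimately have "act ?w (cscale c v + \<psi>) = (\<lambda>T. of_real (cont a b p q T i) * (cscale c v + \<psi>) T)"
        using v unfolding T(2) by (auto simp: cscale_def fun_eq_iff basis_vec_def algebra_simps)
      then show ?case
        using cscale.subspace_add[OF subspace_M cM \<psi>] by blast
    qed
    then show ?thesis by simp
  qed
  show ?thesis
  proof (intro simple_algebra_module.intro simple_algebra_module_axioms.intro mod)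
    obtain T where T: "T \<in> ?Tab"
      using tableaux_nonempty[OF lam] by blast
    have "basis_vec T \<noteq> 0"
      by (auto simp: basis_vec_def fun_eq_iff)
    then show "?M \<noteq> {0}"
      using basis_M[OF T] by auto
    fix N assume sub: "cscale.subspace N" and NM: "N \<subseteq> ?M"
      and closed: "\<And>g \<phi>. g \<in> carrier ?R \<Longrightarrow> \<phi> \<in> N \<Longrightarrow> act g \<phi> \<in> N"
    show "N = {0} \<or> N = ?M"
    proof (cases "N = {0}")
      case False
      define S where "S \<phi> = {T \<in> ?Tab. \<phi> T \<noteq> 0}" for \<phi> :: "tableau \<Rightarrow> complex"
      have fin: "finite (S \<phi>)" for \<phi>
        using finite_tableaux by (simp add: S_def)
      have S_empty: "S \<phi> \<noteq> {}" if "\<phi> \<in> N" "\<phi> \<noteq> 0" for \<phi>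
        using that NM by (auto simp: S_def H_lam_eq fun_eq_iff)
      obtain \<phi>0 where "\<phi>0 \<in> N" "\<phi>0 \<noteq> 0"
        using False cscale.subspace_0[OF sub] by blast
      \<comment> \<open>A vector of minimal support: if the support contained \<open>R\<close>
        besides \<open>T\<close>, some w_i - c_T(i) would annihilate the coefficient of
        \<open>T\<close> but not that of \<open>R\<close>.\<close>
      then obtain \<phi> where \<phi>: "\<phi> \<in> N" "\<phi> \<noteq> 0" and minimal: "\<And>\<psi>. \<psi> \<in> N \<Longrightarrow> \<psi> \<noteq> 0 \<Longrightarrow> card (S \<phi>) \<le> card (S \<psi>)"
        using ex_has_least_nat[of "\<lambda>\<psi>. \<psi> \<in> N \<and> \<psi> \<noteq> 0" \<phi>0 "\<lambda>\<psi>. card (S \<psi>)"] by blast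
      obtain T where T: "T \<in> ?Tab" "\<phi> T \<noteq> 0"
        using S_empty[OF \<phi>] by (auto simp: S_def)
      have only: "\<phi> R = 0" if "R \<noteq> T" for R
      proof (rule ccontr)
        assume R0: "\<phi> R \<noteq> 0"
        then have R: "R \<in> ?Tab"
          using \<phi>(1) NM by (auto simp: H_lam_eq)
        then have "weight k R \<noteq> weight k T"
          using weight_inj[OF R T(1)] that by blast
        then obtain i where i: "i \<in> {0..k}" "cont a b p q R i \<noteq> cont a b p q T i"
          by (auto simp: weight_def fun_eq_iff split: if_splits)
        define \<psi> where "\<psi> = act (?H (ww a b p q i)) \<phi> - cscale (of_real (cont a b p q T i)) \<phi>"
        have "\<psi> \<in> N"
          unfolding \<psi>_def
          by (intro cscale.subspace_diff[OF sub] closed[OF H_closed[OF ww_carrier[OF i(1)]] \<phi>(1)]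
              cscale.subspace_scale[OF sub \<phi>(1)])
        moreover have val: "\<psi> Q = of_real (cont a b p q Q i - cont a b p q T i) * \<phi> Q" for Q
          using act_ww[OF i(1)] \<phi>(1) NM by (auto simp: \<psi>_def cscale_def algebra_simps)
        moreover have "\<psi> R \<noteq> 0"
          using val[of R] i(2) R0 by simp
        then have "\<psi> \<noteq> 0"
          by auto
        moreover have "card (S \<psi>) < card (S \<phi>)"
        proof (rule psubset_card_mono[OF fin])
          have "T \<in> S \<phi>" "T \<notin> S \<psi>"
            using T val[of T] by (auto simp: S_def)
          moreover have "S \<psi> \<subseteq> S \<phi>"
            using val by (auto simp: S_def)
          ultimately show "S \<psi> \<subset> S \<phi>"
            by blast
        qed
        ultimately show False
          using minimal[of \<psi>] by linarith
      qed
      have "cscale (1 / \<phi> T) \<phi> = basis_vec T"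
        using T(2) only by (auto simp: cscale_def basis_vec_def)
      then have TN: "basis_vec T \<in> N"
        using cscale.subspace_scale[OF sub \<phi>(1), of "1 / \<phi> T"] by simp
      have partner: "basis_vec R \<in> N"
        if "basis_vec Q \<in> N" "act g (basis_vec Q) = two_term d e Q (Some R)" "g \<in> carrier ?R" "e \<noteq> 0" for Q R g d e
      proof -
        have "act g (basis_vec Q) - cscale (of_real d) (basis_vec Q) \<in> N"
          by (intro cscale.subspace_diff[OF sub] closed that cscale.subspace_scale[OF sub])
        then have "cscale (of_real e) (basis_vec R) \<in> N"
          unfolding that(2) two_term_def by simp
        then have "cscale (1 / of_real e) (cscale (of_real e) (basis_vec R)) \<in> N"
          by (rule cscale.subspace_scale[OF sub])
        moreover have "cscale (1 / of_real e) (cscale (of_real e) (basis_vec R)) = basis_vec R"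
          using that(4) by (auto simp: cscale_def)
        ultimately show ?thesis by simp
      qed
      have stepN: "basis_vec R \<in> N" if Q: "basis_vec Q \<in> N" and st: "step k lam Q R" for Q R
      proof -
        have QT: "Q \<in> ?Tab"
          using st by (simp add: step_def)
        consider i where "i \<in> {1..k-1}" "s_tab a b p q i Q = Some R" | "s0_tab a b p q Q = Some R"
          using st by (auto simp: step_def)
        then show ?thesis
        proof cases
          case 1
          have "i < k"
            using 1(1) by auto
          then have "t_off a b p q i Q \<noteq> 0"
            using t_amp_nonzero[OF _ s_tab_far[OF 1(2)]] tab_gap1[OF QT 1(1)]
            by (simp only: coefficients[OF k] 1(1) gap_def) simp
          moreover have "act (?H (tt (adj i))) (basis_vec Q) = two_term (t_diag a b p q i Q) (t_off a b p q i Q) Q (Some R)"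
            using form QT 1 by (simp add: seminormal_formulas_def)
          ultimately show ?thesis
            using partner[OF Q] H_closed[OF tt_adj[OF 1(1)]] by blast
        next
          case 2
          have "x_off a b p q Q \<noteq> 0"
            using w_nonzero[OF _ s0_tab_special[OF 2 k]] first_box[OF QT k] P_box_shifted(1)
            by (metis coefficients(4)[OF k])
          moreover have "act (?H (xx 1)) (basis_vec Q) = two_term (x_diag a b p q Q) (x_off a b p q Q) Q (Some R)"
            using form QT 2 by (simp add: seminormal_formulas_def)
          moreover have "xx 1 \<in> carrier ?F"
            by (rule gen_letters(2)) (use k in auto)
          ultimately show ?thesis
            using partner[OF Q] H_closed by blast
        qed
      qed
      have "basis_vec R \<in> N" if "R \<in> ?Tab" for R
        using connected[OF T(1) that k]
        by (induction rule: rtranclp_induct) (use TN stepN in auto)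
      then have "?M \<subseteq> N"
        unfolding H_lam_def by (intro cscale.span_minimal[OF _ sub]) auto
      then show ?thesis
        using NM by blast
    qed simp
  qed
qed

end

text \<open>The formulas prescribe the action of the generators w_i, x_1 and t_{s_i} on basis
  vectors. That an action with these values exists is thus a claim of its own, and simplicity is
  asserted for every such action.\<close>

theorem theorem5p3:
  fixes k a b p q :: nat and lam :: partition
  assumes "k \<ge> 1" and "a > 0" and "b > 0" and "p > 0" and "q > 0" and "q \<le> p"
    and "lam \<in> Pset a b p q k"
  shows "(\<exists>act. algebra_module (H_ext k a b p q) (\<lambda>c. H_class k a b p q (scal c))
              cscale (H_lam k a b p q lam) act \<and>
            seminormal_formulas k a b p q lam act) \<and>
         (\<forall>act. algebra_module (H_ext k a b p q) (\<lambda>c. H_class k a b p q (scal c))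
              cscale (H_lam k a b p q lam) act \<and>
            seminormal_formulas k a b p q lam act \<longrightarrow>
            simple_algebra_module (H_ext k a b p q) (\<lambda>c. H_class k a b p q (scal c))
              cscale (H_lam k a b p q lam) act)"
proof -
  interpret seminormal_parameters a b p q
    using assms by unfold_locales
  show ?thesis
    using module_exists[OF assms(1)] module_simple[OF assms(1,7)] by blast
qed

end
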